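(* Let $(\theta_i)_{i\ge 1}$ be i.i.d. random vectors with law $\sigma$ on $\mathbb{S}^{d-1}$, and for $p\ge1$ let $\mathcal{E}_p$ be built from $\theta_1,\dots,\theta_p$. Let $\mathcal{K}\subset\mathbb{R}^{n\times d}$ be a non-empty compact set. Then, as $p\to+\infty$, the random process $\sqrt p(\mathcal{E}_p-\mathcal{E})$ on $\mathcal{K}$ converges in law, in the space $\ell^\infty(\mathcal{K})$ of bounded functions $\mathcal{K}\to\mathbb{R}$ equipped with the uniform norm, to the centred Gaussian process $G$ on $\mathcal{K}$ with covariance $$\mathrm{Cov}(G(Y),G(Y'))=\int_{\mathbb{S}^{d-1}}w_\theta(Y)w_\theta(Y')\,d\sigma(\theta)-\mathcal{E}(Y)\mathcal{E}(Y'),\qquad Y,Y'\in\mathcal{K}.$$ This implies the convergence in law of the uniform error: $\sqrt p\,\|\mathcal{E}_p-\mathcal{E}\|_{\ell^\infty(\mathcal{K})}\to\|G\|_{\ell^\infty(\mathcal{K})}$ in law as $p\to+\infty$.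
   Context: Let $n,d\ge1$. A matrix $Y\in\mathbb{R}^{n\times d}$ is written $Y=(y_1,\dots,y_n)^T$ with rows $y_k\in\mathbb{R}^d$, and $\gamma_Y:=\frac1n\sum_{k=1}^n\delta_{y_k}$. Fix $Z\in\mathbb{R}^{n\times d}$. $\sigma$ denotes the uniform probability measure on the unit sphere $\mathbb{S}^{d-1}$ of $\mathbb{R}^d$, $P_\theta(x)=\theta^Tx$, $\#$ is push-forward, and $\mathrm{W}_2$ is the 2-Wasserstein distance. Define $w_\theta(Y):=\mathrm{W}_2^2(P_\theta\#\gamma_Y,P_\theta\#\gamma_Z)$, $\mathcal{E}(Y):=\int_{\mathbb{S}^{d-1}}w_\theta(Y)\,d\sigma(\theta)$, and, for directions $\theta_1,\dots,\theta_p\in\mathbb{S}^{d-1}$, $\mathcal{E}_p(Y):=\frac1p\sum_{i=1}^p w_{\theta_i}(Y)$. Convergence in law in $\ell^\infty(\mathcal{K})$ is understood in the usual sense of empirical process theory (convergence of outer expectations of bounded continuous functionals, with tight limit). *)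

theory Defs
  imports "HOL-Probability.Probability"
begin

section \<open>The sliced Wasserstein energies\<close>

definition couplings ::
  "'a::{metric_space, second_countable_topology} measure \<Rightarrow> 'a measure \<Rightarrow> ('a \<times> 'a) measure set" where
  "couplings \<mu> \<nu> = {\<pi>. sets \<pi> = sets (borel \<Otimes>\<^sub>M borel) \<and> distr \<pi> borel fst = \<mu> \<and> distr \<pi> borel snd = \<nu>}"

text \<open>
  Meaningful for Borel probability measures with finite second moment: there the infimum is finite,
  so that the conversion to real numbers is harmless.
\<close>
definition W2 ::
  "'a::{metric_space, second_countable_topology} measure \<Rightarrow> 'a measure \<Rightarrow> real" where
  "W2 \<mu> \<nu> = sqrt (enn2real (INF \<pi> \<in> couplings \<mu> \<nu>. \<integral>\<^sup>+z. ennreal ((dist (fst z) (snd z))\<^sup>2) \<partial>\<pi>))"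

text \<open>
  A matrix \<open>Y :: real^'d^'n\<close> has rows \<open>Y $ k\<close>. The image of the uniform probability
  measure on the index type is the empirical measure of the rows, counted with multiplicity.
\<close>
definition empirical_measure :: "real^'d^'n \<Rightarrow> (real^'d) measure" where
  "empirical_measure Y = distr (uniform_count_measure UNIV) borel (\<lambda>k. Y $ k)"

definition projected_measure :: "real^'d \<Rightarrow> (real^'d) measure \<Rightarrow> real measure" where
  "projected_measure \<theta> \<mu> = distr \<mu> borel (\<lambda>x. \<theta> \<bullet> x)"

definition w :: "real^'d^'n \<Rightarrow> real^'d \<Rightarrow> real^'d^'n \<Rightarrow> real" where
  "w Z \<theta> Y = (W2 (projected_measure \<theta> (empirical_measure Y))
                  (projected_measure \<theta> (empirical_measure Z)))\<^sup>2"

text \<open>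
  The uniform probability measure on the unit sphere as the law of \<open>x / norm x\<close>, \<open>x\<close> uniform in
  the unit ball. It lives on the Borel sets of the sphere; the origin, which
  \<^const>\<open>sgn\<close> sends to the origin, is a null set.
\<close>
definition sphere_uniform :: "(real^'d) measure" where
  "sphere_uniform = restrict_space (distr (uniform_measure lborel (ball 0 1)) borel sgn) (sphere 0 1)"

lemma space_sphere_uniform [simp]: "space (sphere_uniform :: (real^'d) measure) = sphere 0 1"
  by (simp add: sphere_uniform_def space_restrict_space)

lemma sets_sphere_uniform [simp, measurable_cong]:
  "sets (sphere_uniform :: (real^'d) measure) = sets (restrict_space borel (sphere 0 1))"
  by (simp add: sphere_uniform_def sets_restrict_space)

lemma prob_space_sphere_uniform: "prob_space (sphere_uniform :: (real^'d) measure)"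
proof
  let ?U = "uniform_measure lborel (ball 0 1 :: (real^'d) set)"
  have ball: "emeasure lborel (ball 0 1 :: (real^'d) set) \<noteq> 0"
             "emeasure lborel (ball 0 1 :: (real^'d) set) \<noteq> \<infinity>"
    using content_ball_pos[of 1 "0 :: real^'d"] emeasure_lborel_ball_finite[of "0 :: real^'d" 1]
    by (auto simp: measure_def)
  have meas: "sgn \<in> borel_measurable (borel :: (real^'d) measure)"
    by (simp add: sgn_div_norm[abs_def])
  have vim: "(sgn :: real^'d \<Rightarrow> _) -` sphere 0 1 = - {0}"
    by (auto simp: norm_sgn)
  have "emeasure ?U (- {0}) = emeasure lborel (ball 0 1 \<inter> - {0} :: (real^'d) set)
          / emeasure lborel (ball 0 1 :: (real^'d) set)"
    by (rule emeasure_uniform_measure) auto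
  also have "emeasure lborel (ball 0 1 \<inter> - {0} :: (real^'d) set) = emeasure lborel (ball 0 1 :: (real^'d) set)"
    using emeasure_Diff_null_set[of "{0 :: real^'d}" lborel "ball 0 1"]
    by (simp add: Diff_eq null_sets_def)
  finally have 1: "emeasure ?U (- {0}) = 1"
    using ball by (simp add: ennreal_divide_self top.not_eq_extremum)
  have "emeasure (sphere_uniform :: (real^'d) measure) (sphere 0 1)
          = emeasure (distr ?U borel sgn) (sphere 0 1)"
    unfolding sphere_uniform_def by (subst emeasure_restrict_space) auto
  also have "\<dots> = emeasure ?U (- {0})"
    using meas by (subst emeasure_distr) (auto simp: vim)
  finally show "emeasure (sphere_uniform :: (real^'d) measure) (space sphere_uniform) = 1"
    using 1 by simp
qed

definition \<E> :: "real^'d^'n \<Rightarrow> real^'d^'n \<Rightarrow> real" where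
  "\<E> Z Y = (LINT \<theta>|sphere_uniform. w Z \<theta> Y)"

definition \<E>_emp :: "real^'d^'n \<Rightarrow> (nat \<Rightarrow> real^'d) \<Rightarrow> nat \<Rightarrow> real^'d^'n \<Rightarrow> real" where
  "\<E>_emp Z \<theta> p Y = (1 / real p) * (\<Sum>i<p. w Z (\<theta> i) Y)"


section \<open>Convergence in law in spaces of bounded functions\<close>

text \<open>
  Functions on \<open>K\<close> are represented by extensional functions, so \<open>linf K\<close> consists of the bounded
  functions on \<open>K\<close> (with value \<^const>\<open>undefined\<close> off \<open>K\<close>) under the uniform distance.
\<close>
abbreviation linf :: "'i set \<Rightarrow> ('i \<Rightarrow> real) metric" where
  "linf K \<equiv> funspace K euclidean_metric"

lemma mspace_linf: "mspace (linf K) = {f \<in> extensional K. bounded (f ` K)}"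
  unfolding funspace_def mspace_euclidean_metric mdist_euclidean_metric
    Metric_space.mspace_metric[OF Met_TC.Metric_space_funspace]
  by (auto simp: Met_TC.fspace_def Met_TC.mbounded_def bounded_def subset_iff)

lemma mdist_linf:
  assumes "f \<in> mspace (linf K)" "g \<in> mspace (linf K)" "K \<noteq> {}"
  shows "mdist (linf K) f g = (SUP x\<in>K. \<bar>f x - g x\<bar>)"
  using assms
  unfolding funspace_def mspace_euclidean_metric mdist_euclidean_metric
    Metric_space.mspace_metric[OF Met_TC.Metric_space_funspace]
    Metric_space.mdist_metric[OF Met_TC.Metric_space_funspace]
  by (simp add: Met_TC.fdist_def dist_real_def)

definition linf_norm :: "'i set \<Rightarrow> ('i \<Rightarrow> real) \<Rightarrow> real" where
  "linf_norm K f = (SUP x\<in>K. \<bar>f x\<bar>)"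

definition linf_borel :: "'i set \<Rightarrow> ('i \<Rightarrow> real) measure" where
  "linf_borel K = sigma (mspace (linf K)) {U. openin (mtopology_of (linf K)) U}"

definition linf_tight :: "'i set \<Rightarrow> ('i \<Rightarrow> real) measure \<Rightarrow> bool" where
  "linf_tight K L \<longleftrightarrow>
     (\<forall>\<epsilon>>0. \<exists>C. compactin (mtopology_of (linf K)) C \<and> measure L C \<ge> 1 - \<epsilon>)"

text \<open>
  Only used for bounded \<open>T\<close>; then restricting the majorants to integrable real-valued functions
  (instead of extended-real-valued ones whose integral exists) does not change the infimum.
\<close>
definition outer_expectation :: "'a measure \<Rightarrow> ('a \<Rightarrow> real) \<Rightarrow> real" where
  "outer_expectation M T =
     (INF U \<in> {U. integrable M U \<and> (\<forall>\<omega>\<in>space M. T \<omega> \<le> U \<omega>)}. LINT \<omega>|M. U \<omega>)"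

text \<open>
  The \<open>X p\<close> are arbitrary maps into \<open>linf K\<close>, the limit \<open>G\<close> is a tight Borel random element;
  convergence is that of outer expectations of bounded continuous functionals.
\<close>
definition converges_in_law_linf ::
  "'i set \<Rightarrow> 'a measure \<Rightarrow> (nat \<Rightarrow> 'a \<Rightarrow> 'i \<Rightarrow> real) \<Rightarrow> 'b measure \<Rightarrow> ('b \<Rightarrow> 'i \<Rightarrow> real) \<Rightarrow> bool" where
  "converges_in_law_linf K M X N G \<longleftrightarrow>
     (\<forall>p. \<forall>\<omega>\<in>space M. X p \<omega> \<in> mspace (linf K)) \<and>
     G \<in> measurable N (linf_borel K) \<and>
     linf_tight K (distr N (linf_borel K) G) \<and>
     (\<forall>H. continuous_map (mtopology_of (linf K)) euclideanreal H \<and> bounded (H ` mspace (linf K)) \<longrightarrow>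
        (\<lambda>p. outer_expectation M (\<lambda>\<omega>. H (X p \<omega>))) \<longlonglongrightarrow> (LINT \<omega>|N. H (G \<omega>)))"

definition converges_in_law ::
  "'a measure \<Rightarrow> (nat \<Rightarrow> 'a \<Rightarrow> real) \<Rightarrow> 'b measure \<Rightarrow> ('b \<Rightarrow> real) \<Rightarrow> bool" where
  "converges_in_law M X N Y \<longleftrightarrow>
     (\<forall>p. X p \<in> borel_measurable M) \<and> Y \<in> borel_measurable N \<and>
     weak_conv_m (\<lambda>p. distr M borel (X p)) (distr N borel Y)"


section \<open>Gaussian processes\<close>

text \<open>Dirac measures count as (degenerate) Gaussian measures.\<close>
definition gaussian_measure :: "real measure \<Rightarrow> bool" where
  "gaussian_measure \<mu> \<longleftrightarrow>
     (\<exists>m. \<mu> = return borel m) \<or>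
     (\<exists>m s. s > 0 \<and> \<mu> = density lborel (\<lambda>x. ennreal (normal_density m s x)))"

definition gaussian_process :: "'b measure \<Rightarrow> 'i set \<Rightarrow> ('b \<Rightarrow> 'i \<Rightarrow> real) \<Rightarrow> bool" where
  "gaussian_process N K G \<longleftrightarrow>
     (\<forall>x\<in>K. (\<lambda>\<omega>. G \<omega> x) \<in> borel_measurable N) \<and>
     (\<forall>F a. finite F \<and> F \<subseteq> K \<longrightarrow> gaussian_measure (distr N borel (\<lambda>\<omega>. \<Sum>x\<in>F. a x * G \<omega> x)))"

definition covariance :: "'b measure \<Rightarrow> ('b \<Rightarrow> real) \<Rightarrow> ('b \<Rightarrow> real) \<Rightarrow> real" where
  "covariance N U V =
     (LINT \<omega>|N. (U \<omega> - (LINT \<omega>'|N. U \<omega>')) * (V \<omega> - (LINT \<omega>'|N. V \<omega>')))"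

end

(* Couplings of two uniform measures on n points reduce to n x n matrices, ranging over a set that
depends on neither theta nor Y, so w_theta(Y) is an infimum of functions that are Lipschitz in Y and
in theta with a common constant. The class of functions theta -> w_theta(Y), Y in K, is therefore
bounded and Lipschitz in its finite-dimensional parameter, and a Donsker theorem follows by chaining
along nets of mesh 2^-j whose cardinality is polynomial in 2^j: Hoeffding's inequality for the
empirical process and the Gaussian tail for the limit give the same sub-Gaussian bounds, so both live,
up to small probability, on one compact set of equicontinuous functions.

Instead of reducing to finite dimensions, a bounded continuous functional is approximated on this
compact set (Stone-Weierstrass) by trigonometric polynomials in finitely many evaluations; their
expectations converge by the one-dimensional central limit theorem. The limit process is built on a
countable dense set from i.i.d. normals, by an infinite Cholesky factorisation of the covariance, and
extended to K by the same chaining bound. *)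

theory Submission
  imports Defs
begin

section \<open>Kernels, normal laws and the central limit theorem\<close>

text \<open>For infinite K the space \<open>linf K\<close> is not separable, so neither convergence
  of finite-dimensional laws nor measurability of all evaluations settles what happens to an
  arbitrary continuous functional. Both difficulties disappear on a set of functions with a common
  bound and a common modulus of continuity: it is compact, the uniform topology on it is that of
  pointwise convergence, and countably many evaluations separate its elements. For fixed p all
  sample paths lie in one such set, because the empirical process inherits the Lipschitz bound. That
  set deteriorates as p grows, but it makes the process Borel measurable, so that outer expectations
  become expectations; uniformity in p holds only with high probability and comes from chaining.
  Products of cosines of linear forms are again sums of such cosines, so the test functions form an
  algebra, and the expectation of each cosine is the real part of a characteristic function of one
  scalar sum. This is how scalar limits suffice.\<close>

definition psd_kernel :: "('a \<Rightarrow> 'a \<Rightarrow> real) \<Rightarrow> bool" where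
  "psd_kernel C \<longleftrightarrow> (\<forall>k l. C k l = C l k) \<and>
     (\<forall>F a. finite F \<longrightarrow> 0 \<le> (\<Sum>k\<in>F. \<Sum>l\<in>F. a k * a l * C k l))"

lemma psd_kernel_sym: "psd_kernel C \<Longrightarrow> C k l = C l k"
  by (simp add: psd_kernel_def)

lemma psd_kernel_nonneg: "psd_kernel C \<Longrightarrow> finite F \<Longrightarrow> 0 \<le> (\<Sum>k\<in>F. \<Sum>l\<in>F. a k * a l * C k l)"
  by (simp add: psd_kernel_def)

lemma psd_kernel_diag_nonneg: "psd_kernel C \<Longrightarrow> 0 \<le> C j j"
  using psd_kernel_nonneg[of C "{j}" "\<lambda>_. 1"] by simp

text \<open>The degenerate case of Cauchy-Schwarz: when the diagonal entry vanishes, the form at the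
  k-th unit vector plus s times the j-th is affine in s, and a non-zero slope would make it negative
  somewhere.\<close>

lemma psd_kernel_diag_zero:
  assumes "psd_kernel C" and "C j j = 0"
  shows "C k j = 0"
proof (rule ccontr)
  assume nz: "C k j \<noteq> 0"
  with assms(2) have "k \<noteq> j" by auto
  \<comment> \<open>Solves \<open>C k k + 2 * s * C k j = -1\<close>.\<close>
  define s where "s = - (C k k + 1) / (2 * C k j)"
  define a where "a = (\<lambda>i. if i = j then s else 1)"
  have "0 \<le> (\<Sum>i\<in>{k, j}. \<Sum>l\<in>{k, j}. a i * a l * C i l)"
    by (rule psd_kernel_nonneg[OF assms(1)]) simp
  also have "\<dots> = C k k + s * C k j + s * C j k"
    using \<open>k \<noteq> j\<close> assms(2) by (simp add: a_def)
  also have "C j k = C k j" by (rule psd_kernel_sym[OF assms(1)])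
  also have "C k k + s * C k j + s * C k j = -1"
    using nz by (simp add: s_def field_simps)
  finally show False by simp
qed

text \<open>For a positive pivot the new form at a is the minimum over s of the old form at a
  shifted by s in direction j. For a zero pivot, division by zero returns 0 and the kernel stays as
  it is.\<close>

lemma psd_kernel_Schur_complement:
  assumes C: "psd_kernel C"
  shows "psd_kernel (\<lambda>k l. C k l - C k j * C l j / C j j)"
  unfolding psd_kernel_def
proof (intro conjI allI impI)
  have sym: "C k l = C l k" for k l by (rule psd_kernel_sym[OF C])
  show "C k l - C k j * C l j / C j j = C l k - C l j * C k j / C j j" for k l
    using sym[of k l] by simp
  fix F :: "'a set" and a :: "'a \<Rightarrow> real"
  assume F: "finite F"
  \<comment> \<open>The pivot j may lie outside F; it is adjoined, and the coefficients are extended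
    by zero.\<close>
  define F' where "F' = insert j F"
  define b where "b = (\<lambda>k. if k \<in> F then a k else 0)"
  define B where "B = (\<Sum>k\<in>F'. b k * C k j)"
  define Q where "Q = (\<Sum>k\<in>F'. \<Sum>l\<in>F'. b k * b l * C k l)"
  have F': "finite F'" "j \<in> F'" using F by (auto simp: F'_def)
  have ext: "(\<Sum>k\<in>F. a k * g k) = (\<Sum>k\<in>F'. b k * g k)" for g
    using F by (intro sum.mono_neutral_cong_left) (auto simp: F'_def b_def)
  have B: "B = (\<Sum>k\<in>F. a k * C k j)" by (simp add: B_def ext)
  have Q: "Q = (\<Sum>k\<in>F. \<Sum>l\<in>F. a k * a l * C k l)"
  proof -
    have "(\<Sum>k\<in>F. \<Sum>l\<in>F. a k * a l * C k l) = (\<Sum>k\<in>F. a k * (\<Sum>l\<in>F. a l * C k l))"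
      by (simp add: sum_distrib_left mult.assoc)
    also have "\<dots> = Q"
      unfolding ext Q_def by (simp add: sum_distrib_left mult.assoc)
    finally show ?thesis by simp
  qed
  have goal: "(\<Sum>k\<in>F. \<Sum>l\<in>F. a k * a l * (C k l - C k j * C l j / C j j)) = Q - B * B / C j j"
  proof -
    have "B * B / C j j = (\<Sum>k\<in>F. \<Sum>l\<in>F. a k * a l * (C k j * C l j / C j j))"
      unfolding B sum_product sum_divide_distrib by (intro sum.cong refl) simp
    then show ?thesis
      unfolding Q by (simp add: right_diff_distrib sum_subtractf)
  qed
  show "0 \<le> (\<Sum>k\<in>F. \<Sum>l\<in>F. a k * a l * (C k l - C k j * C l j / C j j))"
  proof (cases "C j j = 0")
    case True
    then show ?thesis unfolding goal Q using psd_kernel_nonneg[OF C F] by simp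
  next
    case False
    \<comment> \<open>The minimiser of the quadratic
      \<open>Q + 2 * s * B + s * s * C j j\<close>.\<close>
    define s where "s = - B / C j j"
    define d where "d = (\<lambda>k. if k = j then 1 else 0 :: real)"
    have d: "(\<Sum>k\<in>F'. d k * g k) = g j" for g
    proof -
      have "(\<Sum>k\<in>F'. d k * g k) = (\<Sum>k\<in>F'. if k = j then g k else 0)"
        by (intro sum.cong) (auto simp: d_def)
      then show ?thesis using F' by simp
    qed
    have "0 \<le> (\<Sum>k\<in>F'. \<Sum>l\<in>F'. (b k + s * d k) * (b l + s * d l) * C k l)"
      by (rule psd_kernel_nonneg[OF C F'(1)])
    also have "\<dots> = (\<Sum>k\<in>F'. \<Sum>l\<in>F'. b k * b l * C k l + s * (b k * (d l * C k l))
        + s * (d k * (b l * C k l)) + s * s * (d k * (d l * C k l)))"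
      by (intro sum.cong refl) (simp add: algebra_simps)
    also have "\<dots> = Q + s * (\<Sum>k\<in>F'. b k * (\<Sum>l\<in>F'. d l * C k l))
        + s * (\<Sum>k\<in>F'. d k * (\<Sum>l\<in>F'. b l * C k l)) + s * s * (\<Sum>k\<in>F'. d k * (\<Sum>l\<in>F'. d l * C k l))"
      unfolding Q_def by (simp add: sum.distrib sum_distrib_left)
    also have "\<dots> = Q + s * B + s * B + s * s * C j j"
    proof -
      have "(\<Sum>l\<in>F'. b l * C j l) = B"
        unfolding B_def by (intro sum.cong refl arg_cong2[where f = times] sym)
      moreover have "(\<Sum>k\<in>F'. b k * C k j) = B" by (simp add: B_def)
      ultimately show ?thesis unfolding d by (simp only:)
    qed
    also have "\<dots> = Q - B * B / C j j"
      using False by (simp add: s_def field_simps)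
    finally show ?thesis unfolding goal .
  qed
qed

text \<open>The kernel left after eliminating the indices below j; for a Gaussian family this is the
  conditional covariance given the first j variables.\<close>

fun Schur_iterate :: "(nat \<Rightarrow> nat \<Rightarrow> real) \<Rightarrow> nat \<Rightarrow> nat \<Rightarrow> nat \<Rightarrow> real" where
  "Schur_iterate C 0 = C"
| "Schur_iterate C (Suc j) =
     (\<lambda>k l. Schur_iterate C j k l - Schur_iterate C j k j * Schur_iterate C j l j / Schur_iterate C j j j)"

text \<open>An eliminated column stays zero: in later steps both the entry and the correction
  vanish, the latter by symmetry. At a zero pivot the column is already zero by
  \<open>psd_kernel_diag_zero\<close>, so degenerate kernels cause no exception.\<close>

lemma Schur_iterate:
  assumes "psd_kernel C"
  shows psd_kernel_Schur_iterate: "psd_kernel (Schur_iterate C j)"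
    and Schur_iterate_eq_0: "i < j \<Longrightarrow> Schur_iterate C j k i = 0"
proof -
  have "psd_kernel (Schur_iterate C j) \<and> (\<forall>i<j. \<forall>k. Schur_iterate C j k i = 0)"
  proof (induction j)
    case 0
    then show ?case using assms by simp
  next
    case (Suc j)
    let ?S = "Schur_iterate C j"
    have psd: "psd_kernel ?S" and z: "\<And>i k. i < j \<Longrightarrow> ?S k i = 0"
      using Suc.IH by auto
    have sym: "?S k l = ?S l k" for k l by (rule psd_kernel_sym[OF psd])
    have "Schur_iterate C (Suc j) k i = 0" if "i < Suc j" for i k
    proof (cases "i = j")
      case True
      then show ?thesis
        using psd_kernel_diag_zero[OF psd, of j k] by (cases "?S j j = 0") simp_all
    next
      case False
      then have "i < j" using that by simp
      then have "?S k i = 0" "?S i j = 0" using z sym[of i j] by (simp_all only:)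
      then show ?thesis by simp
    qed
    moreover have "psd_kernel (Schur_iterate C (Suc j))"
      unfolding Schur_iterate.simps by (rule psd_kernel_Schur_complement[OF psd])
    ultimately show ?case by blast
  qed
  then show "psd_kernel (Schur_iterate C j)" "i < j \<Longrightarrow> Schur_iterate C j k i = 0" by auto
qed

text \<open>Each Schur step splits off a kernel of rank at most one, so C is a sum of n such kernels
  plus a residual whose k-th row vanishes once k < n. Triangularity is what later turns every
  Gaussian variable into a finite combination of independent normals.\<close>

lemma infinite_Cholesky:
  assumes C: "psd_kernel C"
  obtains L :: "nat \<Rightarrow> nat \<Rightarrow> real" where "\<And>k j. k < j \<Longrightarrow> L k j = 0"
    "\<And>k l n. k < n \<Longrightarrow> C k l = (\<Sum>j<n. L k j * L l j)"
proof -
  define L where "L = (\<lambda>k j. Schur_iterate C j k j / sqrt (Schur_iterate C j j j))"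
  have sym: "Schur_iterate C j k l = Schur_iterate C j l k" for j k l
    by (rule psd_kernel_sym[OF psd_kernel_Schur_iterate[OF C]])
  have LL: "L k j * L l j = Schur_iterate C j k j * Schur_iterate C j l j / Schur_iterate C j j j" for k l j
    using psd_kernel_diag_nonneg[OF psd_kernel_Schur_iterate[OF C, of j], of j] by (simp add: L_def)
  have *: "C k l = Schur_iterate C n k l + (\<Sum>j<n. L k j * L l j)" for n k l
    by (induction n) (simp_all add: LL)
  show ?thesis
  proof (rule that)
    show "L k j = 0" if "k < j" for k j
      using Schur_iterate_eq_0[OF C that, of j] sym[of j k j] by (simp add: L_def)
    show "C k l = (\<Sum>j<n. L k j * L l j)" if "k < n" for k l n
      using *[of k l n] Schur_iterate_eq_0[OF C that, of l] sym[of n k l] by simp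
  qed
qed

section \<open>Centred normal laws, including variance zero\<close>

definition centred_normal :: "real \<Rightarrow> real measure" where
  "centred_normal v = (if v = 0 then return borel 0 else density lborel (normal_density 0 (sqrt v)))"

lemma char_distr_scale:
  assumes "U \<in> borel_measurable M"
  shows "char (distr M borel (\<lambda>om. c * U om)) t = char (distr M borel U) (t * c)"
  unfolding char_def using assms by (simp add: integral_distr mult.assoc)

lemma real_distribution_centred_normal: "v \<ge> 0 \<Longrightarrow> real_distribution (centred_normal v)"
  unfolding centred_normal_def real_distribution_def real_distribution_axioms_def
  by (auto intro!: prob_space_return prob_space_normal_density)

lemma char_centred_normal:
  assumes "v \<ge> 0"
  shows "char (centred_normal v) t = exp (- v * t\<^sup>2 / 2)"
proof (cases "v = 0")
  case True
  then show ?thesis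
    by (simp add: centred_normal_def char_def integral_return)
next
  case False
  then have v: "v > 0" using assms by simp
  interpret N: real_distribution std_normal_distribution by (rule real_dist_normal_dist)
  have "distributed std_normal_distribution lborel (\<lambda>x. x) std_normal_density"
    unfolding distributed_def by (auto simp: distr_id2)
  from N.normal_density_affine[OF this, of "sqrt v" 0]
  have "distr std_normal_distribution lborel (\<lambda>x. sqrt v * x) = centred_normal v"
    using v unfolding distributed_def by (simp add: centred_normal_def)
  moreover have "distr std_normal_distribution lborel (\<lambda>x. sqrt v * x) = distr std_normal_distribution borel (\<lambda>x. sqrt v * x)"
    by (rule distr_cong) auto
  ultimately have "char (centred_normal v) t = char (distr std_normal_distribution borel (\<lambda>x. sqrt v * x)) t"
    by simp
  also have "\<dots> = char (distr std_normal_distribution borel (\<lambda>x. x)) (t * sqrt v)"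
    by (rule char_distr_scale) simp
  also have "distr std_normal_distribution borel (\<lambda>x. x) = std_normal_distribution"
    by (rule distr_id2) simp
  finally show ?thesis
    using v by (simp add: char_std_normal_distribution power_mult_distrib mult.commute)
qed

lemma gaussian_measure_centred_normal: "v \<ge> 0 \<Longrightarrow> gaussian_measure (centred_normal v)"
  using real_sqrt_gt_0_iff[of v] unfolding gaussian_measure_def centred_normal_def
  by (cases "v = 0") (metis, metis less_eq_real_def)

lemma centred_normal_moments:
  assumes "v \<ge> 0"
  shows "integrable (centred_normal v) (\<lambda>x. x)" "(LINT x|centred_normal v. x) = 0"
    "integrable (centred_normal v) (\<lambda>x. x\<^sup>2)" "(LINT x|centred_normal v. x\<^sup>2) = v"
proof -
  have "integrable (centred_normal v) (\<lambda>x. x) \<and> (LINT x|centred_normal v. x) = 0 \<and>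
    integrable (centred_normal v) (\<lambda>x. x\<^sup>2) \<and> (LINT x|centred_normal v. x\<^sup>2) = v"
  proof (cases "v = 0")
    case True
    have "integrable (return borel (0::real)) f" if f: "f \<in> borel_measurable borel" "f 0 = (0::real)" for f
    proof (rule integrable_cong_AE_imp[of _ "\<lambda>_. 0"])
      have "{x. f x = 0} \<in> sets borel" using f(1) by measurable
      then show "AE x in return borel 0. 0 = f x"
        using f(2) by (subst AE_return) (auto simp: pred_def eq_commute[of 0])
    next
      show "f \<in> borel_measurable (return borel 0)"
        using f(1) by (simp only: measurable_cong_sets[OF sets_return refl])
    qed simp
    note int = this
    have m: "(\<lambda>x::real. x) \<in> borel_measurable borel" "(\<lambda>x::real. x\<^sup>2) \<in> borel_measurable borel"
      by measurable
    have "integrable (return borel (0::real)) (\<lambda>x. x)" "integrable (return borel (0::real)) (\<lambda>x. x\<^sup>2)"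
      by (rule int[OF m(1) refl], rule int[OF m(2)], rule zero_power2)
    moreover have "(LINT x|return borel (0::real). x) = 0" "(LINT x|return borel (0::real). x\<^sup>2) = 0"
      by (subst integral_return[OF _ m(1)], simp, rule refl, subst integral_return[OF _ m(2)], simp, rule zero_power2)
    moreover have "centred_normal v = return borel 0"
      using True by (simp add: centred_normal_def)
    ultimately show ?thesis using True by (simp only: simp_thms)
  next
    case False
    then have s: "sqrt v > 0" using assms by simp
    have "has_bochner_integral lborel (\<lambda>x. normal_density 0 (sqrt v) x * x\<^sup>2) v"
      using normal_moment_even[OF s, of 0 1] s by (simp add: fact_numeral)
    then have "integrable lborel (\<lambda>x. normal_density 0 (sqrt v) x * x\<^sup>2)"
       "(LINT x|lborel. normal_density 0 (sqrt v) x * x\<^sup>2) = v"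
      by (auto simp: has_bochner_integral_iff)
    with integrable_normal_moment_nz_1[OF s, of 0] integral_normal_moment_nz_1[OF s, of 0] False
    show ?thesis
      by (simp add: centred_normal_def integrable_density integral_density)
  qed
  then show "integrable (centred_normal v) (\<lambda>x. x)" "(LINT x|centred_normal v. x) = 0"
    "integrable (centred_normal v) (\<lambda>x. x\<^sup>2)" "(LINT x|centred_normal v. x\<^sup>2) = v" by auto
qed

text \<open>Where |x| >= a, one of the two centres b = a, b = -a satisfies
  \<open>x\<^sup>2 \<ge> a\<^sup>2 + (x - b)\<^sup>2\<close>, so the density is at most
  \<open>exp (- a\<^sup>2 / (2 * v))\<close> times a normal density centred at b; integrating both
  gives the factor 2. The bound uses a positive majorant v' of the variance, which keeps it
  meaningful when v = 0.\<close>

lemma centred_normal_tail: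
  assumes "0 \<le> v" "v \<le> v'" "v' > 0" "a > 0"
  shows "measure (centred_normal v) {x. \<bar>x\<bar> \<ge> a} \<le> 2 * exp (- a\<^sup>2 / (2 * v'))"
proof (cases "v = 0")
  case True
  then show ?thesis
    using \<open>a > 0\<close> by (simp add: centred_normal_def measure_return indicator_def)
next
  case False
  then have v: "v > 0" using assms by simp
  define s where "s = sqrt v"
  have s: "s > 0" "s\<^sup>2 = v" using v by (auto simp: s_def)
  have *: "normal_density 0 s x \<le> exp (- a\<^sup>2 / (2 * v)) * normal_density b s x"
    if "b * x \<ge> a * a" "b\<^sup>2 = a\<^sup>2" for x b
  proof -
    have "x\<^sup>2 \<ge> a\<^sup>2 + (x - b)\<^sup>2"
      using that by (simp add: power2_diff power2_eq_square algebra_simps)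
    then have "- x\<^sup>2 / (2 * v) \<le> - a\<^sup>2 / (2 * v) + - (x - b)\<^sup>2 / (2 * v)"
      using v by (simp add: field_simps)
    then have "exp (- x\<^sup>2 / (2 * v)) \<le> exp (- a\<^sup>2 / (2 * v)) * exp (- (x - b)\<^sup>2 / (2 * v))"
      by (simp add: exp_add[symmetric])
    then have "1 / sqrt (2 * pi * v) * exp (- x\<^sup>2 / (2 * v))
        \<le> 1 / sqrt (2 * pi * v) * (exp (- a\<^sup>2 / (2 * v)) * exp (- (x - b)\<^sup>2 / (2 * v)))"
      using v by (intro mult_left_mono) auto
    then show ?thesis
      unfolding normal_density_def s(2) by (simp add: mult_ac)
  qed
  have le: "normal_density 0 s x * indicator {x. \<bar>x\<bar> \<ge> a} x
      \<le> exp (- a\<^sup>2 / (2 * v)) * (normal_density a s x + normal_density (- a) s x)" for x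
  proof (cases "\<bar>x\<bar> \<ge> a")
    case True
    then have "a * x \<ge> a * a \<or> (- a) * x \<ge> a * a"
      using \<open>a > 0\<close> mult_left_mono[of a x a] mult_left_mono[of a "- x" a] by (cases "x \<ge> 0") auto
    then have "normal_density 0 s x \<le> exp (- a\<^sup>2 / (2 * v)) * normal_density a s x \<or>
        normal_density 0 s x \<le> exp (- a\<^sup>2 / (2 * v)) * normal_density (- a) s x"
      using *[of a x] *[of "- a" x] by auto
    moreover have n: "exp (- a\<^sup>2 / (2 * v)) * normal_density b s x \<ge> 0" for b by simp
    ultimately have "normal_density 0 s x
        \<le> exp (- a\<^sup>2 / (2 * v)) * normal_density a s x + exp (- a\<^sup>2 / (2 * v)) * normal_density (- a) s x"
      using n[of a] n[of "- a"] by linarith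
    then show ?thesis using True by (simp add: distrib_left)
  qed simp
  have set: "{x::real. \<bar>x\<bar> \<ge> a} \<in> sets borel" by measurable
  interpret D: real_distribution "centred_normal v"
    using real_distribution_centred_normal \<open>0 \<le> v\<close> by blast
  have cn: "centred_normal v = density lborel (normal_density 0 s)"
    using False by (simp add: centred_normal_def s_def)
  have "measure (centred_normal v) {x. \<bar>x\<bar> \<ge> a} = (LINT x|centred_normal v. indicator {x. \<bar>x\<bar> \<ge> a} x)"
    using set by simp
  also have "\<dots> = (LINT x|lborel. normal_density 0 s x * indicator {x. \<bar>x\<bar> \<ge> a} x)"
    unfolding cn by (subst integral_density) (use set in auto)
  also have "\<dots> \<le> (LINT x|lborel. exp (- a\<^sup>2 / (2 * v)) * (normal_density a s x + normal_density (- a) s x))"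
  proof (rule integral_mono[OF _ _ le])
    show "integrable lborel (\<lambda>x. normal_density 0 s x * indicator {x. \<bar>x\<bar> \<ge> a} x)"
      using integrable_real_mult_indicator[OF _ integrable_normal_density[OF s(1), of 0], of "{x. \<bar>x\<bar> \<ge> a}"] set
      by (simp add: mult.commute)
    show "integrable lborel (\<lambda>x. exp (- a\<^sup>2 / (2 * v)) * (normal_density a s x + normal_density (- a) s x))"
      using s(1) by (intro integrable_mult_right Bochner_Integration.integrable_add integrable_normal_density)
  qed
  also have "\<dots> = 2 * exp (- a\<^sup>2 / (2 * v))"
    using s(1) by (simp add: Bochner_Integration.integral_add)
  also have "\<dots> \<le> 2 * exp (- a\<^sup>2 / (2 * v'))"
    using assms v by (simp add: frac_le)
  finally show ?thesis .
qed

section \<open>Characteristic functions and the scalar central limit theorem\<close>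

lemma (in prob_space) distr_eq_centred_normalI:
  assumes "U \<in> borel_measurable M" "v \<ge> 0" "\<And>t. char (distr M borel U) t = exp (- v * t\<^sup>2 / 2)"
  shows "distr M borel U = centred_normal v"
  using assms by (intro Levy_uniqueness real_distribution_distr real_distribution_centred_normal)
    (auto simp: char_centred_normal fun_eq_iff)

lemma (in prob_space) expectation_cos_char:
  assumes U: "U \<in> borel_measurable M"
  shows "expectation (\<lambda>om. cos (U om + b)) = Re (iexp b * char (distr M borel U) 1)"
proof -
  have "iexp b * char (distr M borel U) 1 = (LINT om|M. iexp b * iexp (U om))"
    unfolding char_def using U by (subst integral_distr) auto
  also have "Re \<dots> = (LINT om|M. Re (iexp b * iexp (U om)))"
  proof (rule integral_Re[symmetric])
    have "integrable M (\<lambda>om. iexp (U om))"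
      using U by (intro integrable_iexp) auto
    then show "integrable M (\<lambda>om. iexp b * iexp (U om))" by simp
  qed
  also have "\<dots> = expectation (\<lambda>om. cos (U om + b))"
    by (intro Bochner_Integration.integral_cong refl) (simp add: cos_add Re_exp Im_exp algebra_simps)
  finally show ?thesis by simp
qed

text \<open>The central limit theorem divides by the standard deviation, so variance zero is treated
  apart: there every summand vanishes almost surely. Degenerate combinations do occur, since the
  covariance need not be strictly positive definite.\<close>

lemma (in prob_space) char_normalized_sum_tendsto:
  fixes X :: "nat \<Rightarrow> 'a \<Rightarrow> real"
  assumes indep: "indep_vars (\<lambda>_. borel) X UNIV"
    and mean: "\<And>i. expectation (X i) = 0" and bdd: "\<And>i om. om \<in> space M \<Longrightarrow> \<bar>X i om\<bar> \<le> B"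
    and var: "\<And>i. expectation (\<lambda>om. (X i om)\<^sup>2) = v"
    and distr: "\<And>i. distr M borel (X i) = \<mu>"
  shows "(\<lambda>n. char (distr M borel (\<lambda>om. (\<Sum>i<n. X i om) / sqrt (real n))) t) \<longlonglongrightarrow> exp (- v * t\<^sup>2 / 2)"
proof -
  have X[measurable]: "X i \<in> borel_measurable M" for i
    using indep by (auto simp: indep_vars_def2)
  have sq: "integrable M (\<lambda>om. (X i om)\<^sup>2)" for i
  proof (rule integrable_const_bound)
    show "AE om in M. norm ((X i om)\<^sup>2) \<le> B\<^sup>2"
    proof (rule AE_I2)
      fix om assume "om \<in> space M"
      then have "\<bar>X i om\<bar> \<le> \<bar>B\<bar>" using bdd[of om i] by linarith
      then show "norm ((X i om)\<^sup>2) \<le> B\<^sup>2" by (simp add: abs_le_square_iff)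
    qed
  qed simp
  have "0 \<le> expectation (\<lambda>om. (X 0 om)\<^sup>2)" by simp
  then have "v \<ge> 0" unfolding var .
  show ?thesis
  proof (cases "v = 0")
    case True
    have "AE om in M. X i om = 0" for i
      using integral_nonneg_eq_0_iff_AE[OF sq[of i]] var[of i] True by auto
    then have "AE om in M. \<forall>i. X i om = 0" by (simp add: AE_all_countable)
    then have z: "AE om in M. (\<Sum>i<n. X i om) / sqrt (real n) = 0" for n by eventually_elim simp
    have "char (distr M borel (\<lambda>om. (\<Sum>i<n. X i om) / sqrt (real n))) t = 1" for n
    proof -
      have "char (distr M borel (\<lambda>om. (\<Sum>i<n. X i om) / sqrt (real n))) t
          = (LINT om|M. iexp (t * ((\<Sum>i<n. X i om) / sqrt (real n))))"
        unfolding char_def by (subst integral_distr) auto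
      also have "\<dots> = (LINT om|M. 1)"
      proof (rule integral_cong_AE)
        show "AE om in M. iexp (t * ((\<Sum>i<n. X i om) / sqrt (real n))) = 1"
          using z[of n] by eventually_elim (simp only: mult_zero_right of_real_0 exp_zero)
      qed simp_all
      finally show ?thesis by (simp add: prob_space)
    qed
    then show ?thesis using True by simp
  next
    case False
    then have v: "v > 0" using \<open>v \<ge> 0\<close> by simp
    have "weak_conv_m (\<lambda>n. distr M borel (\<lambda>x. (\<Sum>i<n. X i x) / sqrt (n * (sqrt v)\<^sup>2))) std_normal_distribution"
      using central_limit_theorem_zero_mean[OF indep mean _ sq _ distr, of "sqrt v"] v mean var by simp
    \<comment> \<open>Evaluating at \<open>t * sqrt v\<close> undoes the division by the standard
      deviation.\<close>
    then have "(\<lambda>n. char (distr M borel (\<lambda>x. (\<Sum>i<n. X i x) / sqrt (n * (sqrt v)\<^sup>2))) (t * sqrt v))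
        \<longlonglongrightarrow> char std_normal_distribution (t * sqrt v)"
      by (intro levy_continuity1 real_dist_normal_dist real_distribution_distr) auto
    moreover have "char (distr M borel (\<lambda>x. (\<Sum>i<n. X i x) / sqrt (n * (sqrt v)\<^sup>2))) (t * sqrt v)
        = char (distr M borel (\<lambda>om. (\<Sum>i<n. X i om) / sqrt (real n))) t" for n
    proof -
      have "(\<Sum>i<n. X i x) / sqrt (real n) = sqrt v * ((\<Sum>i<n. X i x) / sqrt (n * (sqrt v)\<^sup>2))" for x
        using v by (simp add: real_sqrt_mult)
      then show ?thesis
        by (simp only:) (rule char_distr_scale[symmetric], measurable)
    qed
    moreover have "char std_normal_distribution (t * sqrt v) = exp (- v * t\<^sup>2 / 2)"
      using v by (simp add: char_std_normal_distribution power_mult_distrib mult.commute)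
    ultimately show ?thesis by (simp only:)
  qed
qed

text \<open>Only countably many coordinates are used; the index type is kept arbitrary because the
  limit process is wanted on a space of functions on the matrices.\<close>
lemma std_normal_PiM:
  fixes e :: "nat \<Rightarrow> 'i"
  assumes "inj e"
  defines "N \<equiv> PiM (UNIV :: 'i set) (\<lambda>_. std_normal_distribution)"
  shows prob_space_std_normal_PiM: "prob_space N"
    and measurable_std_normal_PiM: "(\<lambda>om. \<Sum>j<n. c j * om (e j)) \<in> borel_measurable N"
    and char_std_normal_PiM:
      "char (distr N borel (\<lambda>om. \<Sum>j<n. c j * om (e j))) s = exp (- (\<Sum>j<n. (c j)\<^sup>2) * s\<^sup>2 / 2)"
proof -
  interpret R: real_distribution std_normal_distribution by (rule real_dist_normal_dist)
  have p: "prob_space std_normal_distribution" by unfold_locales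
  show N: "prob_space N" unfolding N_def by (rule prob_space_PiM) (rule p)
  interpret N: prob_space N by (rule N)
  have coord: "(\<lambda>om. om i) \<in> measurable N std_normal_distribution" for i
    unfolding N_def by (rule measurable_component_singleton) simp
  have coord_distr: "distr N std_normal_distribution (\<lambda>om. om i) = std_normal_distribution" for i
    unfolding N_def by (rule distr_PiM_component) (use p in auto)
  have coord_b: "(\<lambda>om. om i) \<in> borel_measurable N" for i
    using coord[of i] by (simp only: measurable_cong_sets[OF refl R.events_eq_borel])
  have coord_distr_b: "distr N borel (\<lambda>om. om i) = std_normal_distribution" for i
    using coord_distr[of i] by (simp only: distr_cong[OF refl R.events_eq_borel refl])
  show "(\<lambda>om. \<Sum>j<n. c j * om (e j)) \<in> borel_measurable N"
    by (intro borel_measurable_sum borel_measurable_times borel_measurable_const coord_b)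
  have "N.indep_vars (\<lambda>_. std_normal_distribution) (\<lambda>i om. om i) UNIV"
  proof (subst N.indep_vars_iff_distr_eq_PiM)
    have "distr N (PiM UNIV (\<lambda>_. std_normal_distribution)) (\<lambda>x. \<lambda>i\<in>UNIV. x i) = N"
      unfolding N_def by (simp add: distr_id2 restrict_UNIV)
    then show "distr N (PiM UNIV (\<lambda>_. std_normal_distribution)) (\<lambda>x. \<lambda>i\<in>UNIV. x i)
        = PiM UNIV (\<lambda>i. distr N std_normal_distribution (\<lambda>om. om i))"
      by (simp only: coord_distr) (simp only: N_def)
  qed (use coord in auto)
  \<comment> \<open>The coefficients are carried over to the index type by \<open>inv e\<close>; off
    the range of e they are arbitrary, and the family is restricted to the image of an initial
    segment right away.\<close>
  then have "N.indep_vars (\<lambda>_. borel) (\<lambda>i om. c (inv e i) * om i) UNIV"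
    by (rule N.indep_vars_compose2[where Y = "\<lambda>i x. c (inv e i) * x"])
       (auto simp: measurable_cong_sets[OF R.events_eq_borel refl])
  then have ind: "N.indep_vars (\<lambda>_. borel) (\<lambda>i om. c (inv e i) * om i) (e ` {..<n})"
    by (rule N.indep_vars_subset) simp
  have inj: "inj_on e {..<n}" using assms(1) by (rule inj_on_subset) simp
  have "(\<Sum>j<n. c j * om (e j)) = (\<Sum>i\<in>e ` {..<n}. c (inv e i) * om i)" for om
    using assms(1) by (simp add: sum.reindex[OF inj])
  then have "char (distr N borel (\<lambda>om. \<Sum>j<n. c j * om (e j))) s
      = (\<Prod>i\<in>e ` {..<n}. char (distr N borel (\<lambda>om. c (inv e i) * om i)) s)"
    by (simp only: N.char_distr_sum[OF ind])
  also have "\<dots> = (\<Prod>j<n. char (distr N borel (\<lambda>om. c j * om (e j))) s)"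
    using assms(1) by (simp add: prod.reindex[OF inj])
  also have "\<dots> = (\<Prod>j<n. complex_of_real (exp (- ((c j)\<^sup>2 * s\<^sup>2) / 2)))"
    by (simp add: char_distr_scale[OF coord_b] coord_distr_b char_std_normal_distribution power_mult_distrib mult.commute)
  also have "\<dots> = complex_of_real (exp (\<Sum>j<n. - ((c j)\<^sup>2 * s\<^sup>2) / 2))"
    by (simp only: of_real_prod[symmetric] exp_sum[OF finite_lessThan])
  also have "(\<Sum>j<n. - ((c j)\<^sup>2 * s\<^sup>2) / 2) = - (\<Sum>j<n. (c j)\<^sup>2) * s\<^sup>2 / 2"
    by (simp add: sum_distrib_right sum_negf sum_divide_distrib)
  finally show "char (distr N borel (\<lambda>om. \<Sum>j<n. c j * om (e j))) s = exp (- (\<Sum>j<n. (c j)\<^sup>2) * s\<^sup>2 / 2)" .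
qed

section \<open>Exponential tails and comparison of expectations\<close>

lemma summable_power_times_exp_neg:
  fixes q \<kappa> b :: real
  assumes "q > 0" "\<kappa> > 0" "b > 1"
  shows "summable (\<lambda>i. q ^ i * exp (- \<kappa> * b ^ i))"
proof -
  \<comment> \<open>An exponent for which b^k beats 2 q: the exponential is then dominated by a
    power of b that leaves a geometric series of ratio 1/2.\<close>
  obtain k where k: "q * 2 < b ^ k" using real_arch_pow[OF \<open>b > 1\<close>] by blast
  \<comment> \<open>From \<open>1 + y \<le> exp y\<close> at \<open>y = x / real (Suc k)\<close>,
    raised to the power \<open>Suc k\<close>.\<close>
  have exp_le: "exp (- x) \<le> (real (Suc k) / x) ^ Suc k" if "x > 0" for x :: real
  proof -
    have "x / real (Suc k) \<le> exp (x / real (Suc k))"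
      using exp_ge_add_one_self[of "x / real (Suc k)"] by linarith
    then have "(x / real (Suc k)) ^ Suc k \<le> exp (x / real (Suc k)) ^ Suc k"
      using that by (intro power_mono) auto
    also have "\<dots> = exp x" by (simp only: exp_of_nat_mult[symmetric]) simp
    finally have le: "(x / real (Suc k)) ^ Suc k \<le> exp x" .
    have "inverse (exp x) \<le> inverse ((x / real (Suc k)) ^ Suc k)"
      using that by (intro le_imp_inverse_le le) simp
    then show ?thesis by (simp only: exp_minus power_inverse[symmetric] inverse_divide)
  qed
  define c where "c = (real (Suc k) / \<kappa>) ^ Suc k"
  have c: "c > 0" using \<open>\<kappa> > 0\<close> by (simp add: c_def)
  have bound: "q ^ i * exp (- \<kappa> * b ^ i) \<le> c * (1 / 2) ^ i" for i
  proof -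
    have b: "b ^ i > 0" using \<open>b > 1\<close> by simp
    have "exp (- \<kappa> * b ^ i) \<le> (real (Suc k) / (\<kappa> * b ^ i)) ^ Suc k"
      using exp_le[of "\<kappa> * b ^ i"] b \<open>\<kappa> > 0\<close> by simp
    also have "\<dots> = c * (1 / b ^ Suc k) ^ i"
      unfolding c_def by (simp only: power_divide power_mult_distrib power_mult[symmetric] mult.commute[of i]) simp
    finally have "q ^ i * exp (- \<kappa> * b ^ i) \<le> q ^ i * (c * (1 / b ^ Suc k) ^ i)"
      using \<open>q > 0\<close> by (intro mult_left_mono) auto
    also have "\<dots> = c * (q / b ^ Suc k) ^ i"
      by (simp add: power_divide)
    also have "\<dots> \<le> c * (1 / 2) ^ i"
    proof (intro mult_left_mono power_mono)
      have "b ^ k \<le> b ^ Suc k" using \<open>b > 1\<close> by (intro power_increasing) auto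
      then have "q * 2 \<le> b ^ Suc k" using k by linarith
      moreover have "b ^ Suc k > 0" using \<open>b > 1\<close> by simp
      ultimately show "q / b ^ Suc k \<le> 1 / 2" by (simp only: divide_le_eq) simp
    qed (use c \<open>q > 0\<close> \<open>b > 1\<close> in auto)
    finally show ?thesis .
  qed
  show ?thesis
  proof (rule summable_comparison_test')
    show "summable (\<lambda>i. c * (1 / 2 :: real) ^ i)" by (intro summable_mult summable_geometric) simp
    show "norm (q ^ i * exp (- \<kappa> * b ^ i)) \<le> c * (1 / 2) ^ i" if "i \<ge> 0" for i
      using bound[of i] \<open>q > 0\<close> by simp
  qed
qed

text \<open>A deviation a of the normalised sum is a deviation \<open>a * sqrt (real p)\<close> of
  the plain sum, whose p terms have range 2 b. The p cancels, so the bound is uniform in the sample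
  size. For p = 0 the normalised sum is 0 and the event is empty.\<close>

lemma (in prob_space) Hoeffding_normalized_sum:
  fixes h :: "'s \<Rightarrow> real" and \<theta> :: "nat \<Rightarrow> 'a \<Rightarrow> 's"
  assumes indep: "indep_vars (\<lambda>_. S) \<theta> UNIV" and law: "\<And>i. distr M S (\<theta> i) = S"
    and h: "h \<in> borel_measurable S" "\<And>t. t \<in> space S \<Longrightarrow> \<bar>h t\<bar> \<le> b" and "b > 0" "a > 0"
  shows "prob {om \<in> space M. a \<le> \<bar>sqrt (real p) * (1 / real p * (\<Sum>i<p. h (\<theta> i om)) - (LINT t|S. h t))\<bar>}
    \<le> 2 * exp (- a\<^sup>2 / (2 * b\<^sup>2))"
proof (cases "p = 0")
  case True
  then show ?thesis using \<open>a > 0\<close> by simp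
next
  case False
  have \<theta>: "\<theta> i \<in> measurable M S" for i using indep by (simp add: indep_vars_def2)
  have exp: "expectation (\<lambda>om. h (\<theta> i om)) = (LINT t|S. h t)" for i
    using integral_distr[OF \<theta>, of h i] h(1) by (simp add: law)
  interpret Hoeffding_ineq M "{..<p}" "\<lambda>i om. h (\<theta> i om)" "\<lambda>_. - b" "\<lambda>_. b" "real p * (LINT t|S. h t)"
  proof unfold_locales
    have "indep_vars (\<lambda>_. borel) (\<lambda>i om. h (\<theta> i om)) UNIV"
      by (rule indep_vars_compose2[OF indep]) (rule h(1))
    then show "indep_vars (\<lambda>_. borel) (\<lambda>i om. h (\<theta> i om)) {..<p}"
      by (rule indep_vars_subset) simp
    show "AE om in M. h (\<theta> i om) \<in> {- b..b}" for i
    proof (rule AE_I2)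
      fix om assume "om \<in> space M"
      then show "h (\<theta> i om) \<in> {- b..b}"
        using h(2)[OF measurable_space[OF \<theta>[of i] \<open>om \<in> space M\<close>]] unfolding abs_le_iff atLeastAtMost_iff by linarith
    qed
    show "real p * (LINT t|S. h t) \<equiv> \<Sum>i<p. expectation (\<lambda>om. h (\<theta> i om))"
      by (simp add: exp)
  qed simp
  have sp: "sqrt (real p) > 0" using False by simp
  have "a \<le> \<bar>sqrt (real p) * (1 / real p * x - y)\<bar> \<longleftrightarrow> a * sqrt (real p) \<le> \<bar>x - real p * y\<bar>" for x y
  proof -
    have "sqrt (real p) * (sqrt (real p) * (1 / real p * x - y)) = x - real p * y"
      using False by (simp add: right_diff_distrib flip: mult.assoc)
    then have "\<bar>x - real p * y\<bar> = \<bar>sqrt (real p) * (1 / real p * x - y)\<bar> * sqrt (real p)"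
      using sp by (simp add: abs_mult flip: \<open>_ = x - real p * y\<close>)
    then show ?thesis using sp by (simp only: mult_le_cancel_right_pos)
  qed
  then have "prob {om \<in> space M. a \<le> \<bar>sqrt (real p) * (1 / real p * (\<Sum>i<p. h (\<theta> i om)) - (LINT t|S. h t))\<bar>}
      = prob {om \<in> space M. a * sqrt (real p) \<le> \<bar>(\<Sum>i<p. h (\<theta> i om)) - real p * (LINT t|S. h t)\<bar>}"
    by (simp only:)
  also have "\<dots> \<le> 2 * exp (- 2 * (a * sqrt (real p))\<^sup>2 / (\<Sum>i<p. (b - - b)\<^sup>2))"
    by (rule Hoeffding_ineq_abs_ge) (use False \<open>a > 0\<close> \<open>b > 0\<close> in auto)
  also have "- 2 * (a * sqrt (real p))\<^sup>2 / (\<Sum>i<p. (b - - b)\<^sup>2) = - a\<^sup>2 / (2 * b\<^sup>2)"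
    using False \<open>b > 0\<close> by (simp add: power_mult_distrib power2_eq_square field_simps)
  finally show ?thesis .
qed

text \<open>Serves to replace a functional by its trigonometric approximant: the error is e on the
  good event E, and the trivial bound 2 b is paid with probability at most \<eta> elsewhere.\<close>

lemma (in prob_space) expectation_diff_bound:
  fixes U V :: "'a \<Rightarrow> real"
  assumes UV: "U \<in> borel_measurable M" "V \<in> borel_measurable M"
    and b: "\<And>om. om \<in> space M \<Longrightarrow> \<bar>U om\<bar> \<le> b" "\<And>om. om \<in> space M \<Longrightarrow> \<bar>V om\<bar> \<le> b"
    and E: "E \<in> events" "\<And>om. om \<in> E \<Longrightarrow> \<bar>U om - V om\<bar> \<le> e" "e \<ge> 0" "prob (space M - E) \<le> \<eta>"
  shows "\<bar>expectation U - expectation V\<bar> \<le> e + 2 * b * \<eta>"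
proof -
  have int: "integrable M U" "integrable M V"
    by (rule integrable_const_bound[of _ b]; use UV b in auto)+
  obtain om0 where "om0 \<in> space M" using not_empty by blast
  then have "b \<ge> 0" using b(1)[of om0] by linarith
  have ind: "integrable M (indicator (space M - E) :: 'a \<Rightarrow> real)"
    by (rule integrable_real_indicator) (use E(1) in \<open>auto simp: less_top[symmetric]\<close>)
  have "\<bar>expectation U - expectation V\<bar> = \<bar>expectation (\<lambda>om. U om - V om)\<bar>"
    using int by simp
  also have "\<dots> \<le> expectation (\<lambda>om. \<bar>U om - V om\<bar>)"
    by (rule integral_abs_bound)
  also have "\<dots> \<le> expectation (\<lambda>om. e + 2 * b * indicator (space M - E) om)"
  proof (rule integral_mono)
    show "integrable M (\<lambda>om. \<bar>U om - V om\<bar>)" using int by auto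
    show "integrable M (\<lambda>om. e + 2 * b * indicator (space M - E) om)"
      using ind by auto
    fix om assume om: "om \<in> space M"
    show "\<bar>U om - V om\<bar> \<le> e + 2 * b * indicator (space M - E) om"
    proof (cases "om \<in> E")
      case True
      then show ?thesis using E(2) by simp
    next
      case False
      then show ?thesis using b[OF om] om E(3) by simp
    qed
  qed
  also have "\<dots> = e + 2 * b * prob (space M - E)"
  proof -
    have "expectation (indicator (space M - E)) = prob (space M - E)"
      using E(1) by simp
    then show ?thesis
      by (simp only: Bochner_Integration.integral_add[OF integrable_const integrable_mult_right[OF ind]]
        integral_mult_right_zero lebesgue_integral_const prob_space) simp
  qed
  also have "\<dots> \<le> e + 2 * b * \<eta>"
    using E(4) \<open>b \<ge> 0\<close> by (intro add_left_mono mult_left_mono) auto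
  finally show ?thesis .
qed

text \<open>An integrable T is its own least majorant, so the infimum is attained there.\<close>

lemma (in prob_space) outer_expectation_eq:
  assumes "integrable M T"
  shows "outer_expectation M T = expectation T"
  unfolding outer_expectation_def
proof (rule cInf_eq_minimum)
  show "expectation T \<in> (\<lambda>U. LINT om|M. U om) ` {U. integrable M U \<and> (\<forall>om\<in>space M. T om \<le> U om)}"
    using assms by (intro image_eqI[of _ _ T]) auto
  fix x assume "x \<in> (\<lambda>U. LINT om|M. U om) ` {U. integrable M U \<and> (\<forall>om\<in>space M. T om \<le> U om)}"
  then obtain U where "integrable M U" "\<forall>om\<in>space M. T om \<le> U om" "x = (LINT om|M. U om)" by auto
  then show "expectation T \<le> x" using assms by (auto intro: integral_mono)
qed

section \<open>Transport between point clouds\<close>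

text \<open>The Birkhoff polytope of doubly stochastic matrices, scaled by 1/n.\<close>

definition coupling_matrices :: "('n::finite \<Rightarrow> 'n \<Rightarrow> real) set" where
  "coupling_matrices = {P. (\<forall>k l. P k l \<ge> 0) \<and> (\<forall>k. (\<Sum>l\<in>UNIV. P k l) = 1 / real CARD('n)) \<and>
     (\<forall>l. (\<Sum>k\<in>UNIV. P k l) = 1 / real CARD('n))}"

definition transport_cost :: "('n::finite \<Rightarrow> real) \<Rightarrow> ('n \<Rightarrow> real) \<Rightarrow> ('n \<Rightarrow> 'n \<Rightarrow> real) \<Rightarrow> real" where
  "transport_cost a b P = (\<Sum>k\<in>UNIV. \<Sum>l\<in>UNIV. P k l * (a k - b l)\<^sup>2)"

definition quadratic_cost :: "(real \<times> real) measure \<Rightarrow> ennreal" where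
  "quadratic_cost \<pi> = (\<integral>\<^sup>+z. ennreal ((dist (fst z) (snd z))\<^sup>2) \<partial>\<pi>)"

definition point_cloud :: "('n::finite \<Rightarrow> real) \<Rightarrow> real measure" where
  "point_cloud a = distr (uniform_count_measure UNIV) borel a"

text \<open>Every value is counted once per index of its fibre, with the reciprocal of the fibre
  size as weight. This undoes the even splitting of atoms in
  \<open>matrix_of_coupling\<close>.\<close>

lemma sum_fibre_average:
  fixes b :: "'n::finite \<Rightarrow> 'b" and f :: "'b \<Rightarrow> real"
  shows "(\<Sum>l\<in>UNIV. f (b l) / real (card {i. b i = b l})) = (\<Sum>y\<in>range b. f y)"
proof -
  have "(\<Sum>l\<in>UNIV. f (b l) / real (card {i. b i = b l}))
      = (\<Sum>y\<in>range b. \<Sum>l\<in>{l\<in>UNIV. b l = y}. f (b l) / real (card {i. b i = b l}))"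
    by (rule sum.image_gen) simp
  also have "\<dots> = (\<Sum>y\<in>range b. \<Sum>l\<in>{l. b l = y}. f y / real (card {i. b i = y}))"
    by (intro sum.cong) auto
  also have "\<dots> = (\<Sum>y\<in>range b. f y)"
  proof (rule sum.cong)
    fix y assume "y \<in> range b"
    then have "{i. b i = y} \<noteq> {}" by auto
    then have "card {i. b i = y} \<noteq> 0" by simp
    then show "(\<Sum>l\<in>{l. b l = y}. f y / real (card {i. b i = y})) = f y" by simp
  qed simp
  finally show ?thesis .
qed

lemma measure_point_cloud:
  fixes a :: "'n::finite \<Rightarrow> real"
  assumes "A \<in> sets borel"
  shows "emeasure (point_cloud a) A = ennreal (real (card {i. a i \<in> A}) / real CARD('n))"
proof -
  have "emeasure (point_cloud a) A = emeasure (uniform_count_measure UNIV) (a -` A \<inter> UNIV)"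
    unfolding point_cloud_def using assms
    by (subst emeasure_distr) (auto simp: space_uniform_count_measure measurable_def sets_uniform_count_measure)
  also have "\<dots> = ennreal (real (card (a -` A)) / real CARD('n))"
    by (subst emeasure_uniform_count_measure) auto
  also have "a -` A = {i. a i \<in> A}" by auto
  finally show ?thesis .
qed

lemma coupling_matrix_sum:
  fixes P :: "'n::finite \<Rightarrow> 'n \<Rightarrow> real"
  assumes "P \<in> coupling_matrices"
  shows "(\<Sum>k\<in>UNIV. \<Sum>l\<in>UNIV. P k l) = 1"
  using assms by (simp add: coupling_matrices_def)

text \<open>The matrix is a measure on pairs of indices, and its image on pairs of points is the
  coupling. Marginals and cost are computed on the index side, where coinciding points need no
  special care.\<close>

lemma coupling_of_matrix:
  fixes a b :: "'n::finite \<Rightarrow> real"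
  assumes P: "P \<in> coupling_matrices"
  obtains \<pi> where "\<pi> \<in> couplings (point_cloud a) (point_cloud b)"
    "quadratic_cost \<pi> = ennreal (transport_cost a b P)"
proof -
  define D where "D = point_measure (UNIV :: ('n \<times> 'n) set) (\<lambda>z. ennreal (P (fst z) (snd z)))"
  define g where "g = (\<lambda>z::'n\<times>'n. (a (fst z), b (snd z)))"
  define \<pi> where "\<pi> = distr D (borel \<Otimes>\<^sub>M borel) g"
  have P0: "P k l \<ge> 0" for k l using P by (simp add: coupling_matrices_def)
  have mD: "h \<in> measurable D N \<longleftrightarrow> h \<in> UNIV \<rightarrow> space N" for h and N :: "'c measure"
    unfolding D_def measurable_def by (auto simp: sets_point_measure space_point_measure)
  have g[measurable]: "g \<in> measurable D (borel \<Otimes>\<^sub>M borel)"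
    by (subst mD) (auto simp: space_pair_measure)
  have eD: "emeasure D X = ennreal (\<Sum>z\<in>X. P (fst z) (snd z))" for X
    unfolding D_def using P0 by (subst emeasure_point_measure_finite) (auto simp: sum_ennreal)
  \<comment> \<open>Covers both projections: \<open>ix\<close> is the projection of index pairs that
    lies over the projection \<open>pr\<close> of point pairs.\<close>
  have marginal: "distr \<pi> borel pr = point_cloud h"
    if pr: "pr \<in> measurable (borel \<Otimes>\<^sub>M borel) borel" and ix: "pr \<circ> g = h \<circ> ix"
      and sum: "\<And>k. (\<Sum>z | ix z = k. P (fst z) (snd z)) = 1 / real CARD('n)" for pr h and ix :: "'n \<times> 'n \<Rightarrow> 'n"
  proof (rule measure_eqI)
    show "sets (distr \<pi> borel pr) = sets (point_cloud h)" by (simp add: point_cloud_def)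
    fix A assume "A \<in> sets (distr \<pi> borel pr)"
    then have A: "A \<in> sets borel" by simp
    have "emeasure (distr \<pi> borel pr) A = emeasure D ((pr \<circ> g) -` A \<inter> space D)"
      unfolding \<pi>_def by (subst distr_distr[OF pr g], rule emeasure_distr) (auto simp: mD A)
    also have "(pr \<circ> g) -` A \<inter> space D = {z. h (ix z) \<in> A}"
      unfolding ix by (auto simp: D_def space_point_measure)
    also have "emeasure D {z. h (ix z) \<in> A} = ennreal (\<Sum>k | h k \<in> A. \<Sum>z | ix z = k. P (fst z) (snd z))"
    proof -
      have "(\<Sum>z | h (ix z) \<in> A. P (fst z) (snd z)) = (\<Sum>k | h k \<in> A. \<Sum>z\<in>{z \<in> {z. h (ix z) \<in> A}. ix z = k}. P (fst z) (snd z))"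
        by (rule sum.group[symmetric]) auto
      also have "\<dots> = (\<Sum>k | h k \<in> A. \<Sum>z | ix z = k. P (fst z) (snd z))"
        by (intro sum.cong) auto
      finally show ?thesis unfolding eD by (simp only:)
    qed
    finally show "emeasure (distr \<pi> borel pr) A = emeasure (point_cloud h) A"
      by (simp add: sum measure_point_cloud[OF A])
  qed
  have 1: "distr \<pi> borel fst = point_cloud a"
  proof (rule marginal)
    fix k :: 'n
    have "{z. fst z = k} = Pair k ` (UNIV :: 'n set)" by auto
    then show "(\<Sum>z | fst z = k. P (fst z) (snd z)) = 1 / real CARD('n)"
      using P by (simp add: sum.reindex inj_on_def coupling_matrices_def)
  qed (auto simp: g_def)
  have 2: "distr \<pi> borel snd = point_cloud b"
  proof (rule marginal)
    fix l :: 'n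
    have "{z. snd z = l} = (\<lambda>k. (k, l)) ` (UNIV :: 'n set)" by auto
    then show "(\<Sum>z | snd z = l. P (fst z) (snd z)) = 1 / real CARD('n)"
      using P by (simp add: sum.reindex inj_on_def coupling_matrices_def)
  qed (auto simp: g_def)
  have "quadratic_cost \<pi> = (\<integral>\<^sup>+z. ennreal ((a (fst z) - b (snd z))\<^sup>2) \<partial>D)"
    unfolding quadratic_cost_def \<pi>_def by (subst nn_integral_distr[OF g]) (measurable, simp add: g_def dist_real_def)
  also have "\<dots> = (\<Sum>z\<in>UNIV. ennreal (P (fst z) (snd z)) * ennreal ((a (fst z) - b (snd z))\<^sup>2))"
    unfolding D_def by (rule nn_integral_point_measure_finite) auto
  also have "\<dots> = (\<Sum>z\<in>UNIV. ennreal (P (fst z) (snd z) * (a (fst z) - b (snd z))\<^sup>2))"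
    using P0 by (simp add: ennreal_mult)
  also have "\<dots> = ennreal (\<Sum>z\<in>UNIV. P (fst z) (snd z) * (a (fst z) - b (snd z))\<^sup>2)"
    using P0 by (intro sum_ennreal) auto
  also have "(\<Sum>z\<in>UNIV. P (fst z) (snd z) * (a (fst z) - b (snd z))\<^sup>2) = transport_cost a b P"
    unfolding transport_cost_def sum.cartesian_product by (simp add: case_prod_beta)
  finally show ?thesis using 1 2 by (intro that[of \<pi>]) (auto simp: couplings_def \<pi>_def)
qed

text \<open>Atoms shared by several indices are split evenly among them.\<close>
lemma matrix_of_coupling:
  fixes a b :: "'n::finite \<Rightarrow> real"
  assumes \<pi>: "\<pi> \<in> couplings (point_cloud a) (point_cloud b)"
  obtains P where "P \<in> coupling_matrices"
    "ennreal (transport_cost a b P) \<le> quadratic_cost \<pi>"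
proof -
  have sets[measurable_cong]: "sets \<pi> = sets (borel \<Otimes>\<^sub>M borel)"
    and d1: "distr \<pi> borel fst = point_cloud a" and d2: "distr \<pi> borel snd = point_cloud b"
    using \<pi> by (auto simp: couplings_def)
  have space: "space \<pi> = UNIV" using sets_eq_imp_space_eq[OF sets] by (simp add: space_pair_measure)
  have e1: "emeasure \<pi> (A \<times> UNIV) = ennreal (real (card {i. a i \<in> A}) / real CARD('n))" if "A \<in> sets borel" for A
  proof -
    have "emeasure (distr \<pi> borel fst) A = emeasure \<pi> (fst -` A \<inter> space \<pi>)"
      by (rule emeasure_distr) (use that in auto)
    also have "fst -` A \<inter> space \<pi> = A \<times> UNIV" by (auto simp: space)
    finally show ?thesis unfolding d1 measure_point_cloud[OF that] by simp
  qed
  have e2: "emeasure \<pi> (UNIV \<times> A) = ennreal (real (card {i. b i \<in> A}) / real CARD('n))" if "A \<in> sets borel" for A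
  proof -
    have "emeasure (distr \<pi> borel snd) A = emeasure \<pi> (snd -` A \<inter> space \<pi>)"
      by (rule emeasure_distr) (use that in auto)
    also have "snd -` A \<inter> space \<pi> = UNIV \<times> A" by (auto simp: space)
    finally show ?thesis unfolding d2 measure_point_cloud[OF that] by simp
  qed
  have "emeasure \<pi> (space \<pi>) = 1" using e1[of UNIV] by (simp add: space flip: UNIV_Times_UNIV)
  then interpret prob_space \<pi> by (rule prob_spaceI)
  have sing: "A \<times> B \<in> sets \<pi>" if "A \<in> sets borel" "B \<in> sets borel" for A B :: "real set"
    using that by (simp add: sets)
  have pt: "{z} \<in> sets \<pi>" for z
    using sing[of "{fst z}" "{snd z}"] by simp
  have fin: "finite F \<Longrightarrow> F \<in> sets borel" for F :: "real set"
    by (simp add: borel_closed finite_imp_closed)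
  define Q where "Q = (\<lambda>x y. measure \<pi> {(x, y)})"
  \<comment> \<open>The part W of a line that misses the finite grid is null because a marginal of
    \<pi> charges only the points of a cloud; the mass of the line is therefore the sum of its
    atoms.\<close>
  have atoms: "(\<Sum>z\<in>T. measure \<pi> {z}) = measure \<pi> V"
    if T: "finite T" "T \<subseteq> V" "V \<subseteq> T \<union> W" and W: "V \<in> sets \<pi>" "W \<in> sets \<pi>" "emeasure \<pi> W = 0" for T V W
  proof -
    have Ts: "T \<in> sets \<pi>"
      using sets.finite_UN[OF T(1), of "\<lambda>z. {z}"] pt by (simp only: UN_singleton)
    have "measure \<pi> V \<le> measure \<pi> T + measure \<pi> W"
      by (rule order_trans[OF finite_measure_mono[OF T(3)] measure_Un_le]) (use Ts W in auto)
    then have "measure \<pi> V = measure \<pi> T"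
      using finite_measure_mono[OF T(2) W(1)] W(3) by (simp add: measure_def)
    then show ?thesis using finite_measure_eq_sum_singleton[OF T(1) pt] by simp
  qed
  have row: "(\<Sum>y\<in>range b. Q x y) = real (card {i. a i = x}) / real CARD('n)" for x
  proof -
    have "(\<Sum>y\<in>range b. Q x y) = (\<Sum>z\<in>{x} \<times> range b. measure \<pi> {z})"
      unfolding Q_def by (simp add: sum.cartesian_product')
    also have "\<dots> = measure \<pi> ({x} \<times> UNIV)"
      by (rule atoms[of _ _ "UNIV \<times> - range b"]) (auto intro!: sing simp: fin borel_comp e2)
    finally show ?thesis using e1[of "{x}"] by (simp add: measure_def)
  qed
  have col: "(\<Sum>x\<in>range a. Q x y) = real (card {i. b i = y}) / real CARD('n)" for y
  proof -
    have "(\<Sum>x\<in>range a. Q x y) = (\<Sum>z\<in>range a \<times> {y}. measure \<pi> {z})"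
      unfolding Q_def by (simp add: sum.cartesian_product')
    also have "\<dots> = measure \<pi> (UNIV \<times> {y})"
      by (rule atoms[of _ _ "(- range a) \<times> UNIV"]) (auto intro!: sing simp: fin borel_comp e1)
    finally show ?thesis using e2[of "{y}"] by (simp add: measure_def)
  qed
  define m where "m = (\<lambda>k. real (card {i. a i = a k}))"
  define m' where "m' = (\<lambda>l. real (card {i. b i = b l}))"
  have m: "m k > 0" "m' k > 0" for k
    unfolding m_def m'_def by (auto simp: card_gt_0_iff)
  define P where "P = (\<lambda>k l. Q (a k) (b l) / (m k * m' l))"
  have "P \<in> coupling_matrices"
    unfolding coupling_matrices_def
  proof (intro CollectI conjI allI)
    fix k l
    show "P k l \<ge> 0" using m by (simp add: P_def Q_def less_imp_le)
    have "(\<Sum>l\<in>UNIV. P k l) = (\<Sum>l\<in>UNIV. Q (a k) (b l) / m' l) / m k"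
      by (simp add: P_def sum_divide_distrib mult.commute)
    also have "\<dots> = (\<Sum>y\<in>range b. Q (a k) y) / m k"
      unfolding m'_def by (subst sum_fibre_average) simp
    also have "\<dots> = 1 / real CARD('n)"
    proof -
      have "real (card {i. a i = a k}) = m k" by (simp only: m_def)
      then show ?thesis unfolding row using m(1)[of k] by simp
    qed
    finally show "(\<Sum>l\<in>UNIV. P k l) = 1 / real CARD('n)" .
    have "(\<Sum>k\<in>UNIV. P k l) = (\<Sum>k\<in>UNIV. Q (a k) (b l) / m k) / m' l"
      by (simp add: P_def sum_divide_distrib)
    also have "\<dots> = (\<Sum>x\<in>range a. Q x (b l)) / m' l"
      unfolding m_def by (subst sum_fibre_average[of "\<lambda>x. Q x (b l)"]) simp
    also have "\<dots> = 1 / real CARD('n)"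
    proof -
      have "real (card {i. b i = b l}) = m' l" by (simp only: m'_def)
      then show ?thesis unfolding col using m(2)[of l] by simp
    qed
    finally show "(\<Sum>k\<in>UNIV. P k l) = 1 / real CARD('n)" .
  qed
  \<comment> \<open>An inequality is enough for the infimum: the sum over the grid integrates a
    function that equals the cost at the grid points and vanishes elsewhere.\<close>
  moreover have "ennreal (transport_cost a b P) \<le> quadratic_cost \<pi>"
  proof -
    have "transport_cost a b P = (\<Sum>k\<in>UNIV. (\<Sum>l\<in>UNIV. Q (a k) (b l) * (a k - b l)\<^sup>2 / m' l) / m k)"
      unfolding transport_cost_def P_def sum_divide_distrib by (intro sum.cong refl) (simp add: field_simps)
    also have "\<dots> = (\<Sum>k\<in>UNIV. (\<Sum>y\<in>range b. Q (a k) y * (a k - y)\<^sup>2) / m k)"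
      unfolding m'_def by (subst sum_fibre_average[of "\<lambda>y. Q (a k) y * (a k - y)\<^sup>2" for k]) simp
    also have "\<dots> = (\<Sum>x\<in>range a. \<Sum>y\<in>range b. Q x y * (x - y)\<^sup>2)"
      unfolding m_def by (subst sum_fibre_average[of "\<lambda>x. \<Sum>y\<in>range b. Q x y * (x - y)\<^sup>2"]) simp
    also have "\<dots> = (\<Sum>z\<in>range a \<times> range b. (fst z - snd z)\<^sup>2 * measure \<pi> {z})"
      unfolding sum.cartesian_product by (simp add: Q_def case_prod_beta mult.commute)
    finally have "ennreal (transport_cost a b P) = (\<Sum>z\<in>range a \<times> range b. ennreal ((fst z - snd z)\<^sup>2) * emeasure \<pi> {z})"
      by (simp add: sum_ennreal[symmetric] ennreal_mult emeasure_eq_measure)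
    also have "\<dots> = (\<Sum>z\<in>range a \<times> range b. \<integral>\<^sup>+x. ennreal ((fst z - snd z)\<^sup>2) * indicator {z} x \<partial>\<pi>)"
    proof (intro sum.cong refl)
      fix z :: "real \<times> real"
      from pt[of z] show "ennreal ((fst z - snd z)\<^sup>2) * emeasure \<pi> {z} = (\<integral>\<^sup>+x. ennreal ((fst z - snd z)\<^sup>2) * indicator {z} x \<partial>\<pi>)"
        by (rule nn_integral_cmult_indicator[symmetric])
    qed
    also have "\<dots> = (\<integral>\<^sup>+x. (\<Sum>z\<in>range a \<times> range b. ennreal ((fst z - snd z)\<^sup>2) * indicator {z} x) \<partial>\<pi>)"
    proof (rule nn_integral_sum[symmetric])
      fix z :: "real \<times> real"
      from pt[of z] show "(\<lambda>x. ennreal ((fst z - snd z)\<^sup>2) * indicator {z} x) \<in> borel_measurable \<pi>" by measurable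
    qed
    also have "\<dots> \<le> quadratic_cost \<pi>"
      unfolding quadratic_cost_def
    proof (rule nn_integral_mono)
      fix x :: "real \<times> real"
      have "(\<Sum>z\<in>range a \<times> range b. ennreal ((fst z - snd z)\<^sup>2) * indicator {z} x)
          = (\<Sum>z\<in>range a \<times> range b. if z = x then ennreal ((fst x - snd x)\<^sup>2) else 0)"
        by (intro sum.cong) (auto simp: indicator_def)
      also have "\<dots> \<le> ennreal ((fst x - snd x)\<^sup>2)"
        by (subst sum.delta) auto
      finally show "(\<Sum>z\<in>range a \<times> range b. ennreal ((fst z - snd z)\<^sup>2) * indicator {z} x) \<le> ennreal ((dist (fst x) (snd x))\<^sup>2)"
        by (simp add: dist_real_def)
    qed
    finally show ?thesis .
  qed
  ultimately show ?thesis by (rule that)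
qed

lemma coupling_matrices_nonempty: "(coupling_matrices :: ('n::finite \<Rightarrow> 'n \<Rightarrow> real) set) \<noteq> {}"
proof -
  have "(\<lambda>_ _. 1 / (real CARD('n))\<^sup>2) \<in> (coupling_matrices :: ('n \<Rightarrow> 'n \<Rightarrow> real) set)"
    by (simp add: coupling_matrices_def power2_eq_square)
  then show ?thesis by blast
qed

lemma transport_cost_nonneg: "P \<in> coupling_matrices \<Longrightarrow> 0 \<le> transport_cost a b P"
  unfolding transport_cost_def coupling_matrices_def by (intro sum_nonneg) auto

text \<open>Every matrix yields a coupling of the same cost, and every coupling a matrix of no
  larger cost, so the two infima agree. An epsilon stands in for a minimising matrix. Finiteness of
  the common value makes \<open>enn2real\<close> harmless.\<close>

lemma W2_point_cloud:
  fixes a b :: "'n::finite \<Rightarrow> real"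
  shows "(W2 (point_cloud a) (point_cloud b))\<^sup>2 = (INF P\<in>coupling_matrices. transport_cost a b P)"
proof -
  let ?g = "INF P\<in>coupling_matrices. transport_cost a b P"
  let ?I = "INF \<pi>\<in>couplings (point_cloud a) (point_cloud b). quadratic_cost \<pi>"
  have bdd: "bdd_below (transport_cost a b ` coupling_matrices)"
    by (rule bdd_belowI[of _ 0]) (auto intro: transport_cost_nonneg)
  have g0: "?g \<ge> 0"
    using coupling_matrices_nonempty transport_cost_nonneg by (rule cINF_greatest)
  have "?I = ennreal ?g"
  proof (rule antisym)
    show "?I \<le> ennreal ?g"
    proof (rule ennreal_le_epsilon)
      fix e :: real assume "e > 0"
      have "\<exists>x\<in>transport_cost a b ` coupling_matrices. x < ?g + e"
      proof (rule cInf_lessD)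
        show "transport_cost a b ` coupling_matrices \<noteq> {}" using coupling_matrices_nonempty by (simp only: image_is_empty)
        show "?g < ?g + e" using \<open>e > 0\<close> by (rule less_add_same_cancel1[THEN iffD2])
      qed
      then obtain P where P: "P \<in> coupling_matrices" "transport_cost a b P < ?g + e" by blast
      obtain \<pi> where "\<pi> \<in> couplings (point_cloud a) (point_cloud b)"
          "quadratic_cost \<pi> = ennreal (transport_cost a b P)"
        using coupling_of_matrix[OF P(1), of a b] by blast
      then have "?I \<le> ennreal (transport_cost a b P)"
        by (intro INF_lower2[of \<pi>]) (auto simp only: order_refl)
      also have "\<dots> \<le> ennreal (?g + e)" using P(2) by (intro ennreal_leI) simp
      also have "\<dots> = ennreal ?g + ennreal e" using g0 \<open>e > 0\<close> by (intro ennreal_plus) auto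
      finally show "?I \<le> ennreal ?g + ennreal e" .
    qed
    show "ennreal ?g \<le> ?I"
    proof (rule INF_greatest)
      fix \<pi> assume "\<pi> \<in> couplings (point_cloud a) (point_cloud b)"
      then obtain P where P: "P \<in> coupling_matrices"
          "ennreal (transport_cost a b P) \<le> quadratic_cost \<pi>"
        using matrix_of_coupling by blast
      have "ennreal ?g \<le> ennreal (transport_cost a b P)"
        by (intro ennreal_leI cINF_lower bdd P)
      with P(2) show "ennreal ?g \<le> quadratic_cost \<pi>" by (rule order_trans[rotated])
    qed
  qed
  then show ?thesis unfolding W2_def quadratic_cost_def using g0 by simp
qed

section \<open>The sliced cost as a function of direction and point cloud\<close>

lemma w_eq_INF:
  fixes Z Y :: "real^'d^'n"
  shows "w Z \<theta> Y = (INF P\<in>coupling_matrices. transport_cost (\<lambda>k. \<theta> \<bullet> (Y $ k)) (\<lambda>k. \<theta> \<bullet> (Z $ k)) P)"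
proof -
  have "projected_measure \<theta> (empirical_measure V) = point_cloud (\<lambda>k. \<theta> \<bullet> (V $ k))" for V :: "real^'d^'n"
  proof -
    have "(\<lambda>k. V $ k) \<in> measurable (uniform_count_measure UNIV) borel"
      by (auto simp: measurable_def sets_uniform_count_measure space_uniform_count_measure)
    then show ?thesis
      unfolding projected_measure_def empirical_measure_def point_cloud_def
      by (subst distr_distr) (auto simp: comp_def)
  qed
  then show ?thesis unfolding w_def by (simp add: W2_point_cloud)
qed

lemma transport_cost_diff_le:
  fixes a b a' b' :: "'n::finite \<Rightarrow> real"
  assumes P: "P \<in> coupling_matrices"
    and E: "\<And>k l. \<bar>(a k - b l)\<^sup>2 - (a' k - b' l)\<^sup>2\<bar> \<le> E"
  shows "transport_cost a b P \<le> transport_cost a' b' P + E"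
proof -
  have "transport_cost a b P \<le> (\<Sum>k\<in>UNIV. \<Sum>l\<in>UNIV. P k l * (a' k - b' l)\<^sup>2 + P k l * E)"
    unfolding transport_cost_def distrib_left[symmetric]
  proof (intro sum_mono mult_left_mono)
    fix k l show "(a k - b l)\<^sup>2 \<le> (a' k - b' l)\<^sup>2 + E" using E[of k l] by linarith
    show "0 \<le> P k l" using P by (simp add: coupling_matrices_def)
  qed
  also have "\<dots> = transport_cost a' b' P + (\<Sum>k\<in>UNIV. \<Sum>l\<in>UNIV. P k l) * E"
    unfolding transport_cost_def by (simp add: sum.distrib sum_distrib_right)
  finally show ?thesis using coupling_matrix_sum[OF P] by simp
qed

text \<open>Each matrix has total mass 1, so its cost moves by at most E, and so does the infimum
  over the common set of matrices. Direction and cloud may change together and the directions need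
  not be unit vectors; this one estimate gives the Lipschitz bound, the uniform bound and continuity
  in the direction.\<close>

lemma w_diff_le:
  fixes Z Y Y' :: "real^'d^'n"
  assumes E: "\<And>k l. \<bar>(\<theta> \<bullet> (Y $ k) - \<theta> \<bullet> (Z $ l))\<^sup>2 - (\<theta>' \<bullet> (Y' $ k) - \<theta>' \<bullet> (Z $ l))\<^sup>2\<bar> \<le> E"
  shows "\<bar>w Z \<theta> Y - w Z \<theta>' Y'\<bar> \<le> E"
proof -
  have *: "w Z \<theta> Y \<le> w Z \<theta>' Y' + E"
    if E: "\<And>k l. \<bar>(\<theta> \<bullet> (Y $ k) - \<theta> \<bullet> (Z $ l))\<^sup>2 - (\<theta>' \<bullet> (Y' $ k) - \<theta>' \<bullet> (Z $ l))\<^sup>2\<bar> \<le> E"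
    for \<theta> \<theta>' :: "real^'d" and Y Y' :: "real^'d^'n"
  proof -
    have "w Z \<theta> Y - E \<le> w Z \<theta>' Y'"
      unfolding w_eq_INF[of Z \<theta>' Y']
    proof (rule cINF_greatest[OF coupling_matrices_nonempty])
      fix P :: "'n \<Rightarrow> 'n \<Rightarrow> real" assume P: "P \<in> coupling_matrices"
      have "w Z \<theta> Y \<le> transport_cost (\<lambda>k. \<theta> \<bullet> (Y $ k)) (\<lambda>k. \<theta> \<bullet> (Z $ k)) P"
        unfolding w_eq_INF
        by (rule cINF_lower[OF _ P], rule bdd_belowI[of _ 0]) (auto intro: transport_cost_nonneg)
      also have "\<dots> \<le> transport_cost (\<lambda>k. \<theta>' \<bullet> (Y' $ k)) (\<lambda>k. \<theta>' \<bullet> (Z $ k)) P + E"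
        by (rule transport_cost_diff_le[OF P E])
      finally show "w Z \<theta> Y - E \<le> transport_cost (\<lambda>k. \<theta>' \<bullet> (Y' $ k)) (\<lambda>k. \<theta>' \<bullet> (Z $ k)) P"
        by simp
    qed
    then show ?thesis by simp
  qed
  have E': "\<bar>(\<theta>' \<bullet> (Y' $ k) - \<theta>' \<bullet> (Z $ l))\<^sup>2 - (\<theta> \<bullet> (Y $ k) - \<theta> \<bullet> (Z $ l))\<^sup>2\<bar> \<le> E" for k l
    using E[of k l] by (simp add: abs_minus_commute)
  show ?thesis using *[OF E] *[OF E'] by (simp add: abs_le_iff)
qed

lemma abs_square_diff_le:
  fixes u v :: real
  assumes "\<bar>u - v\<bar> \<le> d" "\<bar>u\<bar> \<le> r" "\<bar>v\<bar> \<le> r"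
  shows "\<bar>u\<^sup>2 - v\<^sup>2\<bar> \<le> 2 * r * d"
proof -
  have "\<bar>u\<^sup>2 - v\<^sup>2\<bar> = \<bar>u + v\<bar> * \<bar>u - v\<bar>"
    by (simp add: power2_eq_square abs_mult[symmetric] algebra_simps)
  also have "\<dots> \<le> (2 * r) * d"
    using assms by (intro mult_mono) linarith+
  finally show ?thesis .
qed

lemma inner_diff_bound:
  fixes Y Z :: "real^'d^'n"
  assumes "norm \<theta> = 1" "norm Y \<le> R"
  shows "\<bar>\<theta> \<bullet> (Y $ k) - \<theta> \<bullet> (Z $ l)\<bar> \<le> R + norm Z"
proof -
  have "\<bar>\<theta> \<bullet> (Y $ k) - \<theta> \<bullet> (Z $ l)\<bar> \<le> norm (Y $ k - Z $ l)"
    using Cauchy_Schwarz_ineq2[of \<theta> "Y $ k - Z $ l"] assms by (simp add: inner_diff_right)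
  also have "\<dots> \<le> norm (Y $ k) + norm (Z $ l)" by (rule norm_triangle_ineq4)
  also have "\<dots> \<le> R + norm Z"
    using Finite_Cartesian_Product.norm_nth_le[of Y k] Finite_Cartesian_Product.norm_nth_le[of Z l] assms by linarith
  finally show ?thesis .
qed

lemma w_Lipschitz:
  fixes Z Y Y' :: "real^'d^'n"
  assumes "norm \<theta> = 1" "norm Y \<le> R" "norm Y' \<le> R"
  shows "\<bar>w Z \<theta> Y - w Z \<theta> Y'\<bar> \<le> 2 * (R + norm Z) * dist Y Y'"
proof (intro w_diff_le abs_square_diff_le)
  fix k l
  have "\<bar>\<theta> \<bullet> (Y $ k) - \<theta> \<bullet> (Y' $ k)\<bar> \<le> norm ((Y - Y') $ k)"
    using Cauchy_Schwarz_ineq2[of \<theta> "(Y - Y') $ k"] assms by (simp add: inner_diff_right)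
  also have "\<dots> \<le> dist Y Y'" using Finite_Cartesian_Product.norm_nth_le[of "Y - Y'" k] by (simp add: dist_norm)
  finally show "\<bar>\<theta> \<bullet> (Y $ k) - \<theta> \<bullet> (Z $ l) - (\<theta> \<bullet> (Y' $ k) - \<theta> \<bullet> (Z $ l))\<bar> \<le> dist Y Y'" by simp
qed (use assms inner_diff_bound in blast)+

lemma w_bound:
  fixes Z Y :: "real^'d^'n"
  assumes "norm \<theta> = 1" "norm Y \<le> R"
  shows "\<bar>w Z \<theta> Y\<bar> \<le> (R + norm Z)\<^sup>2"
proof -
  have "w Z 0 Y = (INF P\<in>(coupling_matrices :: ('n \<Rightarrow> 'n \<Rightarrow> real) set). 0)"
    unfolding w_eq_INF by (simp add: transport_cost_def)
  also have "\<dots> = 0" using coupling_matrices_nonempty by (rule cINF_const)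
  finally have "w Z 0 Y = 0" .
  moreover have "\<bar>w Z \<theta> Y - w Z 0 Y\<bar> \<le> (R + norm Z)\<^sup>2"
  proof (rule w_diff_le)
    fix k l
    have "\<bar>\<theta> \<bullet> (Y $ k) - \<theta> \<bullet> (Z $ l)\<bar>\<^sup>2 \<le> (R + norm Z)\<^sup>2"
      using inner_diff_bound[OF assms] by (rule power_mono) simp
    then show "\<bar>(\<theta> \<bullet> (Y $ k) - \<theta> \<bullet> (Z $ l))\<^sup>2 - (0 \<bullet> (Y $ k) - 0 \<bullet> (Z $ l))\<^sup>2\<bar> \<le> (R + norm Z)\<^sup>2" by simp
  qed
  ultimately show ?thesis by simp
qed

text \<open>The infimum runs over an uncountable set of matrices when there are at least two points,
  so measurability is drawn from Lipschitz continuity in the direction and not from that of the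
  individual costs.\<close>

lemma w_measurable:
  fixes Z Y :: "real^'d^'n"
  shows "(\<lambda>\<theta>. w Z \<theta> Y) \<in> borel_measurable sphere_uniform"
proof -
  define L where "L = 2 * (norm Y + norm Z) * (norm Y + norm Z)"
  have "L-lipschitz_on (sphere 0 1) (\<lambda>\<theta>. w Z \<theta> Y)"
  proof (rule lipschitz_onI)
    fix \<theta> \<theta>' :: "real^'d" assume \<theta>: "\<theta> \<in> sphere 0 1" "\<theta>' \<in> sphere 0 1"
    have "\<bar>w Z \<theta> Y - w Z \<theta>' Y\<bar> \<le> 2 * (norm Y + norm Z) * (dist \<theta> \<theta>' * (norm Y + norm Z))"
    proof (intro w_diff_le abs_square_diff_le)
      fix k l
      have "\<bar>(\<theta> - \<theta>') \<bullet> (Y $ k - Z $ l)\<bar> \<le> norm (\<theta> - \<theta>') * norm (Y $ k - Z $ l)"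
        by (rule Cauchy_Schwarz_ineq2)
      also have "\<dots> \<le> norm (\<theta> - \<theta>') * (norm Y + norm Z)"
        using norm_triangle_ineq4[of "Y $ k" "Z $ l"] Finite_Cartesian_Product.norm_nth_le[of Y k] Finite_Cartesian_Product.norm_nth_le[of Z l]
        by (intro mult_left_mono norm_ge_zero) linarith
      finally show "\<bar>\<theta> \<bullet> (Y $ k) - \<theta> \<bullet> (Z $ l) - (\<theta>' \<bullet> (Y $ k) - \<theta>' \<bullet> (Z $ l))\<bar> \<le> dist \<theta> \<theta>' * (norm Y + norm Z)"
        by (simp add: inner_diff_left inner_diff_right dist_norm algebra_simps)
    qed (use \<theta> inner_diff_bound[of _ Y "norm Y" _ Z] in auto)
    then show "dist (w Z \<theta> Y) (w Z \<theta>' Y) \<le> L * dist \<theta> \<theta>'"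
      by (simp add: L_def dist_real_def mult_ac)
  qed (simp add: L_def)
  then have "continuous_on (sphere 0 1) (\<lambda>\<theta>. w Z \<theta> Y)"
    by (rule lipschitz_on_continuous_on)
  then have "(\<lambda>\<theta>. w Z \<theta> Y) \<in> borel_measurable (restrict_space borel (sphere 0 1))"
    by (rule borel_measurable_continuous_on_restrict)
  then show ?thesis
    by (simp only: measurable_cong_sets[OF sets_sphere_uniform refl])
qed

section \<open>Chaining and compact sets of bounded functions\<close>

abbreviation linf_continuous :: "'i set \<Rightarrow> (('i \<Rightarrow> real) \<Rightarrow> real) \<Rightarrow> bool" where
  "linf_continuous K H \<equiv> continuous_map (mtopology_of (linf K)) euclideanreal H"

lemma three_quarters_power_small:
  assumes "e > 0"
  obtains i :: nat where "i \<ge> j" "9 * (3/4 :: real) ^ i < e"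
proof -
  obtain n where n: "(3/4 :: real) ^ n < e / 9"
    using real_arch_pow_inv[of "e / 9" "3/4"] assms by auto
  have "(3/4 :: real) ^ max j n \<le> (3/4) ^ n"
    by (intro power_decreasing) auto
  with n have "9 * (3/4 :: real) ^ max j n < e" by argo
  then show ?thesis by (intro that[of "max j n"]) auto
qed

lemma Lipschitz_1_imp_continuous_map:
  assumes "\<And>x y. x \<in> mspace m \<Longrightarrow> y \<in> mspace m \<Longrightarrow> \<bar>H x - H y\<bar> \<le> mdist m x y"
  shows "continuous_map (mtopology_of m) euclideanreal H"
proof -
  have "Lipschitz_continuous_map m euclidean_metric H"
    unfolding Lipschitz_continuous_map_def
    using assms by (auto intro!: exI[of _ 1] simp: dist_real_def)
  then show ?thesis
    using Lipschitz_continuous_imp_continuous_map[of m euclidean_metric H] by simp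
qed

lemma topspace_linf: "topspace (mtopology_of (linf K)) = mspace (linf K)"
  unfolding mtopology_of_def by (rule Metric_space.topspace_mtopology[OF Metric_space_mspace_mdist])

lemma openin_linf_Pow: "{U. openin (mtopology_of (linf K)) U} \<subseteq> Pow (mspace (linf K))"
  by (auto dest!: openin_subset simp only: topspace_linf)

lemma space_linf_borel: "space (linf_borel K) = mspace (linf K)"
  unfolding linf_borel_def by (rule space_measure_of[OF openin_linf_Pow])

lemma openin_linf_sets: "openin (mtopology_of (linf K)) U \<Longrightarrow> U \<in> sets (linf_borel K)"
  unfolding linf_borel_def sets_measure_of[OF openin_linf_Pow] by (intro sigma_sets.Basic) simp

lemma linf_borel_functional_measurable:
  assumes "linf_continuous K H"
  shows "H \<in> borel_measurable (linf_borel K)"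
proof (rule borel_measurableI)
  fix U :: "real set" assume "open U"
  then have "openin (mtopology_of (linf K)) {x \<in> topspace (mtopology_of (linf K)). H x \<in> U}"
    using assms by (intro openin_continuous_map_preimage) auto
  also have "{x \<in> topspace (mtopology_of (linf K)). H x \<in> U} = H -` U \<inter> space (linf_borel K)"
    unfolding topspace_linf space_linf_borel by blast
  finally show "H -` U \<inter> space (linf_borel K) \<in> sets (linf_borel K)"
    by (rule openin_linf_sets)
qed

text \<open>The projections take values in K itself, so a function on K can be evaluated at net
  points. Growth of the nets is bounded separately, in \<open>Lipschitz_class\<close>.\<close>

locale dyadic_net =
  fixes K :: "'a::metric_space set" and \<pi> :: "nat \<Rightarrow> 'a \<Rightarrow> 'a" and c :: real
  assumes c_pos: "c > 0" and K_nonempty: "K \<noteq> {}"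
    and net_in: "Y \<in> K \<Longrightarrow> \<pi> j Y \<in> K"
    and net_dist: "Y \<in> K \<Longrightarrow> dist Y (\<pi> j Y) \<le> c / 2 ^ j"
    and net_finite: "finite (\<pi> j ` K)"
begin

text \<open>The ratio 3/4 exceeds the mesh ratio 1/2, so that the sub-Gaussian tail exponents grow like
  (9/4)^j and beat the cardinality of the nets; summing the increments along two chains and across
  one link gives the factor 9 = 2 * 4 + 1 in the modulus of continuity below.\<close>
definition good :: "nat \<Rightarrow> ('a \<Rightarrow> real) \<Rightarrow> bool" where
  "good j x \<longleftrightarrow> (\<forall>u\<in>\<pi> j ` K \<union> \<pi> (Suc j) ` K. \<forall>v\<in>\<pi> j ` K \<union> \<pi> (Suc j) ` K.
      dist u v \<le> 3 * c / 2 ^ j \<longrightarrow> \<bar>x u - x v\<bar> \<le> (3/4) ^ j)"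

text \<open>The modulus starts at level j because chaining controls only the levels from j on;
  across larger distances the bound R takes over. Pinning the values off K makes the set compact for
  pointwise convergence on the whole type.\<close>

definition equicont :: "nat \<Rightarrow> real \<Rightarrow> ('a \<Rightarrow> real) set" where
  "equicont j R = {x \<in> extensional K. (\<forall>Y\<in>K. \<bar>x Y\<bar> \<le> R) \<and>
      (\<forall>i\<ge>j. \<forall>Y\<in>K. \<forall>Y'\<in>K. dist Y Y' \<le> c / 2 ^ i \<longrightarrow> \<bar>x Y - x Y'\<bar> \<le> 9 * (3/4) ^ i)}"

lemma equicontD:
  assumes "x \<in> equicont j R"
  shows "x \<in> extensional K" "Y \<in> K \<Longrightarrow> \<bar>x Y\<bar> \<le> R"
    "j \<le> i \<Longrightarrow> Y \<in> K \<Longrightarrow> Y' \<in> K \<Longrightarrow> dist Y Y' \<le> c / 2 ^ i \<Longrightarrow> \<bar>x Y - x Y'\<bar> \<le> 9 * (3/4) ^ i"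
  using assms unfolding equicont_def by blast+

lemma net_tendsto:
  assumes "Y \<in> K"
  shows "(\<lambda>m. \<pi> m Y) \<longlonglongrightarrow> Y"
proof -
  have "(\<lambda>m. c / 2 ^ m) \<longlonglongrightarrow> 0"
    by (rule LIMSEQ_divide_realpow_zero) simp
  then have "(\<lambda>m. dist (\<pi> m Y) Y) \<longlonglongrightarrow> 0"
    by (rule Lim_null_comparison[rotated]) (use assms net_dist in \<open>auto simp: dist_commute\<close>)
  then show ?thesis
    by (rule tendsto_dist_iff[THEN iffD2])
qed

text \<open>Consecutive projections are at most \<open>3 * c / 2 ^ m\<close> apart, so each link
  costs (3/4)^m. The right-hand side is the exact geometric sum, which lets the induction
  close.\<close>

lemma good_chain:
  assumes good: "\<And>i. i \<ge> j \<Longrightarrow> good i x" and "j \<le> i" "i \<le> m" "Y \<in> K"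
  shows "\<bar>x (\<pi> m Y) - x (\<pi> i Y)\<bar> \<le> 4 * ((3/4) ^ i - (3/4) ^ m)"
  using \<open>i \<le> m\<close>
proof (induction m rule: dec_induct)
  case base
  then show ?case by simp
next
  case (step m)
  have "dist (\<pi> (Suc m) Y) (\<pi> m Y) \<le> dist Y (\<pi> (Suc m) Y) + dist Y (\<pi> m Y)"
    by (metis dist_commute dist_triangle)
  also have "\<dots> \<le> c / 2 ^ Suc m + c / 2 ^ m"
    using net_dist[OF \<open>Y \<in> K\<close>] by (intro add_mono)
  also have "\<dots> \<le> 3 * c / 2 ^ m"
    using c_pos by (simp add: field_simps)
  finally have "\<bar>x (\<pi> (Suc m) Y) - x (\<pi> m Y)\<bar> \<le> (3/4) ^ m"
    using good[of m] \<open>Y \<in> K\<close> \<open>j \<le> i\<close> step(1) unfolding good_def by auto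
  with step.IH show ?case by simp
qed

lemma good_modulus:
  assumes good: "\<And>i. i \<ge> j \<Longrightarrow> good i x" and "j \<le> i" "i \<le> m"
    and "Y \<in> K" "Y' \<in> K" and d: "dist Y Y' \<le> c / 2 ^ i"
  shows "\<bar>x (\<pi> m Y) - x (\<pi> m Y')\<bar> \<le> 9 * (3/4) ^ i"
proof -
  \<comment> \<open>Two projection errors and the distance itself contribute
    \<open>c / 2 ^ i\<close> each: the origin of the 3 in \<open>good\<close>.\<close>
  have "dist (\<pi> i Y) (\<pi> i Y') \<le> dist Y (\<pi> i Y) + dist Y Y' + dist Y' (\<pi> i Y')"
    by (smt (verit) dist_commute dist_triangle)
  also have "\<dots> \<le> c / 2 ^ i + c / 2 ^ i + c / 2 ^ i"
    using net_dist[OF \<open>Y \<in> K\<close>] net_dist[OF \<open>Y' \<in> K\<close>] d by (intro add_mono)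
  also have "\<dots> = 3 * c / 2 ^ i" by simp
  finally have "\<bar>x (\<pi> i Y) - x (\<pi> i Y')\<bar> \<le> (3/4) ^ i"
    using good[of i] \<open>Y \<in> K\<close> \<open>Y' \<in> K\<close> \<open>j \<le> i\<close> unfolding good_def by auto
  moreover have "(3/4 :: real) ^ m \<ge> 0" by simp
  moreover have "\<bar>x (\<pi> m y) - x (\<pi> i y)\<bar> \<le> 4 * ((3/4) ^ i - (3/4) ^ m)" if "y \<in> K" for y
    using good \<open>j \<le> i\<close> \<open>i \<le> m\<close> that by (rule good_chain)
  note this[OF \<open>Y \<in> K\<close>] this[OF \<open>Y' \<in> K\<close>]
  moreover obtain p q where pq: "(3/4 :: real) ^ i = p" "(3/4 :: real) ^ m = q" by simp
  ultimately show ?thesis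
    unfolding pq by (smt (verit))
qed

lemma good_bound:
  assumes good: "\<And>i. i \<ge> j \<Longrightarrow> good i x" and "j \<le> m" "Y \<in> K"
    and R: "\<And>u. u \<in> \<pi> j ` K \<Longrightarrow> \<bar>x u\<bar> \<le> R"
  shows "\<bar>x (\<pi> m Y)\<bar> \<le> R + 4"
proof -
  have "(3/4 :: real) ^ m \<ge> 0" "(3/4 :: real) ^ j \<le> 1" by (auto intro: power_le_one)
  moreover have "\<bar>x (\<pi> m Y) - x (\<pi> j Y)\<bar> \<le> 4 * ((3/4) ^ j - (3/4) ^ m)"
    using good order_refl \<open>j \<le> m\<close> \<open>Y \<in> K\<close> by (rule good_chain)
  moreover have "\<bar>x (\<pi> j Y)\<bar> \<le> R" using R \<open>Y \<in> K\<close> by blast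
  moreover obtain p q where pq: "(3/4 :: real) ^ j = p" "(3/4 :: real) ^ m = q" by simp
  ultimately show ?thesis unfolding pq by (smt (verit))
qed

lemma good_imp_convergent:
  assumes good: "\<And>i. i \<ge> j \<Longrightarrow> good i x" and "Y \<in> K"
  shows "convergent (\<lambda>m. x (\<pi> m Y))"
proof -
  have "Cauchy (\<lambda>m. x (\<pi> m Y))"
  proof (rule metric_CauchyI)
    fix e :: real assume "e > 0"
    obtain i where i: "i \<ge> j" "9 * (3/4 :: real) ^ i < e / 2"
      using three_quarters_power_small[of "e / 2"] \<open>e > 0\<close> by auto
    have *: "\<bar>x (\<pi> m Y) - x (\<pi> i Y)\<bar> < e / 2" if "m \<ge> i" for m
    proof -
      have "(3/4 :: real) ^ m \<ge> 0" by simp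
      moreover have "\<bar>x (\<pi> m Y) - x (\<pi> i Y)\<bar> \<le> 4 * ((3/4) ^ i - (3/4) ^ m)"
        using good i(1) that \<open>Y \<in> K\<close> by (rule good_chain)
      moreover have "(3/4 :: real) ^ i \<ge> 0" by simp
      moreover obtain p q where pq: "(3/4 :: real) ^ i = p" "(3/4 :: real) ^ m = q" by simp
      ultimately show ?thesis using i(2) unfolding pq by (smt (verit))
    qed
    show "\<exists>M. \<forall>m\<ge>M. \<forall>n\<ge>M. dist (x (\<pi> m Y)) (x (\<pi> n Y)) < e"
    proof (intro exI allI impI)
      fix m n assume "m \<ge> i" "n \<ge> i"
      with *[of m] *[of n] show "dist (x (\<pi> m Y)) (x (\<pi> n Y)) < e"
        unfolding dist_real_def by linarith
    qed
  qed
  then show ?thesis by (simp add: Cauchy_convergent_iff)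
qed

text \<open>The estimates along the chains are uniform in the depth m and survive the limit. Only
  values of x at net points enter, so z may be the continuous path itself (empirical process) or an
  extension still to be constructed (Gaussian limit).\<close>

lemma good_limit_equicont:
  assumes good: "\<And>i. i \<ge> j \<Longrightarrow> good i x"
    and R: "\<And>u. u \<in> \<pi> j ` K \<Longrightarrow> \<bar>x u\<bar> \<le> R"
    and z: "z \<in> extensional K" "\<And>Y. Y \<in> K \<Longrightarrow> (\<lambda>m. x (\<pi> m Y)) \<longlonglongrightarrow> z Y"
  shows "z \<in> equicont j (R + 4)"
  unfolding equicont_def
proof (intro CollectI conjI ballI allI impI)
  fix Y assume "Y \<in> K"
  show "\<bar>z Y\<bar> \<le> R + 4"
  proof (rule tendsto_upperbound)
    show "(\<lambda>m. \<bar>x (\<pi> m Y)\<bar>) \<longlonglongrightarrow> \<bar>z Y\<bar>"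
      by (intro tendsto_intros z \<open>Y \<in> K\<close>)
    show "\<forall>\<^sub>F m in sequentially. \<bar>x (\<pi> m Y)\<bar> \<le> R + 4"
      unfolding eventually_sequentially
    proof (intro exI allI impI)
      fix m assume "j \<le> m"
      with good show "\<bar>x (\<pi> m Y)\<bar> \<le> R + 4"
        using \<open>Y \<in> K\<close> R by (rule good_bound)
    qed
  qed simp
next
  fix i Y Y' assume "i \<ge> j" and Y: "Y \<in> K" "Y' \<in> K" and d: "dist Y Y' \<le> c / 2 ^ i"
  show "\<bar>z Y - z Y'\<bar> \<le> 9 * (3/4) ^ i"
  proof (rule tendsto_upperbound)
    show "(\<lambda>m. \<bar>x (\<pi> m Y) - x (\<pi> m Y')\<bar>) \<longlonglongrightarrow> \<bar>z Y - z Y'\<bar>"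
      by (intro tendsto_intros z Y)
    show "\<forall>\<^sub>F m in sequentially. \<bar>x (\<pi> m Y) - x (\<pi> m Y')\<bar> \<le> 9 * (3/4) ^ i"
      unfolding eventually_sequentially
    proof (intro exI allI impI)
      fix m assume "i \<le> m"
      with good \<open>j \<le> i\<close> show "\<bar>x (\<pi> m Y) - x (\<pi> m Y')\<bar> \<le> 9 * (3/4) ^ i"
        using Y d by (rule good_modulus)
    qed
  qed simp
qed (use z in auto)

lemma equicont_tendsto:
  assumes x: "x \<in> equicont j R" and "Y \<in> K"
  shows "(\<lambda>m. x (\<pi> m Y)) \<longlonglongrightarrow> x Y"
proof -
  have "(\<lambda>m. 9 * (3/4 :: real) ^ m) \<longlonglongrightarrow> 0"
    by (intro tendsto_mult_right_zero LIMSEQ_power_zero) simp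
  moreover have "\<forall>\<^sub>F m in sequentially. norm (x (\<pi> m Y) - x Y) \<le> 9 * (3/4) ^ m"
    using eventually_ge_at_top[of j]
  proof eventually_elim
    case (elim m)
    have "\<bar>x Y - x (\<pi> m Y)\<bar> \<le> 9 * (3/4) ^ m"
      using equicontD(3)[OF x elim \<open>Y \<in> K\<close>] net_in[OF \<open>Y \<in> K\<close>] net_dist[OF \<open>Y \<in> K\<close>] by blast
    then show ?case by (simp only: real_norm_def abs_minus_commute)
  qed
  ultimately have "(\<lambda>m. x (\<pi> m Y) - x Y) \<longlonglongrightarrow> 0"
    by (rule Lim_null_comparison[rotated])
  then show ?thesis using LIM_zero_iff by blast
qed

lemma equicont_subset_linf: "equicont j R \<subseteq> mspace (linf K)"
  unfolding mspace_linf equicont_def bounded_iff by (auto simp only: mem_Collect_eq real_norm_def ball_simps)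

text \<open>Tychonoff: a box with factors [-R, R] over K and one-point factors off K, cut by closed
  conditions on pairs of coordinates. The topology of the function type is pointwise
  convergence.\<close>

lemma compact_equicont: "compact (equicont j R)"
proof -
  have ev: "continuous_on UNIV (\<lambda>x::'a \<Rightarrow> real. x Y)" for Y
    by (rule continuous_on_product_coordinates)
  have "compactin (product_topology (\<lambda>_. euclidean) UNIV)
          (PiE UNIV (\<lambda>Y. if Y \<in> K then {-R..R} else {undefined}))"
    by (subst compactin_PiE) auto
  then have 1: "compact (PiE UNIV (\<lambda>Y. if Y \<in> K then {-R..R} else {undefined}))"
    by (simp add: euclidean_product_topology)
  have 2: "closed (\<Inter>i\<in>{j..}. \<Inter>Y\<in>K. \<Inter>Y'\<in>K. {x::'a\<Rightarrow>real. dist Y Y' \<le> c / 2 ^ i \<longrightarrow> \<bar>x Y - x Y'\<bar> \<le> 9 * (3/4) ^ i})"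
  proof (intro closed_INT ballI)
    fix i Y Y'
    have "closed {x::'a\<Rightarrow>real. \<bar>x Y - x Y'\<bar> \<le> 9 * (3/4) ^ i}"
      by (intro closed_Collect_le continuous_on_rabs continuous_on_diff ev continuous_on_const)
    then show "closed {x::'a\<Rightarrow>real. dist Y Y' \<le> c / 2 ^ i \<longrightarrow> \<bar>x Y - x Y'\<bar> \<le> 9 * (3/4) ^ i}"
      by (cases "dist Y Y' \<le> c / 2 ^ i") auto
  qed
  have "equicont j R = PiE UNIV (\<lambda>Y. if Y \<in> K then {-R..R} else {undefined}) \<inter>
      (\<Inter>i\<in>{j..}. \<Inter>Y\<in>K. \<Inter>Y'\<in>K. {x. dist Y Y' \<le> c / 2 ^ i \<longrightarrow> \<bar>x Y - x Y'\<bar> \<le> 9 * (3/4) ^ i})"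
    (is "_ = ?A \<inter> ?B")
  proof (intro set_eqI)
    fix x
    have "x \<in> ?A \<longleftrightarrow> x \<in> extensional K \<and> (\<forall>Y\<in>K. \<bar>x Y\<bar> \<le> R)"
    proof -
      have "x \<in> ?A \<longleftrightarrow> (\<forall>Y. x Y \<in> (if Y \<in> K then {-R..R} else {undefined}))"
        by (simp add: PiE_iff)
      also have "\<dots> \<longleftrightarrow> (\<forall>Y. if Y \<in> K then \<bar>x Y\<bar> \<le> R else x Y = undefined)"
        by (intro all_cong1) (simp add: abs_le_iff, linarith)
      also have "\<dots> \<longleftrightarrow> x \<in> extensional K \<and> (\<forall>Y\<in>K. \<bar>x Y\<bar> \<le> R)"
        unfolding extensional_def mem_Collect_eq by metis
      finally show ?thesis .
    qed
    moreover have "x \<in> ?B \<longleftrightarrow> (\<forall>i\<ge>j. \<forall>Y\<in>K. \<forall>Y'\<in>K. dist Y Y' \<le> c / 2 ^ i \<longrightarrow> \<bar>x Y - x Y'\<bar> \<le> 9 * (3/4) ^ i)"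
      by (simp only: INT_iff mem_Collect_eq atLeast_iff Ball_def)
    ultimately show "x \<in> equicont j R \<longleftrightarrow> x \<in> ?A \<inter> ?B"
      by (simp only: equicont_def Int_iff mem_Collect_eq conj_assoc)
  qed
  then show ?thesis
    using compact_Int_closed[OF 1 2] by (simp only:)
qed

text \<open>With a common modulus, closeness at the finitely many points of a fine net forces
  uniform closeness; hence a functional continuous for the uniform distance is continuous for
  pointwise convergence here.\<close>

lemma linf_continuous_on_equicont:
  assumes H: "linf_continuous K H"
  shows "continuous_on (equicont j R) H"
proof -
  interpret L: Metric_space "mspace (linf K)" "mdist (linf K)"
    by (rule Metric_space_mspace_mdist)
  have "\<exists>A. open A \<and> x \<in> A \<and> (\<forall>y\<in>equicont j R. y \<in> A \<longrightarrow> H y \<in> B)"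
    if x: "x \<in> equicont j R" and B: "open B" "H x \<in> B" for x B
  proof -
    have xm: "x \<in> mspace (linf K)" using x equicont_subset_linf by blast
    have "openin (mtopology_of (linf K)) {y \<in> topspace (mtopology_of (linf K)). H y \<in> B}"
      using H B by (intro openin_continuous_map_preimage) auto
    then obtain e where e: "e > 0" "\<And>y. y \<in> mspace (linf K) \<Longrightarrow> mdist (linf K) x y < e \<Longrightarrow> H y \<in> B"
    proof -
      have "openin L.mtopology {y \<in> mspace (linf K). H y \<in> B}"
        using \<open>openin _ _\<close> by (simp only: mtopology_of_def L.topspace_mtopology)
      moreover have "x \<in> {y \<in> mspace (linf K). H y \<in> B}"
        using xm B by blast
      ultimately obtain e where "e > 0" "L.mball x e \<subseteq> {y \<in> mspace (linf K). H y \<in> B}"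
        unfolding L.openin_mtopology by blast
      then show ?thesis
        using xm by (intro that[of e]) (auto simp only: L.in_mball)
    qed
    \<comment> \<open>One quarter of e for moving to the net in x, one for y, and one for the
      difference at the net point: 3 e / 4 in all.\<close>
    obtain i where i: "i \<ge> j" "9 * (3/4 :: real) ^ i < e / 4"
      using three_quarters_power_small[of "e / 4"] \<open>e > 0\<close> by auto
    define A where "A = (\<Inter>u\<in>\<pi> i ` K. {y::'a\<Rightarrow>real. \<bar>x u - y u\<bar> < e / 4})"
    have "open {y::'a\<Rightarrow>real. \<bar>x u - y u\<bar> < e / 4}" for u
      using continuous_on_product_coordinates[of u]
      by (intro open_Collect_less continuous_on_rabs continuous_on_diff continuous_on_const)
    then have "open A"
      unfolding A_def using net_finite by (intro open_INT) auto
    moreover have "x \<in> A" using \<open>e > 0\<close> by (auto simp: A_def)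
    moreover have "H y \<in> B" if y: "y \<in> equicont j R" "y \<in> A" for y
    proof -
      have ym: "y \<in> mspace (linf K)" using y equicont_subset_linf by blast
      have "\<bar>x Y - y Y\<bar> \<le> 3 * e / 4" if "Y \<in> K" for Y
      proof -
        have "\<bar>x Y - x (\<pi> i Y)\<bar> \<le> 9 * (3/4) ^ i" "\<bar>y Y - y (\<pi> i Y)\<bar> \<le> 9 * (3/4) ^ i"
          using equicontD(3)[OF x i(1) that] equicontD(3)[OF y(1) i(1) that] net_in[OF that] net_dist[OF that]
          by blast+
        moreover have "\<bar>x (\<pi> i Y) - y (\<pi> i Y)\<bar> < e / 4"
          using y that by (auto simp: A_def)
        moreover obtain p where p: "9 * (3/4 :: real) ^ i = p" by simp
        ultimately show ?thesis using i(2) unfolding p by linarith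
      qed
      then have "mdist (linf K) x y \<le> 3 * e / 4"
        unfolding mdist_linf[OF xm ym K_nonempty] by (rule cSUP_least[OF K_nonempty])
      also have "\<dots> < e" using \<open>e > 0\<close> by simp
      finally show ?thesis by (intro e ym)
    qed
    ultimately show ?thesis by blast
  qed
  then show ?thesis
    unfolding continuous_on_topological by blast
qed

text \<open>The set is compact for pointwise convergence, and the identity into the uniform topology
  is continuous on it, since the uniform distance to a fixed point is one of the functionals of
  \<open>linf_continuous_on_equicont\<close>.\<close>

lemma compactin_linf_equicont: "compactin (mtopology_of (linf K)) (equicont j R)"
proof -
  interpret L: Metric_space "mspace (linf K)" "mdist (linf K)"
    by (rule Metric_space_mspace_mdist)
  have "continuous_map (subtopology euclidean (equicont j R)) (mtopology_of (linf K)) id"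
    unfolding continuous_map_def
  proof (intro conjI allI impI)
    show "id \<in> topspace (subtopology euclidean (equicont j R)) \<rightarrow> topspace (mtopology_of (linf K))"
      using equicont_subset_linf unfolding mtopology_of_def L.topspace_mtopology
      by (auto simp only: id_def topspace_euclidean_subtopology)
    fix U assume U: "openin (mtopology_of (linf K)) U"
    show "openin (subtopology euclidean (equicont j R)) {x \<in> topspace (subtopology euclidean (equicont j R)). id x \<in> U}"
    proof (subst openin_subopen, intro ballI)
      fix x assume "x \<in> {x \<in> topspace (subtopology euclidean (equicont j R)). id x \<in> U}"
      then have x: "x \<in> equicont j R" "x \<in> U" by auto
      then have xm: "x \<in> mspace (linf K)" using equicont_subset_linf by blast
      obtain e where e: "e > 0" "L.mball x e \<subseteq> U"
        using U x(2) unfolding mtopology_of_def L.openin_mtopology by blast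
      have "\<bar>mdist (linf K) x y - mdist (linf K) x z\<bar> \<le> mdist (linf K) y z"
        if "y \<in> mspace (linf K)" "z \<in> mspace (linf K)" for y z
        using L.triangle[OF xm that] L.triangle[OF xm that(2,1)] L.commute[of y z] by linarith
      then have "continuous_on (equicont j R) (mdist (linf K) x)"
        by (intro linf_continuous_on_equicont Lipschitz_1_imp_continuous_map)
      then have "openin (top_of_set (equicont j R)) (equicont j R \<inter> mdist (linf K) x -` {..<e})"
        by (rule continuous_openin_preimage_gen) auto
      moreover have "equicont j R \<inter> mdist (linf K) x -` {..<e} \<subseteq> {x \<in> topspace (subtopology euclidean (equicont j R)). id x \<in> U}"
      proof
        fix y assume y: "y \<in> equicont j R \<inter> mdist (linf K) x -` {..<e}"
        then have "y \<in> L.mball x e"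
          using xm equicont_subset_linf unfolding L.in_mball by blast
        with e(2) y show "y \<in> {x \<in> topspace (top_of_set (equicont j R)). id x \<in> U}"
          by auto
      qed
      moreover have "x \<in> equicont j R \<inter> mdist (linf K) x -` {..<e}"
        using x L.mdist_zero[OF xm] e(1) by (simp only: Int_iff vimage_eq lessThan_iff)
      ultimately show "\<exists>T. openin (top_of_set (equicont j R)) T \<and> x \<in> T \<and> T \<subseteq> {x \<in> topspace (subtopology euclidean (equicont j R)). id x \<in> U}"
        by blast
    qed
  qed
  moreover have "compactin (subtopology euclidean (equicont j R)) (equicont j R)"
    using compact_equicont by (simp add: compactin_subtopology)
  ultimately have "compactin (mtopology_of (linf K)) (id ` equicont j R)"
    by (rule image_compactin[rotated])
  then show ?thesis by (simp only: image_id id_apply)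
qed

end

section \<open>Trigonometric approximation of functionals\<close>

text \<open>The phase b covers sines, and an empty F gives constants. Closure under products is
  derived and not generated, so an induction over the set meets only single cosines and sums, whose
  expectations are accessible.\<close>

inductive_set trig :: "'i set \<Rightarrow> (('i \<Rightarrow> real) \<Rightarrow> real) set" for K :: "'i set" where
  trig_cos: "finite F \<Longrightarrow> F \<subseteq> K \<Longrightarrow> (\<lambda>x. a * cos ((\<Sum>Y\<in>F. t Y * x Y) + b)) \<in> trig K"
| trig_add: "f \<in> trig K \<Longrightarrow> g \<in> trig K \<Longrightarrow> (\<lambda>x. f x + g x) \<in> trig K"

lemma trig_const: "(\<lambda>x. a) \<in> trig K"
  using trig_cos[of "{}" K a _ 0] by simp

lemma linear_form_add:
  fixes t s :: "'i \<Rightarrow> real"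
  assumes "finite F" "finite G"
  shows "(\<Sum>Y\<in>F. t Y * x Y) + (\<Sum>Y\<in>G. s Y * x Y)
    = (\<Sum>Y\<in>F \<union> G. ((if Y \<in> F then t Y else 0) + (if Y \<in> G then s Y else 0)) * x Y)"
proof -
  have "(\<Sum>Y\<in>F. t Y * x Y) = (\<Sum>Y\<in>F \<union> G. (if Y \<in> F then t Y else 0) * x Y)"
    using assms by (intro sum.mono_neutral_cong_left) auto
  moreover have "(\<Sum>Y\<in>G. s Y * x Y) = (\<Sum>Y\<in>F \<union> G. (if Y \<in> G then s Y else 0) * x Y)"
    using assms by (intro sum.mono_neutral_cong_left) auto
  ultimately show ?thesis
    by (simp add: sum.distrib distrib_right)
qed

text \<open>Product-to-sum formula; the two linear forms are extended by zero to
  \<open>F \<union> G\<close> and then added and subtracted.\<close>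

lemma trig_mult:
  assumes "f \<in> trig K" "g \<in> trig K"
  shows "(\<lambda>x. f x * g x) \<in> trig K"
  using assms
proof (induction f rule: trig.induct)
  case (trig_cos F a t b)
  note F = trig_cos(1,2)
  from \<open>g \<in> trig K\<close> show ?case
  proof (induction g rule: trig.induct)
    case (trig_cos G a' s b')
    note G = trig_cos
    define p where "p = (\<lambda>Y. (if Y \<in> F then t Y else 0) + (if Y \<in> G then s Y else 0))"
    define m where "m = (\<lambda>Y. (if Y \<in> F then t Y else 0) + (if Y \<in> G then - s Y else 0))"
    have 1: "(\<Sum>Y\<in>F. t Y * x Y) + (\<Sum>Y\<in>G. s Y * x Y) = (\<Sum>Y\<in>F \<union> G. p Y * x Y)" for x
      unfolding p_def by (rule linear_form_add) (use F G in auto)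
    have 2: "(\<Sum>Y\<in>F. t Y * x Y) - (\<Sum>Y\<in>G. s Y * x Y) = (\<Sum>Y\<in>F \<union> G. m Y * x Y)" for x
      using linear_form_add[of F G t x "\<lambda>Y. - s Y"] F G by (simp add: m_def sum_negf)
    have "(\<lambda>x. (a * a' / 2) * cos ((\<Sum>Y\<in>F \<union> G. m Y * x Y) + (b - b'))
            + (a * a' / 2) * cos ((\<Sum>Y\<in>F \<union> G. p Y * x Y) + (b + b'))) \<in> trig K"
      using F G by (intro trig.intros) auto
    also have "(\<lambda>x. (a * a' / 2) * cos ((\<Sum>Y\<in>F \<union> G. m Y * x Y) + (b - b'))
            + (a * a' / 2) * cos ((\<Sum>Y\<in>F \<union> G. p Y * x Y) + (b + b')))
        = (\<lambda>x. a * cos ((\<Sum>Y\<in>F. t Y * x Y) + b) * (a' * cos ((\<Sum>Y\<in>G. s Y * x Y) + b')))"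
    proof
      fix x
      have "cos ((\<Sum>Y\<in>F. t Y * x Y) + b) * cos ((\<Sum>Y\<in>G. s Y * x Y) + b')
        = (cos ((\<Sum>Y\<in>F \<union> G. m Y * x Y) + (b - b')) + cos ((\<Sum>Y\<in>F \<union> G. p Y * x Y) + (b + b'))) / 2"
        unfolding cos_times_cos 1[symmetric] 2[symmetric] by (simp add: algebra_simps)
      then show "(a * a' / 2) * cos ((\<Sum>Y\<in>F \<union> G. m Y * x Y) + (b - b'))
            + (a * a' / 2) * cos ((\<Sum>Y\<in>F \<union> G. p Y * x Y) + (b + b'))
        = a * cos ((\<Sum>Y\<in>F. t Y * x Y) + b) * (a' * cos ((\<Sum>Y\<in>G. s Y * x Y) + b'))"
        by (simp add: field_simps)
    qed
    finally show ?case .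
  next
    case (trig_add f g)
    from trig.trig_add[OF trig_add.IH] show ?case by (simp add: distrib_left)
  qed
next
  case (trig_add f1 f2)
  from trig.trig_add[OF trig_add.IH] trig_add.prems show ?case by (simp add: distrib_right)
qed

lemma trig_bounded:
  assumes "T \<in> trig K"
  obtains B where "\<And>x. \<bar>T x\<bar> \<le> B"
proof -
  have "\<exists>B. \<forall>x. \<bar>T x\<bar> \<le> B"
    using assms
  proof induction
    case (trig_cos F a t b)
    show ?case
      by (intro exI[of _ "\<bar>a\<bar>"] allI) (simp add: abs_mult mult_left_le)
  next
    case (trig_add f g)
    then obtain B B' where "\<forall>x. \<bar>f x\<bar> \<le> B" "\<forall>x. \<bar>g x\<bar> \<le> B'" by blast
    then have "\<forall>x. \<bar>f x + g x\<bar> \<le> B + B'"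
      by (metis abs_triangle_ineq add_mono order_trans)
    then show ?case by blast
  qed
  then show ?thesis using that by blast
qed

lemma trig_measurable:
  assumes "T \<in> trig K" and X: "\<And>Y. Y \<in> K \<Longrightarrow> (\<lambda>om. X om Y) \<in> borel_measurable M"
  shows "(\<lambda>om. T (X om)) \<in> borel_measurable M"
  using assms(1)
proof induction
  case (trig_cos F a t b)
  then have "Y \<in> F \<Longrightarrow> (\<lambda>om. X om Y) \<in> borel_measurable M" for Y using X by blast
  then show ?case by measurable
qed auto

lemma trig_polynomial:
  assumes "real_polynomial_function q" "T \<in> trig K"
  shows "(\<lambda>x. q (T x)) \<in> trig K"
  using assms(1)
proof induction
  case (linear f)
  then have "f s = f 1 * s" for s
    using linear_scale[OF bounded_linear.linear, of f s 1] by simp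
  then have "(\<lambda>x. f (T x)) = (\<lambda>x. f 1 * T x)" by metis
  with trig_mult[OF trig_const assms(2)] show ?case by simp
qed (auto intro: trig_const trig_add trig_mult)

context dyadic_net
begin

text \<open>The values on K are limits of values at net points, so restriction r to the countably
  many net points is injective on \<open>equicont j R\<close>. As a continuous injection of a
  compact set it is a homeomorphism onto its image in a sequence space, where Stone-Weierstrass is
  applied to H composed with the inverse.\<close>

lemma trig_dense:
  assumes H: "continuous_on (equicont j R) H" and "e > 0"
  obtains T where "T \<in> trig K" "\<And>x. x \<in> equicont j R \<Longrightarrow> \<bar>H x - T x\<bar> < e"
proof -
  define D where "D = (\<Union>m. \<pi> m ` K)"
  define y where "y = from_nat_into D"
  define r where "r = (\<lambda>(x::'a\<Rightarrow>real) k. x (y k))"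
  have "countable D" unfolding D_def using net_finite by (auto intro: countable_finite)
  moreover have "D \<noteq> {}" unfolding D_def using K_nonempty by auto
  ultimately have ran: "range y = D" unfolding y_def by (intro range_from_nat_into)
  have "D \<subseteq> K" unfolding D_def using net_in by auto
  then have yK: "y k \<in> K" for k using ran by blast
  have inj: "inj_on r (equicont j R)"
  proof (rule inj_onI)
    fix x x' assume x: "x \<in> equicont j R" "x' \<in> equicont j R" and eq: "r x = r x'"
    have eqD: "x u = x' u" if u: "u \<in> D" for u
    proof -
      obtain k where "u = y k" using u ran by blast
      then show ?thesis using fun_cong[OF eq, of k] by (simp add: r_def)
    qed
    show "x = x'"
    proof (rule extensionalityI)
      fix Y assume Y: "Y \<in> K"
      have "(\<lambda>m. x (\<pi> m Y)) = (\<lambda>m. x' (\<pi> m Y))"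
        using eqD Y unfolding D_def by blast
      then show "x Y = x' Y"
        using equicont_tendsto[OF x(1) Y] equicont_tendsto[OF x(2) Y] LIMSEQ_unique by metis
    qed (use x equicontD(1) in blast)+
  qed
  have cr: "continuous_on S r" for S
    unfolding r_def
    by (intro continuous_on_coordinatewise_then_product)
       (rule continuous_on_subset[OF continuous_on_product_coordinates], simp)
  define g where "g = inv_into (equicont j R) r"
  have "continuous_on (r ` equicont j R) g"
    by (rule continuous_on_inv[OF cr compact_equicont]) (simp add: g_def inv_into_f_f[OF inj])
  moreover have "g ` r ` equicont j R \<subseteq> equicont j R"
    unfolding g_def by (auto intro: inv_into_into)
  ultimately have cH: "continuous_on (r ` equicont j R) (\<lambda>a. H (g a))"
    using continuous_on_compose2[OF H] by blast
  define A where "A = {\<phi> :: (nat \<Rightarrow> real) \<Rightarrow> real. continuous_on UNIV \<phi> \<and> (\<lambda>x. \<phi> (r x)) \<in> trig K}"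
  interpret SW: function_ring_on A "r ` equicont j R"
  proof
    show "compact (r ` equicont j R)"
      by (rule compact_continuous_image[OF cr compact_equicont])
    show "continuous_on (r ` equicont j R) f" if "f \<in> A" for f
      using that continuous_on_subset unfolding A_def by blast
    show "(\<lambda>x. f x + g x) \<in> A" if "f \<in> A" "g \<in> A" for f g
      using that by (auto simp: A_def intro: continuous_on_add trig_add)
    show "(\<lambda>x. f x * g x) \<in> A" if "f \<in> A" "g \<in> A" for f g
      using that by (auto simp: A_def intro: continuous_on_mult trig_mult)
    show "(\<lambda>_. s) \<in> A" for s
      by (auto simp: A_def intro: trig_const)
    fix a b :: "nat \<Rightarrow> real"
    assume "a \<noteq> b"
    then obtain k where k: "a k \<noteq> b k" by auto
    \<comment> \<open>This scaling brings \<open>t * a k\<close> and \<open>t * b k\<close> into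
      [-1, 1], where the sine is injective; the phase \<open>- pi / 2\<close> turns the cosine into
      a sine.\<close>
    define t where "t = 1 / (1 + \<bar>a k\<bar> + \<bar>b k\<bar>)"
    have t: "t > 0" by (simp add: t_def)
    define \<phi> where "\<phi> = (\<lambda>v :: nat \<Rightarrow> real. cos (t * v k - pi / 2))"
    have "continuous_on UNIV \<phi>"
      unfolding \<phi>_def
      by (intro continuous_on_cos continuous_on_diff continuous_on_mult_left continuous_on_const
            continuous_on_product_coordinates)
    moreover have "(\<lambda>x. \<phi> (r x)) \<in> trig K"
      using trig_cos[of "{y k}" K 1 "\<lambda>_. t" "- pi / 2"] yK by (simp add: \<phi>_def r_def)
    moreover have "\<phi> a \<noteq> \<phi> b"
    proof -
      have *: "\<bar>t * v\<bar> \<le> pi / 2" if "\<bar>v\<bar> \<le> 1 + \<bar>a k\<bar> + \<bar>b k\<bar>" for v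
      proof -
        have "1 + \<bar>a k\<bar> + \<bar>b k\<bar> \<noteq> 0" by (smt (verit) abs_ge_zero)
        then have "t * (1 + \<bar>a k\<bar> + \<bar>b k\<bar>) = 1" by (simp add: t_def)
        then have "\<bar>t * v\<bar> \<le> 1"
          using mult_left_mono[OF that, of t] t by (simp add: abs_mult)
        then show ?thesis using pi_half_gt_zero pi_ge_two by linarith
      qed
      have "t * a k \<noteq> t * b k" using k t by simp
      moreover have "\<bar>t * a k\<bar> \<le> pi / 2" "\<bar>t * b k\<bar> \<le> pi / 2" by (intro *; simp)+
      ultimately have "sin (t * a k) \<noteq> sin (t * b k)"
        using sin_inj_pi[of "t * a k" "t * b k"] unfolding abs_le_iff by linarith
      then show ?thesis by (simp add: \<phi>_def cos_diff)
    qed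
    ultimately show "\<exists>f\<in>A. f a \<noteq> f b" unfolding A_def by blast
  qed
  obtain \<phi> where \<phi>: "\<phi> \<in> A" "\<And>a. a \<in> r ` equicont j R \<Longrightarrow> \<bar>H (g a) - \<phi> a\<bar> < e"
    using SW.Stone_Weierstrass_basic[OF cH \<open>e > 0\<close>] by blast
  show ?thesis
  proof (rule that)
    show "(\<lambda>x. \<phi> (r x)) \<in> trig K" using \<phi>(1) by (simp add: A_def)
    show "\<bar>H x - \<phi> (r x)\<bar> < e" if "x \<in> equicont j R" for x
      using \<phi>(2)[of "r x"] that by (simp add: g_def inv_into_f_f[OF inj])
  qed
qed

text \<open>Composing with a polynomial that approximates truncation keeps the approximants bounded
  off the compact set, where nothing else controls them.\<close>
lemma trig_dense_bounded:
  assumes H: "continuous_on (equicont j R) H" and b: "\<And>x. x \<in> equicont j R \<Longrightarrow> \<bar>H x\<bar> \<le> b" "b \<ge> 0" and "e > 0"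
  obtains T where "T \<in> trig K" "\<And>x. x \<in> equicont j R \<Longrightarrow> \<bar>H x - T x\<bar> < e" "\<And>x. \<bar>T x\<bar> \<le> b + e"
proof -
  obtain T where T: "T \<in> trig K" "\<And>x. x \<in> equicont j R \<Longrightarrow> \<bar>H x - T x\<bar> < e / 2"
    using trig_dense[OF H, of "e / 2"] \<open>e > 0\<close> by auto
  obtain B where B: "\<And>x. \<bar>T x\<bar> \<le> B" using trig_bounded[OF T(1)] by blast
  obtain q :: "real \<Rightarrow> real" where q: "real_polynomial_function q"
      "\<And>s. s \<in> {-B..B} \<Longrightarrow> \<bar>max (-b) (min b s) - q s\<bar> < e / 2"
  proof (rule Stone_Weierstrass_real_polynomial_function)
    show "continuous_on {-B..B} (\<lambda>s. max (-b) (min b s))"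
      by (intro continuous_on_max continuous_on_min continuous_on_const continuous_on_id)
    show "compact {-B..B}" "e / 2 > 0" using \<open>e > 0\<close> by auto
  qed blast
  have q': "\<bar>max (-b) (min b (T x)) - q (T x)\<bar> < e / 2" for x
    using q(2)[of "T x"] B[of x] by (auto simp: abs_le_iff)
  show ?thesis
  proof (rule that)
    show "(\<lambda>x. q (T x)) \<in> trig K" by (rule trig_polynomial[OF q(1) T(1)])
    \<comment> \<open>As H x lies in [-b, b], truncating T x to that interval takes it no farther
      from H x.\<close>
    show "\<bar>H x - q (T x)\<bar> < e" if "x \<in> equicont j R" for x
      using q'[of x] T(2)[OF that] b(1)[OF that] by linarith
    show "\<bar>q (T x)\<bar> \<le> b + e" for x
      using q'[of x] b(2) \<open>e > 0\<close> by linarith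
  qed
qed

text \<open>On A the functional is a limit of trigonometric polynomials, each of which reads only
  finitely many coordinates of the path.\<close>

lemma linf_functional_measurable:
  assumes H: "linf_continuous K H"
    and A: "A \<in> sets M" "\<And>om. om \<in> A \<Longrightarrow> X om \<in> equicont j R"
    and X: "\<And>Y. Y \<in> K \<Longrightarrow> (\<lambda>om. X om Y) \<in> borel_measurable M"
  shows "(\<lambda>om. indicator A om * H (X om)) \<in> borel_measurable M"
proof -
  have "\<exists>T. T \<in> trig K \<and> (\<forall>x\<in>equicont j R. \<bar>H x - T x\<bar> < 1 / real (Suc k))" for k
    using trig_dense[OF linf_continuous_on_equicont[OF H], of "1 / real (Suc k)"] by (metis of_nat_0_less_iff zero_less_Suc zero_less_divide_1_iff)
  then obtain T where T: "\<And>k. T k \<in> trig K" "\<And>k x. x \<in> equicont j R \<Longrightarrow> \<bar>H x - T k x\<bar> < 1 / real (Suc k)"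
    by metis
  show ?thesis
  proof (rule borel_measurable_LIMSEQ_real)
    show "(\<lambda>om. indicator A om * T k (X om)) \<in> borel_measurable M" for k
      using trig_measurable[OF T(1) X] A(1) by measurable
    fix om
    show "(\<lambda>k. indicator A om * T k (X om)) \<longlonglongrightarrow> indicator A om * H (X om)"
    proof (cases "om \<in> A")
      case True
      have "(\<lambda>k. T k (X om) - H (X om)) \<longlonglongrightarrow> 0"
      proof (rule Lim_null_comparison)
        show "\<forall>\<^sub>F k in sequentially. norm (T k (X om) - H (X om)) \<le> 1 / real (Suc k)"
          using T(2)[OF A(2)[OF True]] by (intro always_eventually allI) (simp add: abs_minus_commute less_imp_le del: of_nat_Suc)
        show "(\<lambda>k. 1 / real (Suc k)) \<longlonglongrightarrow> 0"
          by (rule LIMSEQ_Suc[OF lim_1_over_n])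
      qed
      then show ?thesis using True LIM_zero_iff by fastforce
    qed simp
  qed
qed

text \<open>In a non-separable space measurable evaluations do not in general imply Borel
  measurability; paths in countably many equicontinuous sets restore it. An open U is the set where
  the distance to its complement is positive, and this distance is a 1-Lipschitz functional.\<close>

lemma measurable_linf_borel:
  assumes A: "\<And>n::nat. A n \<in> sets M" "(\<Union>n. A n) = space M"
    and eq: "\<And>n om. om \<in> A n \<Longrightarrow> X om \<in> equicont (j n) (R n)"
    and X: "\<And>Y. Y \<in> K \<Longrightarrow> (\<lambda>om. X om Y) \<in> borel_measurable M"
  shows "X \<in> measurable M (linf_borel K)"
  unfolding linf_borel_def
proof (rule measurable_measure_of)
  interpret L: Metric_space "mspace (linf K)" "mdist (linf K)"
    by (rule Metric_space_mspace_mdist)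
  show "{U. openin (mtopology_of (linf K)) U} \<subseteq> Pow (mspace (linf K))"
    by (rule openin_linf_Pow)
  show Xm: "X \<in> space M \<rightarrow> mspace (linf K)"
    using A(2) eq equicont_subset_linf by blast
  fix U assume "U \<in> {U. openin (mtopology_of (linf K)) U}"
  then have U: "openin L.mtopology U" by (simp only: mem_Collect_eq mtopology_of_def)
  show "X -` U \<inter> space M \<in> sets M"
  \<comment> \<open>An empty complement is excluded, because the distance to it would be an infimum
    over the empty set.\<close>
  proof (cases "mspace (linf K) \<subseteq> U")
    case True
    then have "X -` U \<inter> space M = space M" using Xm by blast
    then show ?thesis by simp
  next
    case False
    define S where "S = mspace (linf K) - U"
    have S: "S \<noteq> {}" "S \<subseteq> mspace (linf K)" using False by (auto simp only: S_def)
    define H where "H = (\<lambda>x. INF z\<in>S. mdist (linf K) x z)"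
    have bdd: "bdd_below (mdist (linf K) x ` S)" for x
      by (rule bdd_belowI[of _ 0]) (use L.nonneg in blast)
    have le: "H x \<le> mdist (linf K) x y + H y" if "x \<in> mspace (linf K)" "y \<in> mspace (linf K)" for x y
    proof -
      have "H x - mdist (linf K) x y \<le> H y"
        unfolding H_def
      proof (rule cINF_greatest[OF S(1)])
        fix z assume "z \<in> S"
        have "(INF z\<in>S. mdist (linf K) x z) \<le> mdist (linf K) x z"
          by (rule cINF_lower[OF bdd \<open>z \<in> S\<close>])
        also have "\<dots> \<le> mdist (linf K) x y + mdist (linf K) y z"
          using L.triangle that S(2) \<open>z \<in> S\<close> by blast
        finally show "(INF z\<in>S. mdist (linf K) x z) - mdist (linf K) x y \<le> mdist (linf K) y z"
          by linarith
      qed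
      then show ?thesis by linarith
    qed
    have contH: "linf_continuous K H"
      by (rule Lipschitz_1_imp_continuous_map) (smt (verit, best) le L.commute)
    have U_iff: "x \<in> U \<longleftrightarrow> H x > 0" if x: "x \<in> mspace (linf K)" for x
    proof
      assume "x \<in> U"
      then obtain e where e: "e > 0" "L.mball x e \<subseteq> U"
        using U unfolding L.openin_mtopology by blast
      have "e \<le> H x"
        unfolding H_def
      proof (rule cINF_greatest[OF S(1)])
        fix z assume "z \<in> S"
        then have "z \<notin> L.mball x e" "z \<in> mspace (linf K)" using e(2) unfolding S_def by blast+
        then show "e \<le> mdist (linf K) x z" using x unfolding L.in_mball by linarith
      qed
      with e(1) show "H x > 0" by linarith
    next
      assume "H x > 0"
      show "x \<in> U"
      proof (rule ccontr)
        assume "x \<notin> U"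
        then have "x \<in> S" using x unfolding S_def by blast
        then have "H x \<le> mdist (linf K) x x" unfolding H_def by (rule cINF_lower[OF bdd])
        then show False using \<open>H x > 0\<close> L.mdist_zero[OF x] by linarith
      qed
    qed
    have "X -` U \<inter> space M = (\<Union>n. {om \<in> space M. indicator (A n) om * H (X om) > 0})"
    proof (intro set_eqI iffI)
      fix om assume "om \<in> X -` U \<inter> space M"
      moreover from this obtain n where "om \<in> A n" using A(2) by blast
      ultimately show "om \<in> (\<Union>n. {om \<in> space M. indicator (A n) om * H (X om) > 0})"
        using U_iff[of "X om"] Xm by (intro UN_I[of n]) auto
    next
      fix om assume "om \<in> (\<Union>n. {om \<in> space M. indicator (A n) om * H (X om) > 0})"
      then obtain n where "om \<in> space M" "indicator (A n) om * H (X om) > 0" by blast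
      then have "H (X om) > 0" by (cases "om \<in> A n") auto
      then show "om \<in> X -` U \<inter> space M"
        using U_iff[of "X om"] Xm \<open>om \<in> space M\<close> by blast
    qed
    also have "\<dots> \<in> sets M"
    proof (rule sets.countable_UN, safe)
      fix n
      have [measurable]: "(\<lambda>om. indicator (A n) om * H (X om)) \<in> borel_measurable M"
        by (rule linf_functional_measurable[OF contH A(1) eq X])
      show "{om \<in> space M. indicator (A n) om * H (X om) > 0} \<in> sets M" by measurable
    qed
    finally show ?thesis .
  qed
qed

end

section \<open>Dyadic nets in compact subsets of Euclidean space\<close>

lemma compact_dyadic_net:
  fixes K :: "'a::euclidean_space set"
  assumes "compact K" "K \<noteq> {}"
  obtains \<pi> c A q where "dyadic_net K \<pi> c" "\<And>j. real (card (\<pi> j ` K)) \<le> A * q ^ j" "A > 0" "q > 0"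
proof -
  obtain B0 where B0: "\<And>Y. Y \<in> K \<Longrightarrow> norm Y \<le> B0"
    using compact_imp_bounded[OF assms(1)] unfolding bounded_iff by blast
  define B where "B = nat \<lceil>B0\<rceil>"
  have B: "norm Y \<le> real B" if "Y \<in> K" for Y
    using B0[OF that] unfolding B_def by (meson of_nat_ceiling order_trans)
  \<comment> \<open>Integer coordinates of the half-open cube of side 2^-j that contains Y.\<close>
  define cell where "cell = (\<lambda>(j::nat) (Y::'a). \<lambda>b\<in>Basis. \<lfloor>2 ^ j * (Y \<bullet> b)\<rfloor>)"
  \<comment> \<open>The representative depends only on the cube, so there are no more net points
    than occupied cubes, and it is picked inside K.\<close>
  define \<pi> where "\<pi> = (\<lambda>j Y. SOME Y'. Y' \<in> K \<and> cell j Y' = cell j Y)"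
  have \<pi>: "\<pi> j Y \<in> K \<and> cell j (\<pi> j Y) = cell j Y" if "Y \<in> K" for j Y
    unfolding \<pi>_def by (rule someI[of _ Y]) (use that in auto)
  have cells: "cell j ` K \<subseteq> PiE Basis (\<lambda>_. {- int (B * 2 ^ j)..int (B * 2 ^ j)})" for j
  proof (rule image_subsetI)
    fix Y assume "Y \<in> K"
    have "\<lfloor>2 ^ j * (Y \<bullet> b)\<rfloor> \<in> {- int (B * 2 ^ j)..int (B * 2 ^ j)}" if "b \<in> Basis" for b
    proof -
      have "\<bar>Y \<bullet> b\<bar> \<le> real B" using Basis_le_norm[OF that, of Y] B[OF \<open>Y \<in> K\<close>] by linarith
      then have "\<bar>2 ^ j * (Y \<bullet> b)\<bar> \<le> 2 ^ j * real B"
        by (simp add: abs_mult)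
      then have "- real (B * 2 ^ j) \<le> 2 ^ j * (Y \<bullet> b)" "2 ^ j * (Y \<bullet> b) \<le> real (B * 2 ^ j)"
        by (simp_all add: abs_le_iff mult.commute)
      then show ?thesis
        by (metis (no_types, lifting) atLeastAtMost_iff floor_mono floor_of_int of_int_minus of_int_of_nat_eq)
    qed
    then show "cell j Y \<in> PiE Basis (\<lambda>_. {- int (B * 2 ^ j)..int (B * 2 ^ j)})"
      unfolding cell_def by auto
  qed
  have fin: "finite (cell j ` K)" for j
    by (rule finite_subset[OF cells finite_PiE]) auto
  have img: "\<pi> j ` K = (\<lambda>p. SOME Y'. Y' \<in> K \<and> cell j Y' = p) ` cell j ` K" for j
    unfolding \<pi>_def by (simp add: image_image)
  \<comment> \<open>In each coordinate there are at most 2 B 2^j + 1 <= (2 B + 1) 2^j cubes; the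
    power of the dimension gives A and q.\<close>
  have card: "real (card (\<pi> j ` K)) \<le> (2 * real B + 1) ^ DIM('a) * (2 ^ DIM('a)) ^ j" for j
  proof -
    have "card (\<pi> j ` K) \<le> card (cell j ` K)"
      unfolding img by (rule card_image_le[OF fin])
    also have "\<dots> \<le> card (PiE (Basis::'a set) (\<lambda>_. {- int (B * 2 ^ j)..int (B * 2 ^ j)}))"
      by (rule card_mono[OF finite_PiE cells]) auto
    also have "\<dots> = (2 * B * 2 ^ j + 1) ^ DIM('a)"
      by (subst card_PiE) (auto simp: nat_add_distrib nat_mult_distrib nat_power_eq mult.assoc)
    also have "\<dots> \<le> ((2 * B + 1) * 2 ^ j) ^ DIM('a)"
      by (intro power_mono) (auto simp: algebra_simps)
    finally have "real (card (\<pi> j ` K)) \<le> real (((2 * B + 1) * 2 ^ j) ^ DIM('a))"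
      by (rule of_nat_mono)
    also have "\<dots> = (2 * real B + 1) ^ DIM('a) * (2 ^ DIM('a)) ^ j"
      by (simp only: of_nat_power of_nat_mult of_nat_add of_nat_numeral of_nat_1 power_mult_distrib power_mult[symmetric] mult.commute[of j])
    finally show ?thesis .
  qed
  \<comment> \<open>Points of one cube differ by at most 2^-j in each coordinate; passing through
    the l1 norm makes c the dimension.\<close>
  have dist: "dist Y (\<pi> j Y) \<le> real DIM('a) / 2 ^ j" if "Y \<in> K" for Y j
  proof -
    have "\<bar>(Y - \<pi> j Y) \<bullet> b\<bar> \<le> 1 / 2 ^ j" if b: "b \<in> Basis" for b
    proof -
      have "\<lfloor>2 ^ j * (Y \<bullet> b)\<rfloor> = \<lfloor>2 ^ j * (\<pi> j Y \<bullet> b)\<rfloor>"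
        using fun_cong[OF conjunct2[OF \<pi>[OF \<open>Y \<in> K\<close>, of j]], of b] b by (simp add: cell_def)
      then have "\<bar>2 ^ j * (Y \<bullet> b) - 2 ^ j * (\<pi> j Y \<bullet> b)\<bar> \<le> 1"
        by linarith
      then have "2 ^ j * \<bar>(Y - \<pi> j Y) \<bullet> b\<bar> \<le> 1"
        by (simp add: inner_diff_left abs_mult flip: right_diff_distrib)
      then show ?thesis by (simp add: field_simps)
    qed
    then have "(\<Sum>b\<in>Basis. \<bar>(Y - \<pi> j Y) \<bullet> b\<bar>) \<le> (\<Sum>b\<in>(Basis::'a set). 1 / 2 ^ j)"
      by (rule sum_mono)
    with norm_le_l1[of "Y - \<pi> j Y"] show ?thesis by (simp add: dist_norm)
  qed
  have "dyadic_net K \<pi> (real DIM('a))"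
  proof
    show "finite (\<pi> j ` K)" for j unfolding img using fin by blast
  qed (use assms \<pi> dist in auto)
  then show ?thesis using card by (rule that) auto
qed

section \<open>The central limit theorem for Lipschitz classes\<close>

locale Lipschitz_class = dyadic_net K \<pi> c + S: prob_space S
  for K :: "'a::metric_space set" and \<pi> c and S :: "'s measure" +
  fixes f :: "'a \<Rightarrow> 's \<Rightarrow> real" and B L A q :: real
  assumes f_measurable [measurable]: "Y \<in> K \<Longrightarrow> f Y \<in> borel_measurable S"
    and f_bound: "Y \<in> K \<Longrightarrow> t \<in> space S \<Longrightarrow> \<bar>f Y t\<bar> \<le> B"
    and f_Lipschitz: "Y \<in> K \<Longrightarrow> Y' \<in> K \<Longrightarrow> t \<in> space S \<Longrightarrow> \<bar>f Y t - f Y' t\<bar> \<le> L * dist Y Y'"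
    and card_net: "real (card (\<pi> j ` K)) \<le> A * q ^ j"
    and pos: "B > 0" "L > 0" "A > 0" "q > 0"
begin

definition mean :: "'a \<Rightarrow> real" where "mean Y = (LINT t|S. f Y t)"

definition cov :: "'a \<Rightarrow> 'a \<Rightarrow> real" where
  "cov Y Y' = (LINT t|S. f Y t * f Y' t) - mean Y * mean Y'"

abbreviation cov_form :: "'a set \<Rightarrow> ('a \<Rightarrow> real) \<Rightarrow> real" where
  "cov_form F s \<equiv> \<Sum>Y\<in>F. \<Sum>Y'\<in>F. s Y * s Y' * cov Y Y'"

definition net_points :: "'a set" where "net_points = (\<Union>j. \<pi> j ` K)"

text \<open>The bounds shared by the empirical process and its limit, so that one chaining argument
  serves both with the same constants. They concern net points only, because the Gaussian process is
  first defined there.\<close>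

definition subgaussian :: "'b measure \<Rightarrow> ('b \<Rightarrow> 'a \<Rightarrow> real) \<Rightarrow> bool" where
  "subgaussian M X \<longleftrightarrow> prob_space M \<and> (\<forall>u\<in>net_points. (\<lambda>om. X om u) \<in> borel_measurable M) \<and>
     (\<forall>u\<in>net_points. \<forall>a>0. measure M {om\<in>space M. a \<le> \<bar>X om u\<bar>} \<le> 2 * exp (- a\<^sup>2 / (2 * B\<^sup>2))) \<and>
     (\<forall>u\<in>net_points. \<forall>v\<in>net_points. \<forall>r>0. \<forall>a>0. dist u v \<le> r \<longrightarrow>
        measure M {om\<in>space M. a \<le> \<bar>X om u - X om v\<bar>} \<le> 2 * exp (- a\<^sup>2 / (2 * (L * r)\<^sup>2)))"

definition regular :: "'b measure \<Rightarrow> ('b \<Rightarrow> 'a \<Rightarrow> real) \<Rightarrow> nat \<Rightarrow> real \<Rightarrow> 'b set" where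
  "regular M X j R = {om\<in>space M. (\<forall>i\<ge>j. good i (X om)) \<and> (\<forall>u\<in>\<pi> j ` K. \<bar>X om u\<bar> \<le> R)}"

text \<open>Union bound for the failure of \<open>good i\<close>: the squared cardinality of two
  consecutive nets times the increment tail at threshold (3/4)^i and radius
  \<open>3 * c / 2 ^ i\<close>.\<close>

definition net_tail :: "nat \<Rightarrow> real" where
  "net_tail i = (A * q ^ i + A * q ^ Suc i)\<^sup>2 * (2 * exp (- ((3/4) ^ i)\<^sup>2 / (2 * (L * (3 * c / 2 ^ i))\<^sup>2)))"

definition tail_bound :: "nat \<Rightarrow> real \<Rightarrow> real" where
  "tail_bound j R = (\<Sum>i. net_tail (i + j)) + A * q ^ j * (2 * exp (- R\<^sup>2 / (2 * B\<^sup>2)))"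

lemma summable_net_tail: "summable net_tail"
proof -
  \<comment> \<open>The squared threshold (9/16)^i divided by the squared radius, of order 4^-i,
    grows like (9/4)^i; the remaining factor is 1 / (2 * 9 L^2 c^2).\<close>
  define \<kappa> where "\<kappa> = 1 / (18 * L\<^sup>2 * c\<^sup>2)"
  have "\<kappa> > 0" using pos c_pos by (simp add: \<kappa>_def)
  have eq: "net_tail i = (2 * (A * (1 + q))\<^sup>2) * ((q\<^sup>2) ^ i * exp (- \<kappa> * (9/4) ^ i))" for i
  proof -
    have "((3/4 :: real) ^ i)\<^sup>2 / (2 * (L * (3 * c / 2 ^ i))\<^sup>2) = \<kappa> * (9/4) ^ i"
    proof -
      have "((3/4 :: real) ^ i)\<^sup>2 = (9/16) ^ i" "((2::real) ^ i)\<^sup>2 = 4 ^ i"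
        by (simp_all add: power2_eq_square flip: power_mult_distrib)
      moreover have "(9/16 :: real) ^ i * 4 ^ i = (9/4) ^ i"
        by (simp flip: power_mult_distrib)
      ultimately show ?thesis
        using pos c_pos by (simp add: \<kappa>_def power_mult_distrib power_divide mult_ac)
    qed
    then have "- ((3/4 :: real) ^ i)\<^sup>2 / (2 * (L * (3 * c / 2 ^ i))\<^sup>2) = - \<kappa> * (9/4) ^ i"
      by (simp only: minus_divide_left[symmetric] mult_minus_left)
    moreover have "A * q ^ i + A * q ^ Suc i = (A * (1 + q)) * q ^ i"
      by (simp add: algebra_simps)
    moreover have "((A * (1 + q)) * q ^ i)\<^sup>2 = (A * (1 + q))\<^sup>2 * (q\<^sup>2) ^ i"
      by (simp only: power_mult_distrib power_mult[symmetric] mult.commute[of i])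
    ultimately show ?thesis unfolding net_tail_def by (simp only: mult_ac)
  qed
  show ?thesis
    unfolding eq[abs_def]
    by (intro summable_mult summable_power_times_exp_neg) (use pos \<open>\<kappa> > 0\<close> in auto)
qed

lemma net_points_subset: "net_points \<subseteq> K"
  unfolding net_points_def using net_in by blast

lemma net_in_net_points: "Y \<in> K \<Longrightarrow> \<pi> j Y \<in> net_points"
  unfolding net_points_def by blast

lemma net_image_subset: "\<pi> j ` K \<subseteq> net_points"
  unfolding net_points_def by blast

lemma countable_net_points: "countable net_points"
  unfolding net_points_def using net_finite by (auto intro: countable_finite)

lemma regular_sets:
  assumes "\<And>u. u \<in> net_points \<Longrightarrow> (\<lambda>om. X om u) \<in> borel_measurable M"
  shows "regular M X j R \<in> sets M"
proof -
  have m: "(\<lambda>om. X om u) \<in> borel_measurable M" if "u \<in> \<pi> i ` K" for u i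
    using assms that net_image_subset by blast
  have fin: "finite (\<pi> i ` K \<union> \<pi> (Suc i) ` K)" for i using net_finite by blast
  have "{om\<in>space M. good i (X om)} \<in> sets M" for i
    unfolding good_def
  proof (intro sets.sets_Collect_finite_All' sets.sets_Collect_imp fin)
    fix u v assume "u \<in> \<pi> i ` K \<union> \<pi> (Suc i) ` K" "v \<in> \<pi> i ` K \<union> \<pi> (Suc i) ` K"
    then have [measurable]: "(\<lambda>om. X om u) \<in> borel_measurable M" "(\<lambda>om. X om v) \<in> borel_measurable M"
      using m by blast+
    show "{om \<in> space M. \<bar>X om u - X om v\<bar> \<le> (3 / 4) ^ i} \<in> sets M" by measurable
    show "{om \<in> space M. dist u v \<le> 3 * c / 2 ^ i} \<in> sets M" by measurable
  qed (use K_nonempty in auto)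
  then have 1: "{om\<in>space M. \<forall>i. j \<le> i \<longrightarrow> good i (X om)} \<in> sets M"
    by (intro sets.sets_Collect_countable_All sets.sets_Collect_imp) auto
  have 2: "{om\<in>space M. \<forall>u\<in>\<pi> j ` K. \<bar>X om u\<bar> \<le> R} \<in> sets M"
  proof (intro sets.sets_Collect_finite_All' net_finite)
    fix u assume "u \<in> \<pi> j ` K"
    then have [measurable]: "(\<lambda>om. X om u) \<in> borel_measurable M" by (rule m)
    show "{om \<in> space M. \<bar>X om u\<bar> \<le> R} \<in> sets M" by measurable
  qed (use K_nonempty in auto)
  have "regular M X j R = {om\<in>space M. \<forall>i. j \<le> i \<longrightarrow> good i (X om)} \<inter> {om\<in>space M. \<forall>u\<in>\<pi> j ` K. \<bar>X om u\<bar> \<le> R}"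
    unfolding regular_def by blast
  then show ?thesis
    using sets.Int[OF 1 2] by (simp only:)
qed

lemma subgaussianD:
  assumes "subgaussian M X"
  shows "prob_space M" "u \<in> net_points \<Longrightarrow> (\<lambda>om. X om u) \<in> borel_measurable M"
    "u \<in> net_points \<Longrightarrow> a > 0 \<Longrightarrow> measure M {om\<in>space M. a \<le> \<bar>X om u\<bar>} \<le> 2 * exp (- a\<^sup>2 / (2 * B\<^sup>2))"
    "u \<in> net_points \<Longrightarrow> v \<in> net_points \<Longrightarrow> r > 0 \<Longrightarrow> a > 0 \<Longrightarrow> dist u v \<le> r \<Longrightarrow>
       measure M {om\<in>space M. a \<le> \<bar>X om u - X om v\<bar>} \<le> 2 * exp (- a\<^sup>2 / (2 * (L * r)\<^sup>2))"
  using assms unfolding subgaussian_def by simp_all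

text \<open>A path fails to be regular only through a bad increment at some level from j on, or
  through a value above R on the net of level j; the two terms of \<open>tail_bound\<close> account
  for these.\<close>

lemma subgaussian_tail:
  assumes X: "subgaussian M X" and "R > 0"
  shows "measure M (space M - regular M X j R) \<le> tail_bound j R"
proof -
  interpret prob_space M by (rule subgaussianD(1)[OF X])
  note m = subgaussianD(2)[OF X]
  define F where "F = (\<lambda>i. \<pi> i ` K \<union> \<pi> (Suc i) ` K)"
  have F: "finite (F i)" "F i \<subseteq> net_points" for i
    unfolding F_def using net_finite net_image_subset by blast+
  define W where "W = (\<lambda>i z. {om\<in>space M. dist (fst z) (snd z) \<le> 3 * c / 2 ^ i \<and> (3/4) ^ i \<le> \<bar>X om (fst z) - X om (snd z)\<bar>})"
  define U where "U = (\<lambda>i. \<Union>z\<in>F i \<times> F i. (W i z))"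
  have Um: "(W i z) \<in> events" if "z \<in> F i \<times> F i" for z i
  proof -
    have [measurable]: "(\<lambda>om. X om (fst z)) \<in> borel_measurable M" "(\<lambda>om. X om (snd z)) \<in> borel_measurable M"
      using that F(2)[of i] by (auto intro!: m)
    show ?thesis unfolding W_def by measurable
  qed
  have U_sets: "U i \<in> events" for i
    unfolding U_def by (rule sets.finite_UN[OF finite_cartesian_product[OF F(1) F(1)] Um])
  have U_le: "prob (U i) \<le> net_tail i" for i
  proof -
    have "prob (U i) \<le> (\<Sum>z\<in>F i \<times> F i. prob (W i z))"
      unfolding U_def
      by (rule finite_measure_subadditive_finite[OF finite_cartesian_product[OF F(1) F(1)]], rule image_subsetI, rule Um)
    also have "\<dots> \<le> (\<Sum>z\<in>F i \<times> F i. 2 * exp (- ((3/4) ^ i)\<^sup>2 / (2 * (L * (3 * c / 2 ^ i))\<^sup>2)))"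
    proof (rule sum_mono)
      fix z assume z: "z \<in> F i \<times> F i"
      then have zD: "fst z \<in> net_points" "snd z \<in> net_points" using F(2)[of i] by auto
      show "prob (W i z) \<le> 2 * exp (- ((3/4) ^ i)\<^sup>2 / (2 * (L * (3 * c / 2 ^ i))\<^sup>2))"
      proof (cases "dist (fst z) (snd z) \<le> 3 * c / 2 ^ i")
        case True
        have "3 * c / 2 ^ i > 0" "(3/4 :: real) ^ i > 0" using c_pos by auto
        from subgaussianD(4)[OF X zD this True] True show ?thesis by (simp only: W_def simp_thms)
      qed (simp add: W_def)
    qed
    also have "\<dots> = real (card (F i)) ^ 2 * (2 * exp (- ((3/4) ^ i)\<^sup>2 / (2 * (L * (3 * c / 2 ^ i))\<^sup>2)))"
      by (simp add: card_cartesian_product power2_eq_square)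
    also have "\<dots> \<le> net_tail i"
      unfolding net_tail_def
    proof (intro mult_right_mono power_mono)
      have "real (card (F i)) \<le> real (card (\<pi> i ` K)) + real (card (\<pi> (Suc i) ` K))"
        unfolding F_def using card_Un_le[of "\<pi> i ` K" "\<pi> (Suc i) ` K"] by linarith
      then show "real (card (F i)) \<le> A * q ^ i + A * q ^ Suc i"
        using card_net[of i] card_net[of "Suc i"] by linarith
    qed auto
    finally show ?thesis .
  qed
  define V where "V = (\<Union>u\<in>\<pi> j ` K. {om\<in>space M. R \<le> \<bar>X om u\<bar>})"
  have Vm: "{om\<in>space M. R \<le> \<bar>X om u\<bar>} \<in> events" if "u \<in> \<pi> j ` K" for u
  proof -
    have [measurable]: "(\<lambda>om. X om u) \<in> borel_measurable M" using m net_image_subset that by blast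
    show ?thesis by measurable
  qed
  have V_sets: "V \<in> events" unfolding V_def by (rule sets.finite_UN[OF net_finite Vm])
  have V_le: "prob V \<le> A * q ^ j * (2 * exp (- R\<^sup>2 / (2 * B\<^sup>2)))"
  proof -
    have "prob V \<le> (\<Sum>u\<in>\<pi> j ` K. prob {om\<in>space M. R \<le> \<bar>X om u\<bar>})"
      unfolding V_def by (rule finite_measure_subadditive_finite[OF net_finite], rule image_subsetI, rule Vm)
    also have "\<dots> \<le> (\<Sum>u\<in>\<pi> j ` K. 2 * exp (- R\<^sup>2 / (2 * B\<^sup>2)))"
    proof (rule sum_mono)
      fix u assume "u \<in> \<pi> j ` K"
      then have "u \<in> net_points" using net_image_subset by blast
      from subgaussianD(3)[OF X this \<open>R > 0\<close>] show "prob {om\<in>space M. R \<le> \<bar>X om u\<bar>} \<le> 2 * exp (- R\<^sup>2 / (2 * B\<^sup>2))" .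
    qed
    also have "\<dots> \<le> A * q ^ j * (2 * exp (- R\<^sup>2 / (2 * B\<^sup>2)))"
      using card_net[of j] by (simp add: mult_right_mono)
    finally show ?thesis .
  qed
  have sub: "space M - regular M X j R \<subseteq> (\<Union>i. U (i + j)) \<union> V"
  proof
    fix om assume om: "om \<in> space M - regular M X j R"
    show "om \<in> (\<Union>i. U (i + j)) \<union> V"
    proof (cases "\<forall>i\<ge>j. good i (X om)")
      case True
      with om obtain u where u: "u \<in> \<pi> j ` K" "\<not> \<bar>X om u\<bar> \<le> R" unfolding regular_def by blast
      from u(2) have "R \<le> \<bar>X om u\<bar>" by linarith
      with u(1) om have "om \<in> V" unfolding V_def by blast
      then show ?thesis by blast
    next
      case False
      then obtain i where i: "i \<ge> j" "\<not> good i (X om)" by blast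
      then obtain u v where uv: "u \<in> F i" "v \<in> F i" "dist u v \<le> 3 * c / 2 ^ i" "\<not> \<bar>X om u - X om v\<bar> \<le> (3/4) ^ i"
        unfolding good_def F_def by blast
      then have "(3/4) ^ i \<le> \<bar>X om (fst (u, v)) - X om (snd (u, v))\<bar>" unfolding fst_conv snd_conv by linarith
      with uv om have "om \<in> U i"
        unfolding U_def W_def by (intro UN_I[of "(u, v)"]) simp_all
      then have "om \<in> U ((i - j) + j)" using i(1) by simp
      then show ?thesis by blast
    qed
  qed
  have sm: "summable (\<lambda>i. net_tail (i + j))" using summable_net_tail by (simp add: summable_iff_shift)
  have sU: "summable (\<lambda>i. prob (U (i + j)))"
    by (rule summable_comparison_test'[OF sm, of 0]) (simp only: real_norm_def abs_of_nonneg[OF measure_nonneg] U_le)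
  have "measure M (space M - regular M X j R) \<le> prob ((\<Union>i. U (i + j)) \<union> V)"
    by (rule finite_measure_mono[OF sub]) (intro sets.Un sets.countable_UN image_subsetI U_sets V_sets)
  also have "\<dots> \<le> prob (\<Union>i. U (i + j)) + prob V"
    by (rule measure_Un_le) (intro sets.countable_UN image_subsetI U_sets V_sets)+
  also have "prob (\<Union>i. U (i + j)) \<le> (\<Sum>i. prob (U (i + j)))"
    by (rule finite_measure_subadditive_countably[OF _ sU]) (intro image_subsetI U_sets)
  also have "(\<Sum>i. prob (U (i + j))) \<le> (\<Sum>i. net_tail (i + j))"
    by (rule suminf_le[OF U_le sU sm])
  finally show ?thesis using V_le unfolding tail_bound_def by linarith
qed

text \<open>The level j is fixed first, by the tail of the convergent series; R follows, since the
  second term contains the bound \<open>A * q ^ j\<close> on the cardinality of the net.\<close>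

lemma tail_bound_small:
  assumes "\<eta> > 0"
  obtains j R where "R > 0" "tail_bound j R \<le> \<eta>"
proof -
  have "\<forall>\<^sub>F j in sequentially. norm (\<Sum>i. net_tail (i + j)) < \<eta> / 2"
    using suminf_exist_split[OF _ summable_net_tail, of "\<eta> / 2"] assms
    by (auto simp: eventually_sequentially)
  then obtain j where j: "\<bar>\<Sum>i. net_tail (i + j)\<bar> < \<eta> / 2"
    by (auto simp: eventually_sequentially)
  define z where "z = A * q ^ j * 2"
  have z: "z > 0" using pos by (simp add: z_def)
  \<comment> \<open>The square root makes the exponential at most \<open>\<eta> / (2 * z)\<close>;
    the added 1 ensures that R is positive.\<close>
  define R where "R = sqrt (2 * B\<^sup>2 * \<bar>ln (\<eta> / (2 * z))\<bar>) + 1"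
  have "R > 0" unfolding R_def by (simp add: add_nonneg_pos)
  have "2 * B\<^sup>2 * \<bar>ln (\<eta> / (2 * z))\<bar> = (sqrt (2 * B\<^sup>2 * \<bar>ln (\<eta> / (2 * z))\<bar>))\<^sup>2"
    by simp
  also have "\<dots> \<le> R\<^sup>2" unfolding R_def by (intro power_mono) auto
  finally have "\<bar>ln (\<eta> / (2 * z))\<bar> \<le> R\<^sup>2 / (2 * B\<^sup>2)"
    using pos by (simp add: field_simps)
  then have "- R\<^sup>2 / (2 * B\<^sup>2) \<le> ln (\<eta> / (2 * z))" by (simp add: abs_le_iff)
  then have "exp (- R\<^sup>2 / (2 * B\<^sup>2)) \<le> \<eta> / (2 * z)"
    using assms z by (metis exp_ln exp_le_cancel_iff divide_pos_pos mult_pos_pos zero_less_numeral)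
  then have "z * exp (- R\<^sup>2 / (2 * B\<^sup>2)) \<le> z * (\<eta> / (2 * z))"
    using z by (intro mult_left_mono) auto
  then have "A * q ^ j * (2 * exp (- R\<^sup>2 / (2 * B\<^sup>2))) \<le> \<eta> / 2"
  proof -
    have "z * (\<eta> / (2 * z)) = \<eta> / 2" using z by simp
    with \<open>z * exp _ \<le> _\<close> show ?thesis by (simp only: z_def mult.assoc)
  qed
  with j \<open>R > 0\<close> show ?thesis by (intro that[of R j]) (auto simp: tail_bound_def)
qed

lemma f_integrable:
  assumes "Y \<in> K" "Y' \<in> K"
  shows "integrable S (f Y)" "integrable S (\<lambda>t. f Y t * f Y' t)"
proof -
  show "integrable S (f Y)"
    using assms f_bound by (intro S.integrable_const_bound[of _ B]) auto
  have "\<bar>f Y t * f Y' t\<bar> \<le> B * B" if "t \<in> space S" for t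
    using assms f_bound that pos unfolding abs_mult by (intro mult_mono) auto
  then show "integrable S (\<lambda>t. f Y t * f Y' t)"
    using assms by (intro S.integrable_const_bound[of _ "B * B"]) auto
qed

lemma cov_sym: "cov Y Y' = cov Y' Y"
  by (simp add: cov_def mult.commute)

text \<open>The form is the variance of a linear combination. It is indexed by a family u and not by
  a set of points, because distinct points may share a projection and an enumeration of the net
  points may repeat.\<close>

lemma sum_cov_eq_integral:
  fixes u :: "'k \<Rightarrow> 'a"
  assumes "finite F" "\<And>k. k \<in> F \<Longrightarrow> u k \<in> K"
  shows "(\<Sum>k\<in>F. \<Sum>l\<in>F. s k * s l * cov (u k) (u l)) = (LINT t|S. (\<Sum>k\<in>F. s k * (f (u k) t - mean (u k)))\<^sup>2)"
proof -
  have int: "integrable S (f (u k))" "integrable S (\<lambda>t. f (u k) t * f (u l) t)" if "k \<in> F" "l \<in> F" for k l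
    using f_integrable(1)[OF assms(2) assms(2)] f_integrable(2)[OF assms(2) assms(2)] that by auto
  have int2: "integrable S (\<lambda>t. (f (u k) t - mean (u k)) * (f (u l) t - mean (u l)))" if "k \<in> F" "l \<in> F" for k l
    using int that by (auto simp: algebra_simps)
  have c: "(LINT t|S. (f (u k) t - mean (u k)) * (f (u l) t - mean (u l))) = cov (u k) (u l)" if "k \<in> F" "l \<in> F" for k l
  proof -
    have "(\<lambda>t. (f (u k) t - mean (u k)) * (f (u l) t - mean (u l)))
        = (\<lambda>t. f (u k) t * f (u l) t - mean (u l) * f (u k) t - mean (u k) * f (u l) t + mean (u k) * mean (u l))"
      by (simp add: algebra_simps)
    then show ?thesis
      using int(1)[OF that(1,1)] int(1)[OF that(2,2)] int(2)[OF that]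
      by (simp add: cov_def mean_def S.prob_space algebra_simps)
  qed
  have "(LINT t|S. (\<Sum>k\<in>F. s k * (f (u k) t - mean (u k)))\<^sup>2)
      = (LINT t|S. (\<Sum>k\<in>F. \<Sum>l\<in>F. s k * s l * ((f (u k) t - mean (u k)) * (f (u l) t - mean (u l)))))"
    unfolding power2_eq_square sum_product by (intro Bochner_Integration.integral_cong refl sum.cong) simp
  also have "\<dots> = (\<Sum>k\<in>F. \<Sum>l\<in>F. s k * s l * cov (u k) (u l))"
    using int2 c by (simp add: Bochner_Integration.integral_sum)
  finally show ?thesis by simp
qed

lemma sum_cov_nonneg:
  fixes u :: "'k \<Rightarrow> 'a"
  assumes "finite F" "\<And>k. k \<in> F \<Longrightarrow> u k \<in> K"
  shows "0 \<le> (\<Sum>k\<in>F. \<Sum>l\<in>F. s k * s l * cov (u k) (u l))"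
  using sum_cov_eq_integral[of F u s] assms by simp

lemma cov_le:
  assumes "Y \<in> K" shows "cov Y Y \<le> B\<^sup>2"
proof -
  have "cov Y Y \<le> (LINT t|S. f Y t * f Y t)" by (simp add: cov_def)
  also have "\<dots> \<le> (LINT t|S. B\<^sup>2)"
  proof (rule integral_mono)
    show "integrable S (\<lambda>t. f Y t * f Y t)" by (rule f_integrable(2)[OF assms assms])
    fix t assume "t \<in> space S"
    then have "\<bar>f Y t\<bar>\<^sup>2 \<le> B\<^sup>2" using f_bound[OF assms] by (intro power_mono) auto
    then show "f Y t * f Y t \<le> B\<^sup>2" by (simp add: power2_eq_square)
  qed simp
  finally show ?thesis by (simp add: S.prob_space)
qed

text \<open>The left-hand side is the variance of the increment; dropping the squared mean leaves a
  second moment, which the Lipschitz bound controls.\<close>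

lemma cov_increment_le:
  assumes Y: "Y \<in> K" "Y' \<in> K" and r: "dist Y Y' \<le> r"
  shows "cov Y Y - 2 * cov Y Y' + cov Y' Y' \<le> (L * r)\<^sup>2"
proof -
  have int: "integrable S (\<lambda>t. (f Y t - f Y' t)\<^sup>2)"
    using f_integrable Y by (auto simp: power2_eq_square algebra_simps)
  have "(LINT t|S. (f Y t - f Y' t)\<^sup>2) = (LINT t|S. f Y t * f Y t) - 2 * (LINT t|S. f Y t * f Y' t) + (LINT t|S. f Y' t * f Y' t)"
    using f_integrable(2)[OF Y(1) Y(1)] f_integrable(2)[OF Y] f_integrable(2)[OF Y(2) Y(2)]
    by (simp add: power2_eq_square algebra_simps)
  then have "cov Y Y - 2 * cov Y Y' + cov Y' Y' = (LINT t|S. (f Y t - f Y' t)\<^sup>2) - (mean Y - mean Y')\<^sup>2"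
    by (simp add: cov_def power2_eq_square algebra_simps)
  also have "\<dots> \<le> (LINT t|S. (f Y t - f Y' t)\<^sup>2)" by simp
  also have "\<dots> \<le> (LINT t|S. (L * r)\<^sup>2)"
  proof (rule integral_mono[OF int])
    fix t assume t: "t \<in> space S"
    have "\<bar>f Y t - f Y' t\<bar> \<le> L * r"
      using f_Lipschitz[OF Y t] r pos by (meson mult_left_mono order_trans less_imp_le)
    then have "\<bar>f Y t - f Y' t\<bar>\<^sup>2 \<le> (L * r)\<^sup>2" by (intro power_mono) auto
    then show "(f Y t - f Y' t)\<^sup>2 \<le> (L * r)\<^sup>2" by simp
  qed simp
  finally show ?thesis by (simp add: S.prob_space)
qed

lemma f_net_tendsto:
  assumes "Y \<in> K" "t \<in> space S"
  shows "(\<lambda>m. f (\<pi> m Y) t) \<longlonglongrightarrow> f Y t"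
proof -
  have "(\<lambda>m. L * dist (\<pi> m Y) Y) \<longlonglongrightarrow> 0"
    using tendsto_dist[OF net_tendsto[OF assms(1)] tendsto_const[of Y]]
    by (intro tendsto_mult_right_zero) simp
  then have "(\<lambda>m. f (\<pi> m Y) t - f Y t) \<longlonglongrightarrow> 0"
    by (rule Lim_null_comparison[rotated]) (use assms net_in f_Lipschitz in auto)
  then show ?thesis by (rule LIM_zero_cancel)
qed

lemma mean_net_tendsto:
  assumes "Y \<in> K"
  shows "(\<lambda>m. mean (\<pi> m Y)) \<longlonglongrightarrow> mean Y"
  unfolding mean_def
proof (rule integral_dominated_convergence[where w = "\<lambda>_. B"])
  show "AE t in S. (\<lambda>m. f (\<pi> m Y) t) \<longlonglongrightarrow> f Y t"
    using f_net_tendsto[OF assms] by simp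
qed (use assms net_in f_bound in auto)

lemma cov_net_tendsto:
  assumes "Y \<in> K" "Y' \<in> K"
  shows "(\<lambda>m. cov (\<pi> m Y) (\<pi> m Y')) \<longlonglongrightarrow> cov Y Y'"
proof -
  have "(\<lambda>m. LINT t|S. f (\<pi> m Y) t * f (\<pi> m Y') t) \<longlonglongrightarrow> (LINT t|S. f Y t * f Y' t)"
  proof (rule integral_dominated_convergence[where w = "\<lambda>_. B * B"])
    show "AE t in S. (\<lambda>m. f (\<pi> m Y) t * f (\<pi> m Y') t) \<longlonglongrightarrow> f Y t * f Y' t"
      using f_net_tendsto assms by (auto intro!: tendsto_mult)
    show "AE t in S. norm (f (\<pi> m Y) t * f (\<pi> m Y') t) \<le> B * B" for m
      using assms net_in f_bound pos by (auto simp: abs_mult intro!: mult_mono)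
  qed (use assms net_in in auto)
  then show ?thesis
    unfolding cov_def by (intro tendsto_diff tendsto_mult mean_net_tendsto assms)
qed

end

section \<open>The normalised empirical process and the notion of its limit\<close>

context Lipschitz_class
begin

definition empirical :: "(nat \<Rightarrow> 's) \<Rightarrow> nat \<Rightarrow> 'a \<Rightarrow> real" where
  "empirical t p Y = sqrt (real p) * (1 / real p * (\<Sum>i<p. f Y (t i)) - mean Y)"

lemma empirical_linear_combination:
  assumes "finite F" "p > 0"
  shows "(\<Sum>Y\<in>F. s Y * empirical t p Y) = (\<Sum>i<p. \<Sum>Y\<in>F. s Y * (f Y (t i) - mean Y)) / sqrt (real p)"
proof -
  have sp: "sqrt (real p) * sqrt (real p) = real p" "sqrt (real p) > 0" using assms by auto
  have "empirical t p Y = (\<Sum>i<p. f Y (t i) - mean Y) / sqrt (real p)" for Y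
  proof -
    have "sqrt (real p) * (1 / real p * x - y) = (x - real p * y) / sqrt (real p)" for x y
    proof -
      have "sqrt (real p) * (1 / real p * x - y) * sqrt (real p) = (sqrt (real p) * sqrt (real p)) * (1 / real p * x - y)"
        by (simp only: mult_ac)
      also have "\<dots> = x - real p * y"
        using assms(2) by (simp add: right_diff_distrib)
      finally show ?thesis using sp(2) by (simp add: nonzero_eq_divide_eq)
    qed
    then show ?thesis
      unfolding empirical_def by (simp add: sum_subtractf)
  qed
  then have "(\<Sum>Y\<in>F. s Y * empirical t p Y) = (\<Sum>Y\<in>F. \<Sum>i<p. s Y * (f Y (t i) - mean Y)) / sqrt (real p)"
    by (simp only: sum_divide_distrib sum_distrib_left times_divide_eq_right)
  also have "(\<Sum>Y\<in>F. \<Sum>i<p. s Y * (f Y (t i) - mean Y)) = (\<Sum>i<p. \<Sum>Y\<in>F. s Y * (f Y (t i) - mean Y))"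
    by (rule sum.swap)
  finally show ?thesis .
qed

lemma empirical_net_tendsto:
  assumes "Y \<in> K" "\<And>i. t i \<in> space S"
  shows "(\<lambda>m. empirical t p (\<pi> m Y)) \<longlonglongrightarrow> empirical t p Y"
  unfolding empirical_def
  by (intro tendsto_mult tendsto_diff tendsto_const tendsto_sum f_net_tendsto mean_net_tendsto assms)

text \<open>For fixed p all paths have the Lipschitz constant \<open>2 * sqrt (real p) * L\<close>,
  so one set contains them all, whatever the sample. Since j and R depend on p, this yields
  measurability but not tightness.\<close>

lemma empirical_equicont:
  obtains j R where "\<And>t. (\<And>i. t i \<in> space S) \<Longrightarrow> restrict (empirical t p) K \<in> equicont j R"
proof -
  have mean_le: "\<bar>mean Y\<bar> \<le> B" if "Y \<in> K" for Y
  proof -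
    have "\<bar>mean Y\<bar> \<le> (LINT t|S. \<bar>f Y t\<bar>)" unfolding mean_def by (rule integral_abs_bound)
    also have "\<dots> \<le> (LINT t|S. B)"
      using f_integrable[OF that that] f_bound[OF that] by (intro integral_mono) auto
    finally show ?thesis by (simp add: S.prob_space)
  qed
  have mean_diff: "\<bar>mean Y - mean Y'\<bar> \<le> L * dist Y Y'" if "Y \<in> K" "Y' \<in> K" for Y Y'
  proof -
    have "\<bar>mean Y - mean Y'\<bar> = \<bar>LINT t|S. f Y t - f Y' t\<bar>"
      using f_integrable that by (simp add: mean_def)
    also have "\<dots> \<le> (LINT t|S. \<bar>f Y t - f Y' t\<bar>)" by (rule integral_abs_bound)
    also have "\<dots> \<le> (LINT t|S. L * dist Y Y')"
      using f_integrable that f_Lipschitz[OF that] by (intro integral_mono) auto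
    finally show ?thesis by (simp add: S.prob_space)
  qed
  have avg: "\<bar>1 / real p * (\<Sum>i<p. g i)\<bar> \<le> b" if "\<And>i. \<bar>g i\<bar> \<le> b" for g b
  proof (cases "p = 0")
    case True
    then show ?thesis using that[of 0] by simp
  next
    case False
    have "\<bar>\<Sum>i<p. g i\<bar> \<le> (\<Sum>i<p. b)" using that by (intro order_trans[OF sum_abs] sum_mono)
    then show ?thesis using False by (simp add: field_simps)
  qed
  \<comment> \<open>The modulus 9 (3/4)^i is 9 (3/2)^i / 2^i, so (3/2)^j has to exceed the Lipschitz
    constant times c / 9.\<close>
  obtain j where "2 * sqrt (real p) * L * c / 9 < (3/2) ^ j"
    using real_arch_pow[of "3/2" "2 * sqrt (real p) * L * c / 9"] by auto
  then have j: "2 * sqrt (real p) * L * c \<le> 9 * (3/2) ^ j" by simp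
  show ?thesis
  proof (rule that[of j "sqrt (real p) * (2 * B)"])
    fix t :: "nat \<Rightarrow> 's" assume t: "\<And>i. t i \<in> space S"
    have 1: "\<bar>empirical t p Y\<bar> \<le> sqrt (real p) * (2 * B)" if "Y \<in> K" for Y
      unfolding empirical_def abs_mult
      using avg[of "\<lambda>i. f Y (t i)" B] f_bound[OF that t] mean_le[OF that]
      by (intro mult_mono) (auto intro!: order_trans[OF abs_triangle_ineq4])
    have 2: "\<bar>empirical t p Y - empirical t p Y'\<bar> \<le> 9 * (3/4) ^ i"
      if "i \<ge> j" "Y \<in> K" "Y' \<in> K" "dist Y Y' \<le> c / 2 ^ i" for i Y Y'
    proof -
      have "empirical t p Y - empirical t p Y'
          = sqrt (real p) * (1 / real p * (\<Sum>i<p. f Y (t i) - f Y' (t i)) - (mean Y - mean Y'))"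
        by (simp add: empirical_def sum_subtractf algebra_simps)
      also have "\<bar>\<dots>\<bar> \<le> sqrt (real p) * (L * dist Y Y' + L * dist Y Y')"
        unfolding abs_mult
        using avg[of "\<lambda>i. f Y (t i) - f Y' (t i)" "L * dist Y Y'"] f_Lipschitz[OF that(2,3) t] mean_diff[OF that(2,3)]
        by (intro mult_mono) (auto intro!: order_trans[OF abs_triangle_ineq4])
      also have "\<dots> = (2 * sqrt (real p) * L) * dist Y Y'" by simp
      also have "\<dots> \<le> (2 * sqrt (real p) * L) * (c / 2 ^ i)"
        using that pos by (intro mult_left_mono) auto
      also have "\<dots> = (2 * sqrt (real p) * L * c) / 2 ^ i" by simp
      also have "\<dots> \<le> (9 * (3/2) ^ i) / 2 ^ i"
      proof (intro divide_right_mono)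
        have "(3/2 :: real) ^ j \<le> (3/2) ^ i" using that(1) by (intro power_increasing) auto
        then show "2 * sqrt (real p) * L * c \<le> 9 * (3/2) ^ i" using j by linarith
      qed simp
      also have "\<dots> = 9 * ((3/2) / 2) ^ i"
        by (simp only: power_divide times_divide_eq_right)
      also have "\<dots> = 9 * (3/4) ^ i" by simp
      finally show ?thesis .
    qed
    show "restrict (empirical t p) K \<in> equicont j (sqrt (real p) * (2 * B))"
      unfolding equicont_def using 1 2 by simp
  qed
qed

text \<open>The law is fixed through its linear combinations, in the manner of Cramer and Wold. The
  last clause repeats the bound of \<open>subgaussian_tail\<close>, so that one choice of j and R
  serves the empirical process and the limit alike.\<close>

definition gaussian_limit :: "'b measure \<Rightarrow> ('b \<Rightarrow> 'a \<Rightarrow> real) \<Rightarrow> bool" where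
  "gaussian_limit N G \<longleftrightarrow> prob_space N \<and> G \<in> measurable N (linf_borel K) \<and>
     (\<forall>Y\<in>K. (\<lambda>om. G om Y) \<in> borel_measurable N) \<and>
     (\<forall>F s. finite F \<and> F \<subseteq> K \<longrightarrow> distr N borel (\<lambda>om. \<Sum>Y\<in>F. s Y * G om Y)
        = centred_normal (cov_form F s)) \<and>
     (\<forall>j R. R > 0 \<longrightarrow> (\<exists>E\<in>sets N. measure N (space N - E) \<le> tail_bound j R \<and>
        (\<forall>om\<in>E. G om \<in> equicont j (R + 4))))"

lemma gaussian_limitD:
  assumes "gaussian_limit N G"
  shows "prob_space N" "G \<in> measurable N (linf_borel K)"
    "Y \<in> K \<Longrightarrow> (\<lambda>om. G om Y) \<in> borel_measurable N"
    "finite F \<Longrightarrow> F \<subseteq> K \<Longrightarrow> distr N borel (\<lambda>om. \<Sum>Y\<in>F. s Y * G om Y)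
        = centred_normal (cov_form F s)"
    "R > 0 \<Longrightarrow> \<exists>E\<in>sets N. measure N (space N - E) \<le> tail_bound j R \<and>
        (\<forall>om\<in>E. G om \<in> equicont j (R + 4))"
  using assms unfolding gaussian_limit_def by simp_all

end

section \<open>Convergence of expectations of functionals\<close>

locale Lipschitz_sample = Lipschitz_class K \<pi> c S f B L A q + M: prob_space M
  for K :: "'a::metric_space set" and \<pi> c and S :: "'s measure" and f B L A q and M :: "'m measure" +
  fixes \<theta> :: "nat \<Rightarrow> 'm \<Rightarrow> 's"
  assumes indep: "M.indep_vars (\<lambda>_. S) \<theta> UNIV" and law: "\<And>i. distr M S (\<theta> i) = S"
begin

definition emp :: "nat \<Rightarrow> 'm \<Rightarrow> 'a \<Rightarrow> real" where
  "emp p om = empirical (\<lambda>i. \<theta> i om) p"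

abbreviation Emp :: "nat \<Rightarrow> 'm \<Rightarrow> 'a \<Rightarrow> real" where
  "Emp p om \<equiv> restrict (emp p om) K"

lemma \<theta>_measurable [measurable]: "\<theta> i \<in> measurable M S"
  using indep by (simp add: M.indep_vars_def2)

lemma emp_measurable [measurable]: "Y \<in> K \<Longrightarrow> (\<lambda>om. emp p om Y) \<in> borel_measurable M"
  unfolding emp_def empirical_def by measurable

lemma emp_restrict_measurable: "Y \<in> K \<Longrightarrow> (\<lambda>om. Emp p om Y) \<in> borel_measurable M"
  using emp_measurable by simp

text \<open>An increment of the process is itself a normalised sum, for the function
  \<open>f u - f v\<close>, which is bounded by \<open>L * r\<close>; Hoeffding applies to values
  and increments alike.\<close>

lemma emp_subgaussian: "subgaussian M (emp p)"
  unfolding subgaussian_def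
proof (intro conjI ballI allI impI)
  show "prob_space M" by unfold_locales
  show "(\<lambda>om. emp p om u) \<in> borel_measurable M" if "u \<in> net_points" for u
    using that net_points_subset emp_measurable by blast
next
  fix u and a :: real assume "u \<in> net_points" "a > 0"
  then have "u \<in> K" using net_points_subset by blast
  then show "M.prob {om \<in> space M. a \<le> \<bar>emp p om u\<bar>} \<le> 2 * exp (- a\<^sup>2 / (2 * B\<^sup>2))"
    unfolding emp_def empirical_def mean_def
    by (intro M.Hoeffding_normalized_sum[OF indep law] f_measurable f_bound pos \<open>a > 0\<close>)
next
  fix u v and r a :: real assume uv: "u \<in> net_points" "v \<in> net_points" and r: "r > 0" "a > 0" "dist u v \<le> r"
  then have uv: "u \<in> K" "v \<in> K" using net_points_subset by blast+
  have "emp p om u - emp p om v = sqrt (real p) * (1 / real p * (\<Sum>i<p. f u (\<theta> i om) - f v (\<theta> i om)) - (LINT t|S. f u t - f v t))" for om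
    using f_integrable uv by (simp add: emp_def empirical_def mean_def sum_subtractf algebra_simps)
  moreover have "M.prob {om \<in> space M. a \<le> \<bar>sqrt (real p) * (1 / real p * (\<Sum>i<p. f u (\<theta> i om) - f v (\<theta> i om)) - (LINT t|S. f u t - f v t))\<bar>} \<le> 2 * exp (- a\<^sup>2 / (2 * (L * r)\<^sup>2))"
  proof (rule M.Hoeffding_normalized_sum[OF indep law])
    show "(\<lambda>t. f u t - f v t) \<in> borel_measurable S" using uv by measurable
    fix t assume "t \<in> space S"
    then have "\<bar>f u t - f v t\<bar> \<le> L * dist u v" by (rule f_Lipschitz[OF uv])
    also have "\<dots> \<le> L * r" using r pos by (intro mult_left_mono) auto
    finally show "\<bar>f u t - f v t\<bar> \<le> L * r" .
  qed (use r pos in auto)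
  ultimately show "M.prob {om \<in> space M. a \<le> \<bar>emp p om u - emp p om v\<bar>} \<le> 2 * exp (- a\<^sup>2 / (2 * (L * r)\<^sup>2))"
    by (simp only:)
qed

text \<open>The path is continuous along the nets and is thus the limit of its own chains.\<close>

lemma emp_regular:
  assumes "om \<in> regular M (emp p) j R"
  shows "Emp p om \<in> equicont j (R + 4)"
proof (rule good_limit_equicont[where x = "emp p om"])
  have om: "om \<in> space M" using assms by (simp add: regular_def)
  show "good i (emp p om)" if "i \<ge> j" for i using assms that by (simp add: regular_def)
  show "\<bar>emp p om u\<bar> \<le> R" if "u \<in> \<pi> j ` K" for u using assms that unfolding regular_def by blast
  show "(\<lambda>m. emp p om (\<pi> m Y)) \<longlonglongrightarrow> Emp p om Y" if "Y \<in> K" for Y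
    using empirical_net_tendsto[OF that, of "\<lambda>i. \<theta> i om" p] measurable_space[OF \<theta>_measurable om] that by (simp add: emp_def)
qed simp

lemma emp_equicont:
  obtains j R where "\<And>om. om \<in> space M \<Longrightarrow> Emp p om \<in> equicont j R"
  using empirical_equicont[of p] measurable_space[OF \<theta>_measurable] unfolding emp_def by metis

lemma emp_measurable_linf: "(\<lambda>om. Emp p om) \<in> measurable M (linf_borel K)"
proof -
  obtain j R where jR: "\<And>om. om \<in> space M \<Longrightarrow> Emp p om \<in> equicont j R"
    using emp_equicont[of p] by blast
  show ?thesis
    by (rule measurable_linf_borel[of "\<lambda>_. space M" _ _ "\<lambda>_. j" "\<lambda>_. R"])
       (use jR emp_restrict_measurable in auto)
qed

text \<open>A linear combination of evaluations is again a normalised sum of independent,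
  identically distributed, bounded centred variables, with variance
  \<open>cov_form F s\<close>.\<close>

lemma emp_char_tendsto:
  assumes F: "finite F" "F \<subseteq> K"
  shows "(\<lambda>p. char (distr M borel (\<lambda>om. \<Sum>Y\<in>F. s Y * emp p om Y)) z)
    \<longlonglongrightarrow> exp (- (cov_form F s) * z\<^sup>2 / 2)"
proof -
  define h where "h = (\<lambda>t. \<Sum>Y\<in>F. s Y * (f Y t - mean Y))"
  have FK: "Y \<in> F \<Longrightarrow> Y \<in> K" for Y using F by blast
  have fY: "Y \<in> F \<Longrightarrow> f Y \<in> borel_measurable S" for Y using FK f_measurable by blast
  have h[measurable]: "h \<in> borel_measurable S" unfolding h_def using fY by measurable
  have hb: "\<bar>h t\<bar> \<le> (\<Sum>Y\<in>F. \<bar>s Y\<bar> * (B + \<bar>mean Y\<bar>))" if "t \<in> space S" for t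
    unfolding h_def
  proof (rule order_trans[OF sum_abs sum_mono])
    fix Y assume "Y \<in> F"
    then have "\<bar>f Y t - mean Y\<bar> \<le> B + \<bar>mean Y\<bar>" using f_bound[OF FK that, of Y] by linarith
    then show "\<bar>s Y * (f Y t - mean Y)\<bar> \<le> \<bar>s Y\<bar> * (B + \<bar>mean Y\<bar>)"
      unfolding abs_mult by (intro mult_left_mono) auto
  qed
  have h0: "(LINT t|S. h t) = 0"
    unfolding h_def using f_integrable(1)[OF FK FK]
    by (simp add: Bochner_Integration.integral_sum mean_def S.prob_space)
  have lim: "(\<lambda>p. char (distr M borel (\<lambda>om. (\<Sum>i<p. h (\<theta> i om)) / sqrt (real p))) z)
    \<longlonglongrightarrow> exp (- (cov_form F s) * z\<^sup>2 / 2)"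
  proof (rule M.char_normalized_sum_tendsto)
    show "M.indep_vars (\<lambda>_. borel) (\<lambda>i om. h (\<theta> i om)) UNIV"
      by (rule M.indep_vars_compose2[OF indep]) (rule h)
    show "M.expectation (\<lambda>om. h (\<theta> i om)) = 0" for i
      using integral_distr[OF \<theta>_measurable[of i] h] h0 by (simp add: law)
    show "M.expectation (\<lambda>om. (h (\<theta> i om))\<^sup>2) = cov_form F s" for i
      using integral_distr[OF \<theta>_measurable[of i], of "\<lambda>t. (h t)\<^sup>2"] sum_cov_eq_integral[OF F(1), of "\<lambda>Y. Y" s] FK
      by (simp add: law h_def)
    show "distr M borel (\<lambda>om. h (\<theta> i om)) = distr S borel h" for i
      using distr_distr[OF h \<theta>_measurable[of i]] by (simp add: law comp_def)
    show "\<bar>h (\<theta> i om)\<bar> \<le> (\<Sum>Y\<in>F. \<bar>s Y\<bar> * (B + \<bar>mean Y\<bar>))" if "om \<in> space M" for i om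
      by (rule hb[OF measurable_space[OF \<theta>_measurable that]])
  qed
  show ?thesis
  proof (rule Lim_transform_eventually[OF lim])
    show "\<forall>\<^sub>F p in sequentially. char (distr M borel (\<lambda>om. (\<Sum>i<p. h (\<theta> i om)) / sqrt (real p))) z
        = char (distr M borel (\<lambda>om. \<Sum>Y\<in>F. s Y * emp p om Y)) z"
      using eventually_gt_at_top[of 0]
      by eventually_elim (simp only: emp_def h_def empirical_linear_combination[OF F(1)])
  qed
qed

text \<open>The expectation of a cosine is the real part of a characteristic function at 1, turned
  by the phase; the frequencies sit in the coefficients s, so the argument 1 is general
  enough.\<close>

lemma emp_trig_tendsto:
  assumes NG: "gaussian_limit N G"
    and T: "T \<in> trig K"
  shows "(\<lambda>p. LINT om|M. T (Emp p om)) \<longlonglongrightarrow> (LINT om|N. T (G om))"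
proof -
  note N = gaussian_limitD(1)[OF NG] and G = gaussian_limitD(3)[OF NG] and G_law = gaussian_limitD(4)[OF NG]
  show ?thesis
  using T
proof (induction T rule: trig.induct)
  case (trig_cos F a s b)
  interpret N: prob_space N by (rule N)
  have FK: "Y \<in> F \<Longrightarrow> Y \<in> K" for Y using trig_cos by blast
  have m: "(\<lambda>om. \<Sum>Y\<in>F. s Y * emp p om Y) \<in> borel_measurable M" for p
    by (intro borel_measurable_sum borel_measurable_times borel_measurable_const emp_measurable FK)
  have mG: "(\<lambda>om. \<Sum>Y\<in>F. s Y * G om Y) \<in> borel_measurable N"
    by (intro borel_measurable_sum borel_measurable_times borel_measurable_const G FK)
  have res: "(\<Sum>Y\<in>F. s Y * Emp p om Y) = (\<Sum>Y\<in>F. s Y * emp p om Y)" for p om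
    using FK by (intro sum.cong) auto
  have V: "0 \<le> (cov_form F s)"
    using sum_cov_nonneg[of F "\<lambda>Y. Y" s] trig_cos FK by simp
  have "char (distr N borel (\<lambda>om. \<Sum>Y\<in>F. s Y * G om Y)) 1 = exp (- (cov_form F s) * 1\<^sup>2 / 2)"
    unfolding G_law[OF trig_cos] by (rule char_centred_normal[OF V])
  then have "(\<lambda>p. a * Re (iexp b * char (distr M borel (\<lambda>om. \<Sum>Y\<in>F. s Y * emp p om Y)) 1))
     \<longlonglongrightarrow> a * Re (iexp b * char (distr N borel (\<lambda>om. \<Sum>Y\<in>F. s Y * G om Y)) 1)"
    using emp_char_tendsto[OF trig_cos, of s 1] by (intro tendsto_intros) (simp only:)
  then show ?case
    by (simp only: res M.expectation_cos_char[OF m, symmetric] N.expectation_cos_char[OF mG, symmetric] integral_mult_right_zero)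
next
  case (trig_add g h)
  interpret N: prob_space N by (rule N)
  have intM: "integrable M (\<lambda>om. g (Emp p om))" if g: "g \<in> trig K" for g p
  proof -
    obtain b where "\<And>x. \<bar>g x\<bar> \<le> b" using trig_bounded[OF g] by blast
    then show ?thesis
      using trig_measurable[OF g, of "\<lambda>om. Emp p om"] emp_restrict_measurable by (intro M.integrable_const_bound[of _ b]) auto
  qed
  have intN: "integrable N (\<lambda>om. g (G om))" if g: "g \<in> trig K" for g
  proof -
    obtain b where "\<And>x. \<bar>g x\<bar> \<le> b" using trig_bounded[OF g] by blast
    then show ?thesis
      using trig_measurable[OF g G] by (intro N.integrable_const_bound[of _ b]) auto
  qed
  show ?case
    using tendsto_add[OF trig_add.IH] intM[OF trig_add.hyps(1)] intM[OF trig_add.hyps(2)]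
      intN[OF trig_add.hyps(1)] intN[OF trig_add.hyps(2)]
    by (simp only: Bochner_Integration.integral_add)
qed
qed

text \<open>Three errors of size \<epsilon> / 3: H against T under the empirical process, uniformly
  in p; T against its limit; T against H under the Gaussian law. The same T works on both sides
  because both laws charge the same \<open>equicont j (R + 4)\<close>.\<close>

lemma emp_functional_tendsto:
  assumes NG: "gaussian_limit N G"
    and H: "linf_continuous K H" "bounded (H ` mspace (linf K))"
  shows "(\<lambda>p. LINT om|M. H (Emp p om)) \<longlonglongrightarrow> (LINT om|N. H (G om))"
proof -
  note N = gaussian_limitD(1)[OF NG] and G = gaussian_limitD(2,3)[OF NG] and G_tight = gaussian_limitD(5)[OF NG]
  interpret N: prob_space N by (rule N)
  obtain b where b: "\<And>x. x \<in> mspace (linf K) \<Longrightarrow> \<bar>H x\<bar> \<le> b" "b > 0"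
    using H(2) unfolding bounded_pos by auto
  have HX: "(\<lambda>om. H (Emp p om)) \<in> borel_measurable M" for p
    by (rule measurable_compose[OF emp_measurable_linf linf_borel_functional_measurable[OF H(1)]])
  have HG: "(\<lambda>om. H (G om)) \<in> borel_measurable N"
    by (rule measurable_compose[OF G(1) linf_borel_functional_measurable[OF H(1)]])
  have bX: "\<bar>H (Emp p om)\<bar> \<le> b" if "om \<in> space M" for p om
    using b(1) measurable_space[OF emp_measurable_linf that] space_linf_borel by blast
  have bG: "\<bar>H (G om)\<bar> \<le> b" if "om \<in> space N" for om
    using b(1) measurable_space[OF G(1) that] space_linf_borel by blast
  show ?thesis
  proof (rule LIMSEQ_I)
    fix \<epsilon> :: real assume "\<epsilon> > 0"
    \<comment> \<open>With e <= 1 the error \<delta> is at most e (3 + 2 b), and the quotient brings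
      this below \<epsilon> / 3.\<close>
    define e where "e = min 1 (\<epsilon> / (6 * (2 + 2 * b)))"
    have e: "e > 0" "e \<le> 1" using \<open>\<epsilon> > 0\<close> b(2) by (auto simp: e_def)
    define \<delta> where "\<delta> = e + 2 * (b + e) * e"
    have "\<delta> \<le> e * (3 + 2 * b)"
      using e mult_left_mono[OF e(2), of "e * 2"] by (simp add: \<delta>_def algebra_simps)
    also have "\<dots> \<le> e * (2 * (2 + 2 * b))" using e b(2) by (intro mult_left_mono) auto
    also have "\<dots> \<le> \<epsilon> / (6 * (2 + 2 * b)) * (2 * (2 + 2 * b))"
      using b(2) by (intro mult_right_mono) (auto simp: e_def)
    also have "\<dots> = \<epsilon> / 3" using b(2) by (simp add: field_simps)
    finally have \<delta>: "\<delta> \<le> \<epsilon> / 3" .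
    obtain j R where R: "R > 0" "tail_bound j R \<le> e"
      using tail_bound_small[OF e(1)] by blast
    have bE: "\<bar>H x\<bar> \<le> b" if "x \<in> equicont j (R + 4)" for x
      using b(1) that equicont_subset_linf by blast
    obtain T where T: "T \<in> trig K" "\<And>x. x \<in> equicont j (R + 4) \<Longrightarrow> \<bar>H x - T x\<bar> < e" "\<And>x. \<bar>T x\<bar> \<le> b + e"
      using trig_dense_bounded[OF linf_continuous_on_equicont[OF H(1)] bE less_imp_le[OF b(2)] e(1)] by blast
    have X: "\<bar>(LINT om|M. H (Emp p om)) - (LINT om|M. T (Emp p om))\<bar> \<le> \<delta>" for p
      unfolding \<delta>_def
    proof (rule M.expectation_diff_bound[OF HX])
      show "(\<lambda>om. T (Emp p om)) \<in> borel_measurable M"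
        by (rule trig_measurable[OF T(1) emp_restrict_measurable])
      show "regular M (emp p) j R \<in> sets M"
        by (rule regular_sets) (use emp_measurable net_points_subset in blast)
      show "\<bar>H (Emp p om) - T (Emp p om)\<bar> \<le> e" if "om \<in> regular M (emp p) j R" for om
        using T(2)[OF emp_regular[OF that]] by simp
      show "M.prob (space M - regular M (emp p) j R) \<le> e"
        using subgaussian_tail[OF emp_subgaussian R(1), of p j] R(2) by linarith
      show "\<bar>H (Emp p om)\<bar> \<le> b + e" if "om \<in> space M" for om
        using bX[OF that, of p] e by linarith
    qed (use T(3) e in auto)
    obtain E where E: "E \<in> sets N" "measure N (space N - E) \<le> e" "\<And>om. om \<in> E \<Longrightarrow> G om \<in> equicont j (R + 4)"
      using G_tight[OF R(1), of j] R(2) by (meson order_trans)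
    have G': "\<bar>(LINT om|N. H (G om)) - (LINT om|N. T (G om))\<bar> \<le> \<delta>"
      unfolding \<delta>_def
    proof (rule N.expectation_diff_bound[OF HG])
      show "(\<lambda>om. T (G om)) \<in> borel_measurable N"
        by (rule trig_measurable[OF T(1) G(2)])
      show "\<bar>H (G om) - T (G om)\<bar> \<le> e" if "om \<in> E" for om
        using T(2)[OF E(3)[OF that]] by simp
      show "\<bar>H (G om)\<bar> \<le> b + e" if "om \<in> space N" for om
        using bG[OF that] e by linarith
    qed (use T(3) e E in auto)
    obtain p0 where p0: "\<And>p. p \<ge> p0 \<Longrightarrow> norm ((LINT om|M. T (Emp p om)) - (LINT om|N. T (G om))) < \<epsilon> / 3"
      using LIMSEQ_D[OF emp_trig_tendsto[OF NG T(1)], of "\<epsilon> / 3"] \<open>\<epsilon> > 0\<close> by auto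
    show "\<exists>no. \<forall>n\<ge>no. norm ((LINT om|M. H (restrict (emp n om) K)) - (LINT om|N. H (G om))) < \<epsilon>"
    proof (intro exI allI impI)
      fix p assume "p \<ge> p0"
      from p0[OF this] X[of p] G' \<delta>
      show "norm ((LINT om|M. H (Emp p om)) - (LINT om|N. H (G om))) < \<epsilon>"
        unfolding real_norm_def by linarith
    qed
  qed
qed

end

section \<open>Construction of the Gaussian limit\<close>

context Lipschitz_class
begin

text \<open>Rows of the Cholesky factor applied to independent normals have the prescribed
  covariance, and triangularity makes every row finite. The family u in the law may repeat net
  points, as is needed when several points of K are projected to one net.\<close>

lemma exists_gaussian_on_net:
  fixes e :: "nat \<Rightarrow> 'i"
  assumes e: "inj e"
  obtains N :: "('i \<Rightarrow> real) measure" and X where "prob_space N"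
    "\<And>u. u \<in> net_points \<Longrightarrow> (\<lambda>om. X om u) \<in> borel_measurable N"
    "\<And>(F :: 'a set) u s. finite F \<Longrightarrow> (\<And>Y. Y \<in> F \<Longrightarrow> u Y \<in> net_points) \<Longrightarrow>
       distr N borel (\<lambda>om. \<Sum>Y\<in>F. s Y * X om (u Y)) = centred_normal (\<Sum>Y\<in>F. \<Sum>Y'\<in>F. s Y * s Y' * cov (u Y) (u Y'))"
proof -
  define y where "y = from_nat_into net_points"
  have "net_points \<noteq> {}" unfolding net_points_def using K_nonempty by auto
  then have ran: "range y = net_points"
    unfolding y_def using countable_net_points by (intro range_from_nat_into)
  have yK: "y k \<in> K" for k using ran net_points_subset by blast
  define C where "C = (\<lambda>k l. cov (y k) (y l))"
  have "psd_kernel C"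
    unfolding psd_kernel_def C_def
    using cov_sym sum_cov_nonneg[of _ y] yK by simp
  then obtain Lo :: "nat \<Rightarrow> nat \<Rightarrow> real" where Lo: "\<And>k j. k < j \<Longrightarrow> Lo k j = 0"
      "\<And>k l n. k < n \<Longrightarrow> C k l = (\<Sum>j<n. Lo k j * Lo l j)"
    using infinite_Cholesky by blast
  \<comment> \<open>The enumeration may repeat, so one index is fixed for each net point.\<close>
  define idx where "idx = (\<lambda>u. SOME k. y k = u)"
  have idx: "y (idx u) = u" if u: "u \<in> net_points" for u
  proof -
    have "u \<in> range y" using u by (simp only: ran)
    then obtain k where "y k = u" by (elim imageE) simp
    then show ?thesis unfolding idx_def by (rule someI)
  qed
  define N where "N = PiM (UNIV :: 'i set) (\<lambda>_. std_normal_distribution)"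
  define X where "X = (\<lambda>(om::'i \<Rightarrow> real) u. \<Sum>j<Suc (idx u). Lo (idx u) j * om (e j))"
  interpret N: prob_space N unfolding N_def by (rule prob_space_std_normal_PiM[OF e])
  \<comment> \<open>Coefficients beyond the diagonal vanish, which gives finitely many variables a
    common range of summation.\<close>
  have X_ext: "X om u = (\<Sum>j<n. Lo (idx u) j * om (e j))" if "idx u < n" for om u n
    unfolding X_def
  proof (rule sum.mono_neutral_left)
    show "{..<Suc (idx u)} \<subseteq> {..<n}" using that by auto
    show "\<forall>j\<in>{..<n} - {..<Suc (idx u)}. Lo (idx u) j * om (e j) = 0" using Lo(1) by auto
  qed simp
  show ?thesis
  proof (rule that)
    show "prob_space N" by unfold_locales
    show "(\<lambda>om. X om u) \<in> borel_measurable N" for u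
      unfolding X_def N_def by (rule measurable_std_normal_PiM[OF e])
    fix F :: "'a set" and u :: "'a \<Rightarrow> 'a" and s :: "'a \<Rightarrow> real"
    assume F: "finite F" and u: "\<And>Y. Y \<in> F \<Longrightarrow> u Y \<in> net_points"
    define V where "V = (\<Sum>Y\<in>F. \<Sum>Y'\<in>F. s Y * s Y' * cov (u Y) (u Y'))"
    obtain n where n: "\<And>Y. Y \<in> F \<Longrightarrow> idx (u Y) < n"
      using finite_nat_set_iff_bounded[of "(\<lambda>Y. idx (u Y)) ` F"] F by auto
    define d where "d = (\<lambda>j. \<Sum>Y\<in>F. s Y * Lo (idx (u Y)) j)"
    have comb: "(\<Sum>Y\<in>F. s Y * X om (u Y)) = (\<Sum>j<n. d j * om (e j))" for om
    proof -
      have "(\<Sum>Y\<in>F. s Y * X om (u Y)) = (\<Sum>Y\<in>F. \<Sum>j<n. s Y * Lo (idx (u Y)) j * om (e j))"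
        using X_ext[OF n] by (intro sum.cong refl) (simp add: sum_distrib_left mult.assoc)
      also have "\<dots> = (\<Sum>j<n. d j * om (e j))"
        unfolding d_def by (subst sum.swap) (simp add: sum_distrib_right)
      finally show ?thesis .
    qed
    have "(\<Sum>j<n. (d j)\<^sup>2) = (\<Sum>j<n. \<Sum>Y\<in>F. \<Sum>Y'\<in>F. s Y * s Y' * (Lo (idx (u Y)) j * Lo (idx (u Y')) j))"
      unfolding d_def power2_eq_square sum_product by (intro sum.cong refl) simp
    also have "\<dots> = (\<Sum>Y\<in>F. \<Sum>Y'\<in>F. \<Sum>j<n. s Y * s Y' * (Lo (idx (u Y)) j * Lo (idx (u Y')) j))"
      by (subst sum.swap) (intro sum.cong refl sum.swap)
    also have "\<dots> = V"
      unfolding V_def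
    proof (intro sum.cong refl)
      fix Y Y' assume Y: "Y \<in> F" "Y' \<in> F"
      have "(\<Sum>j<n. s Y * s Y' * (Lo (idx (u Y)) j * Lo (idx (u Y')) j)) = s Y * s Y' * C (idx (u Y)) (idx (u Y'))"
        using Lo(2)[OF n[OF Y(1)], of "idx (u Y')"] by (simp add: sum_distrib_left)
      also have "C (idx (u Y)) (idx (u Y')) = cov (u Y) (u Y')"
        unfolding C_def using idx u Y by simp
      finally show "(\<Sum>j<n. s Y * s Y' * (Lo (idx (u Y)) j * Lo (idx (u Y')) j)) = s Y * s Y' * cov (u Y) (u Y')" .
    qed
    finally have V: "(\<Sum>j<n. (d j)\<^sup>2) = V" .
    then have "V \<ge> 0" by (metis sum_nonneg zero_le_power2)
    then show "distr N borel (\<lambda>om. \<Sum>Y\<in>F. s Y * X om (u Y)) = centred_normal (\<Sum>Y\<in>F. \<Sum>Y'\<in>F. s Y * s Y' * cov (u Y) (u Y'))"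
      unfolding comb V_def[symmetric]
    proof (intro N.distr_eq_centred_normalI)
      show "(\<lambda>om. \<Sum>j<n. d j * om (e j)) \<in> borel_measurable N"
        unfolding N_def by (rule measurable_std_normal_PiM[OF e])
      show "char (distr N borel (\<lambda>om. \<Sum>j<n. d j * om (e j))) t = exp (- V * t\<^sup>2 / 2)" for t
        unfolding N_def char_std_normal_PiM[OF e] V by simp
    qed
  qed
qed

lemma gaussian_on_net_subgaussian:
  assumes N: "prob_space N" and X: "\<And>u. u \<in> net_points \<Longrightarrow> (\<lambda>om. X om u) \<in> borel_measurable N"
    and law: "\<And>(F :: 'a set) s. finite F \<Longrightarrow> F \<subseteq> net_points \<Longrightarrow>
       distr N borel (\<lambda>om. \<Sum>Y\<in>F. s Y * X om Y) = centred_normal (cov_form F s)"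
  shows "subgaussian N X"
  unfolding subgaussian_def
proof (intro conjI ballI allI impI)
  interpret N: prob_space N by (rule N)
  have tail: "measure N {om\<in>space N. a \<le> \<bar>U om\<bar>} \<le> 2 * exp (- a\<^sup>2 / (2 * v'))"
    if U: "U \<in> borel_measurable N" "distr N borel U = centred_normal v" and v: "0 \<le> v" "v \<le> v'" "v' > 0" "a > 0" for U v v' a
  proof -
    have "measure N {om\<in>space N. a \<le> \<bar>U om\<bar>} = measure (distr N borel U) {x. a \<le> \<bar>x\<bar>}"
      using U(1) by (subst measure_distr) (auto intro!: arg_cong[where f = "measure N"])
    then show ?thesis using centred_normal_tail[OF v] U(2) by simp
  qed
  show "(\<lambda>om. X om u) \<in> borel_measurable N" if "u \<in> net_points" for u by (rule X[OF that])
  show "measure N {om \<in> space N. a \<le> \<bar>X om u\<bar>} \<le> 2 * exp (- a\<^sup>2 / (2 * B\<^sup>2))" if "u \<in> net_points" "a > 0" for u a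
  proof (rule tail)
    have u: "u \<in> K" using that net_points_subset by blast
    show "distr N borel (\<lambda>om. X om u) = centred_normal (cov u u)"
      using law[of "{u}" "\<lambda>_. 1"] that by simp
    show "0 \<le> cov u u" using sum_cov_nonneg[of "{u}" "\<lambda>Y. Y" "\<lambda>_. 1"] u by simp
    show "cov u u \<le> B\<^sup>2" by (rule cov_le[OF u])
  qed (use that X pos in auto)
  fix u v and r a :: real assume uv: "u \<in> net_points" "v \<in> net_points" and r: "0 < r" "0 < a" "dist u v \<le> r"
  show "measure N {om \<in> space N. a \<le> \<bar>X om u - X om v\<bar>} \<le> 2 * exp (- a\<^sup>2 / (2 * (L * r)\<^sup>2))"
  \<comment> \<open>For u = v the set {u, v} collapses and the coefficients 1, -1 no longer encode
    the difference; the event is empty in that case.\<close>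
  proof (cases "u = v")
    case True
    then show ?thesis using r by simp
  next
    case False
    have uvK: "u \<in> K" "v \<in> K" using uv net_points_subset by blast+
    show ?thesis
    proof (rule tail)
      let ?s = "\<lambda>Y. if Y = u then 1 else - 1 :: real"
      have sum: "(\<Sum>Y\<in>{u, v}. \<Sum>Y'\<in>{u, v}. ?s Y * ?s Y' * cov Y Y') = cov u u - 2 * cov u v + cov v v"
        using False cov_sym[of v u] by simp
      have "(\<Sum>Y\<in>{u, v}. ?s Y * X om Y) = X om u - X om v" for om
        using False by simp
      then show "distr N borel (\<lambda>om. X om u - X om v) = centred_normal (cov u u - 2 * cov u v + cov v v)"
        using law[of "{u, v}" ?s] uv unfolding sum by (simp only:) simp
      show "0 \<le> cov u u - 2 * cov u v + cov v v"
        using sum_cov_nonneg[of "{u, v}" "\<lambda>Y. Y" ?s] uvK unfolding sum by auto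
      show "cov u u - 2 * cov u v + cov v v \<le> (L * r)\<^sup>2" by (rule cov_increment_le[OF uvK r(3)])
    qed (use X[OF uv(1)] X[OF uv(2)] r pos in auto)
  qed
qed (rule N)

text \<open>The process on K is the limit of the net values along the chains. These converge on
  \<Omega>, an event of full probability, and the modulus of continuity passes to the limit.\<close>

lemma exists_gaussian:
  fixes e :: "nat \<Rightarrow> 'i"
  assumes e: "inj e"
  obtains N :: "('i \<Rightarrow> real) measure" and G where "gaussian_limit N G"
proof -
  obtain N :: "('i \<Rightarrow> real) measure" and X where N: "prob_space N"
    and X: "\<And>u. u \<in> net_points \<Longrightarrow> (\<lambda>om. X om u) \<in> borel_measurable N"
    and X_law: "\<And>(F :: 'a set) u s. finite F \<Longrightarrow> (\<And>Y. Y \<in> F \<Longrightarrow> u Y \<in> net_points) \<Longrightarrow>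
       distr N borel (\<lambda>om. \<Sum>Y\<in>F. s Y * X om (u Y)) = centred_normal (\<Sum>Y\<in>F. \<Sum>Y'\<in>F. s Y * s Y' * cov (u Y) (u Y'))"
    apply (rule exists_gaussian_on_net[OF e])
    subgoal premises prems for N X
      using prems(2-) by (rule prems(1))
    done
  interpret N: prob_space N by (rule N)
  have sg: "subgaussian N X"
  proof (rule gaussian_on_net_subgaussian[OF N X])
    show "distr N borel (\<lambda>om. \<Sum>Y\<in>F. s Y * X om Y) = centred_normal (cov_form F s)"
      if F: "finite F" "F \<subseteq> net_points" for F s
      using X_law[OF F(1), of "\<lambda>Y. Y" s] F(2) by blast
  qed
  have reg: "regular N X j R \<in> sets N" for j R by (rule regular_sets[OF X])
  \<comment> \<open>One parameter, j = R = n, keeps the union countable and hence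
    measurable.\<close>
  define \<Omega> where "\<Omega> = (\<Union>n. regular N X n (real n))"
  have \<Omega>: "\<Omega> \<in> sets N" unfolding \<Omega>_def using reg by blast
  have reg_\<Omega>: "regular N X j R \<subseteq> \<Omega>" for j R
  proof
    fix om assume om: "om \<in> regular N X j R"
    \<comment> \<open>Raising the level from j to n increases the bound on net values by at most 4,
      so n has to dominate R + 4.\<close>
    define n where "n = max j (nat \<lceil>R + 4\<rceil>)"
    have n: "n \<ge> j" "real n \<ge> R + 4" unfolding n_def by (simp, linarith)
    have "om \<in> regular N X n (real n)"
      unfolding regular_def
    proof (intro CollectI conjI ballI allI impI)
      show "om \<in> space N" using om by (simp add: regular_def)
      show "good i (X om)" if "i \<ge> n" for i using om n that by (simp add: regular_def)
      fix u assume "u \<in> \<pi> n ` K"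
      then obtain Y where Y: "Y \<in> K" "u = \<pi> n Y" by blast
      have "\<bar>X om (\<pi> n Y)\<bar> \<le> R + 4"
      proof (rule good_bound[OF _ n(1) Y(1)])
        show "good i (X om)" if "i \<ge> j" for i using om that by (simp add: regular_def)
        show "\<bar>X om u\<bar> \<le> R" if "u \<in> \<pi> j ` K" for u using om that unfolding regular_def by blast
      qed
      then show "\<bar>X om u\<bar> \<le> real n" using Y n by simp
    qed
    then show "om \<in> \<Omega>" unfolding \<Omega>_def by blast
  qed
  have conv: "convergent (\<lambda>m. X om (\<pi> m Y))" if om: "om \<in> \<Omega>" and Y: "Y \<in> K" for om Y
  proof -
    obtain n where "om \<in> regular N X n (real n)" using om unfolding \<Omega>_def by blast
    then have "\<And>i. i \<ge> n \<Longrightarrow> good i (X om)" by (simp add: regular_def)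
    then show ?thesis using Y by (rule good_imp_convergent)
  qed
  \<comment> \<open>The value 0 off \<Omega> puts every path, and not only almost every path, into
    \<open>linf K\<close>.\<close>
  define G where "G = (\<lambda>om. \<lambda>Y\<in>K. if om \<in> \<Omega> then lim (\<lambda>m. X om (\<pi> m Y)) else 0)"
  have G_lim: "(\<lambda>m. X om (\<pi> m Y)) \<longlonglongrightarrow> G om Y" if "om \<in> \<Omega>" "Y \<in> K" for om Y
    using conv[OF that] that by (simp add: G_def convergent_LIMSEQ_iff)
  have G_meas: "(\<lambda>om. G om Y) \<in> borel_measurable N" if "Y \<in> K" for Y
  proof -
    have [measurable]: "(\<lambda>om. X om (\<pi> m Y)) \<in> borel_measurable N" for m
      by (rule X[OF net_in_net_points[OF that]])
    have [measurable]: "\<Omega> \<in> sets N" by (rule \<Omega>)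
    have "(\<lambda>om. if om \<in> \<Omega> then lim (\<lambda>m. X om (\<pi> m Y)) else 0) \<in> borel_measurable N"
      by measurable
    then show ?thesis using that by (simp add: G_def)
  qed
  have G_reg: "G om \<in> equicont j (R + 4)" if om: "om \<in> regular N X j R" for om j R
  proof (rule good_limit_equicont[where x = "X om"])
    show "good i (X om)" if "i \<ge> j" for i using om that by (simp add: regular_def)
    show "\<bar>X om u\<bar> \<le> R" if "u \<in> \<pi> j ` K" for u using om that unfolding regular_def by blast
    show "(\<lambda>m. X om (\<pi> m Y)) \<longlonglongrightarrow> G om Y" if "Y \<in> K" for Y
      using G_lim reg_\<Omega> om that by blast
  qed (simp add: G_def)
  have G_tail: "measure N (space N - regular N X j R) \<le> tail_bound j R" if "R > 0" for j R
    by (rule subgaussian_tail[OF sg that])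
  have AE_\<Omega>: "AE om in N. om \<in> \<Omega>"
  proof (rule N.AE_prob_1)
    \<comment> \<open>The complement lies outside every regular event, so its measure is below every
      value of \<open>tail_bound\<close>.\<close>
    have "measure N (space N - \<Omega>) \<le> 0"
    proof (rule field_le_epsilon)
      fix \<eta> :: real assume "\<eta> > 0"
      obtain j R where R: "R > 0" "tail_bound j R \<le> \<eta>"
        using tail_bound_small[OF \<open>\<eta> > 0\<close>] by blast
      have "measure N (space N - \<Omega>) \<le> measure N (space N - regular N X j R)"
        using reg_\<Omega>[of j R] reg[of j R] by (intro N.finite_measure_mono) auto
      with G_tail[OF R(1), of j] R(2) show "measure N (space N - \<Omega>) \<le> 0 + \<eta>" by linarith
    qed
    then show "N.prob \<Omega> = 1" using N.prob_compl[OF \<Omega>] N.prob_le_1[of \<Omega>] by linarith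
  qed
  have "gaussian_limit N G"
    unfolding gaussian_limit_def
  proof (intro conjI ballI allI impI)
    show "prob_space N" by (rule N)
    show "(\<lambda>om. G om Y) \<in> borel_measurable N" if "Y \<in> K" for Y by (rule G_meas[OF that])
    show "G \<in> measurable N (linf_borel K)"
    proof (rule measurable_linf_borel)
      \<comment> \<open>Index 0 takes the exceptional event, where the zero path lies in
        \<open>equicont 0 0\<close>; the others cover \<Omega>.\<close>
      let ?E = "\<lambda>n. case n of 0 \<Rightarrow> space N - \<Omega> | Suc n \<Rightarrow> regular N X n (real n)"
      show "?E n \<in> sets N" for n using reg \<Omega> by (cases n) auto
      show "(\<Union>n. ?E n) = space N"
      proof
        show "(\<Union>n. ?E n) \<subseteq> space N"
        proof (rule UN_least)
          show "?E n \<subseteq> space N" for n by (cases n) (auto simp: regular_def)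
        qed
        show "space N \<subseteq> (\<Union>n. ?E n)"
        proof
          fix om assume "om \<in> space N"
          show "om \<in> (\<Union>n. ?E n)"
          proof (cases "om \<in> \<Omega>")
            case True
            then obtain n where "om \<in> regular N X n (real n)" unfolding \<Omega>_def by blast
            then show ?thesis by (intro UN_I[of "Suc n"]) auto
          qed (use \<open>om \<in> space N\<close> in \<open>intro UN_I[of 0], auto\<close>)
        qed
      qed
      show "G om \<in> equicont (case n of 0 \<Rightarrow> 0 | Suc n \<Rightarrow> n) (case n of 0 \<Rightarrow> 0 | Suc n \<Rightarrow> real n + 4)" if "om \<in> ?E n" for n om
      proof (cases n)
        case 0
        then have "om \<notin> \<Omega>" using that by simp
        then show ?thesis using 0 by (simp add: equicont_def G_def)
      next
        case (Suc n)
        then show ?thesis using that G_reg by simp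
      qed
      show "(\<lambda>om. G om Y) \<in> borel_measurable N" if "Y \<in> K" for Y by (rule G_meas[OF that])
    qed
    show "\<exists>E\<in>sets N. measure N (space N - E) \<le> tail_bound j R \<and> (\<forall>om\<in>E. G om \<in> equicont j (R + 4))"
      if "R > 0" for j R
      using G_tail[OF that] G_reg reg by (intro bexI[of _ "regular N X j R"]) auto
    fix F :: "'a set" and s :: "'a \<Rightarrow> real" assume "finite F \<and> F \<subseteq> K"
    then have F: "finite F" "F \<subseteq> K" by simp_all
    then have FK: "Y \<in> F \<Longrightarrow> Y \<in> K" for Y by blast
    define V where "V = (\<lambda>m. \<Sum>Y\<in>F. \<Sum>Y'\<in>F. s Y * s Y' * cov (\<pi> m Y) (\<pi> m Y'))"
    define V0 where "V0 = cov_form F s"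
    define U where "U = (\<lambda>m om. \<Sum>Y\<in>F. s Y * X om (\<pi> m Y))"
    define U0 where "U0 = (\<lambda>om. \<Sum>Y\<in>F. s Y * G om Y)"
    have U[measurable]: "U m \<in> borel_measurable N" for m
      unfolding U_def by (intro borel_measurable_sum borel_measurable_times borel_measurable_const X net_in_net_points FK)
    have U0[measurable]: "U0 \<in> borel_measurable N"
      unfolding U0_def by (intro borel_measurable_sum borel_measurable_times borel_measurable_const G_meas FK)
    have "distr N borel U0 = centred_normal V0"
    proof (rule N.distr_eq_centred_normalI[OF U0])
      show "0 \<le> V0" unfolding V0_def by (rule sum_cov_nonneg[OF F(1) FK])
      fix t :: real
      have chU: "char (distr N borel (U m)) t = exp (- V m * t\<^sup>2 / 2)" for m
      proof -
        have V: "V m \<ge> 0" unfolding V_def by (rule sum_cov_nonneg[OF F(1)]) (use FK net_in in blast)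
        have "distr N borel (U m) = centred_normal (V m)"
          unfolding U_def V_def by (rule X_law[OF F(1)]) (use FK net_in_net_points in blast)
        then show ?thesis by (simp only: char_centred_normal[OF V])
      qed
      have "V \<longlonglongrightarrow> V0"
        unfolding V_def V0_def by (intro tendsto_sum tendsto_mult tendsto_const cov_net_tendsto FK)
      then have lim1: "(\<lambda>m. char (distr N borel (U m)) t) \<longlonglongrightarrow> exp (- V0 * t\<^sup>2 / 2)"
        unfolding chU by (intro tendsto_of_real tendsto_intros) auto
      \<comment> \<open>The characteristic functions at level m have two limits, which must agree:
        one from convergence of the variances, and one by dominated convergence along the
        paths.\<close>
      have "(\<lambda>m. LINT om|N. iexp (t * U m om)) \<longlonglongrightarrow> (LINT om|N. iexp (t * U0 om))"
      proof (rule integral_dominated_convergence[where w = "\<lambda>_. 1"])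
        show "AE om in N. (\<lambda>m. iexp (t * U m om)) \<longlonglongrightarrow> iexp (t * U0 om)"
          using AE_\<Omega>
        proof eventually_elim
          case (elim om)
          have "(\<lambda>m. U m om) \<longlonglongrightarrow> U0 om"
            unfolding U_def U0_def by (intro tendsto_sum tendsto_mult tendsto_const G_lim elim FK)
          then show ?case by (intro tendsto_intros)
        qed
      qed auto
      then have "(\<lambda>m. char (distr N borel (U m)) t) \<longlonglongrightarrow> char (distr N borel U0) t"
        unfolding char_def by (simp add: integral_distr)
      then show "char (distr N borel U0) t = exp (- V0 * t\<^sup>2 / 2)"
        using lim1 LIMSEQ_unique by blast
    qed
    then show "distr N borel (\<lambda>om. \<Sum>Y\<in>F. s Y * G om Y) = centred_normal (cov_form F s)"
      unfolding U0_def V0_def .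
  qed
  then show ?thesis by (rule that)
qed

end

section \<open>The uniform norm, and moments and tightness of the limit\<close>

lemma linf_bdd_above: "x \<in> mspace (linf K) \<Longrightarrow> bdd_above ((\<lambda>Y. \<bar>x Y\<bar>) ` K)"
  unfolding mspace_linf bounded_iff bdd_above_def by auto

lemma linf_norm_triangle:
  assumes x: "x \<in> mspace (linf K)" and y: "y \<in> mspace (linf K)" and K: "K \<noteq> {}"
  shows "linf_norm K x \<le> linf_norm K y + mdist (linf K) x y"
  unfolding mdist_linf[OF x y K] unfolding linf_norm_def
proof (rule cSUP_least[OF K])
  have bdd: "bdd_above ((\<lambda>Y. \<bar>x Y - y Y\<bar>) ` K)"
  proof -
    obtain a b where "\<And>Y. Y \<in> K \<Longrightarrow> \<bar>x Y\<bar> \<le> a" "\<And>Y. Y \<in> K \<Longrightarrow> \<bar>y Y\<bar> \<le> b"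
      using linf_bdd_above[OF x] linf_bdd_above[OF y] unfolding bdd_above_def by auto
    then have le: "\<bar>x Y - y Y\<bar> \<le> a + b" if "Y \<in> K" for Y
      using abs_triangle_ineq4[of "x Y" "y Y"] that by (meson add_mono order_trans)
    show ?thesis by (rule bdd_aboveI2[OF le])
  qed
  fix Y assume Y: "Y \<in> K"
  have "\<bar>x Y\<bar> \<le> \<bar>y Y\<bar> + \<bar>x Y - y Y\<bar>" by linarith
  also have "\<dots> \<le> (SUP Y\<in>K. \<bar>y Y\<bar>) + (SUP Y\<in>K. \<bar>x Y - y Y\<bar>)"
    by (intro add_mono cSUP_upper Y linf_bdd_above[OF y] bdd)
  finally show "\<bar>x Y\<bar> \<le> (SUP Y\<in>K. \<bar>y Y\<bar>) + (SUP Y\<in>K. \<bar>x Y - y Y\<bar>)" .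
qed

lemma continuous_linf_norm:
  assumes "K \<noteq> {}"
  shows "linf_continuous K (linf_norm K)"
proof (rule Lipschitz_1_imp_continuous_map)
  interpret L: Metric_space "mspace (linf K)" "mdist (linf K)"
    by (rule Metric_space_mspace_mdist)
  fix x y assume "x \<in> mspace (linf K)" "y \<in> mspace (linf K)"
  then show "\<bar>linf_norm K x - linf_norm K y\<bar> \<le> mdist (linf K) x y"
    using linf_norm_triangle[of x K y] linf_norm_triangle[of y K x] L.commute[of x y] assms by linarith
qed

text \<open>Boundedness is asked of the scaled function, which is what the empirical process
  provides. For s > 0 it passes to g; for s = 0, that is p = 0, the supremum over g is multiplied by
  zero, whatever its value.\<close>

lemma linf_norm_scale:
  assumes s: "s \<ge> 0" and K: "K \<noteq> {}" and bdd: "bdd_above ((\<lambda>Y. \<bar>s * g Y\<bar>) ` K)"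
  shows "linf_norm K (\<lambda>Y. s * g Y) = s * linf_norm K g"
proof (cases "s = 0")
  case True
  then show ?thesis using K by (simp add: linf_norm_def)
next
  case False
  then have s: "s > 0" using s by simp
  have le: "\<bar>g Y\<bar> \<le> (SUP Y\<in>K. \<bar>s * g Y\<bar>) / s" if "Y \<in> K" for Y
  proof -
    have "\<bar>s * g Y\<bar> \<le> (SUP Y\<in>K. \<bar>s * g Y\<bar>)" by (rule cSUP_upper[OF that bdd])
    then show ?thesis using s by (simp add: abs_mult field_simps)
  qed
  show ?thesis
    unfolding linf_norm_def
  proof (rule antisym)
    show "(SUP Y\<in>K. \<bar>s * g Y\<bar>) \<le> s * (SUP Y\<in>K. \<bar>g Y\<bar>)"
    proof (rule cSUP_least[OF K])
      fix Y assume "Y \<in> K"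
      then have "\<bar>g Y\<bar> \<le> (SUP Y\<in>K. \<bar>g Y\<bar>)"
        by (rule cSUP_upper) (rule bdd_aboveI2[OF le])
      then show "\<bar>s * g Y\<bar> \<le> s * (SUP Y\<in>K. \<bar>g Y\<bar>)" using s by (simp add: abs_mult)
    qed
    have "(SUP Y\<in>K. \<bar>g Y\<bar>) \<le> (SUP Y\<in>K. \<bar>s * g Y\<bar>) / s" by (rule cSUP_least[OF K le])
    then show "s * (SUP Y\<in>K. \<bar>g Y\<bar>) \<le> (SUP Y\<in>K. \<bar>s * g Y\<bar>)" using s by (simp add: field_simps)
  qed
qed

context Lipschitz_class
begin

text \<open>Only laws of scalar combinations are known, so the mixed moment is obtained by
  polarisation from the variance of \<open>G om Y + G om Y'\<close>. Equal points are treated apart,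
  since {Y, Y'} then has one element.\<close>

lemma gaussian_moments:
  assumes NG: "gaussian_limit N G"
    and Y: "Y \<in> K" "Y' \<in> K"
  shows "(LINT om|N. G om Y) = 0" "(LINT om|N. G om Y * G om Y') = cov Y Y'"
proof -
  note G = gaussian_limitD(3)[OF NG] and G_law = gaussian_limitD(4)[OF NG]
  have single: "distr N borel (\<lambda>om. G om Y) = centred_normal (cov Y Y)" if "Y \<in> K" for Y
    using G_law[of "{Y}" "\<lambda>_. 1"] that by simp
  have cov0: "0 \<le> cov Y Y" if "Y \<in> K" for Y
    using sum_cov_nonneg[of "{Y}" "\<lambda>Y. Y" "\<lambda>_. 1"] that by simp
  have transfer: "integrable N U \<and> (LINT om|N. U om) = 0 \<and> integrable N (\<lambda>om. (U om)\<^sup>2) \<and> (LINT om|N. (U om)\<^sup>2) = v"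
    if U: "U \<in> borel_measurable N" "distr N borel U = centred_normal v" "v \<ge> 0" for U v
  proof -
    have id: "(\<lambda>x::real. x) \<in> borel_measurable borel" by simp
    have sq: "(\<lambda>x::real. x\<^sup>2) \<in> borel_measurable borel" by measurable
    show ?thesis
      using centred_normal_moments[OF U(3)] unfolding U(2)[symmetric]
      by (simp only: integrable_distr_eq[OF U(1) id] integral_distr[OF U(1) id]
          integrable_distr_eq[OF U(1) sq] integral_distr[OF U(1) sq] simp_thms)
  qed
  note tr = transfer[OF G single cov0]
  show "(LINT om|N. G om Y) = 0" using tr[OF Y(1) Y(1) Y(1)] by blast
  show "(LINT om|N. G om Y * G om Y') = cov Y Y'"
  proof (cases "Y = Y'")
    case True
    then show ?thesis using tr[OF Y(1) Y(1) Y(1)] by (simp add: power2_eq_square)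
  next
    case False
    have sum: "(\<Sum>y\<in>{Y, Y'}. \<Sum>y'\<in>{Y, Y'}. 1 * 1 * cov y y') = cov Y Y + 2 * cov Y Y' + cov Y' Y'"
      using False cov_sym[of Y' Y] by simp
    have law2: "distr N borel (\<lambda>om. G om Y + G om Y') = centred_normal (cov Y Y + 2 * cov Y Y' + cov Y' Y')"
      using G_law[of "{Y, Y'}" "\<lambda>_. 1"] Y False unfolding sum by simp
    have nn: "0 \<le> cov Y Y + 2 * cov Y Y' + cov Y' Y'"
      using sum_cov_nonneg[of "{Y, Y'}" "\<lambda>Y. Y" "\<lambda>_. 1"] Y unfolding sum by auto
    have meas: "(\<lambda>om. G om Y + G om Y') \<in> borel_measurable N" using G Y by simp
    note t3 = transfer[OF meas law2 nn]
    note t1 = tr[OF Y(1) Y(1) Y(1)] and t2 = tr[OF Y(2) Y(2) Y(2)]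
    have "(\<lambda>om. G om Y * G om Y') = (\<lambda>om. ((G om Y + G om Y')\<^sup>2 - (G om Y)\<^sup>2 - (G om Y')\<^sup>2) / 2)"
      by (simp add: power2_eq_square algebra_simps)
    then have "(LINT om|N. G om Y * G om Y') = ((LINT om|N. (G om Y + G om Y')\<^sup>2) - (LINT om|N. (G om Y)\<^sup>2) - (LINT om|N. (G om Y')\<^sup>2)) / 2"
      using t1 t2 t3 by simp
    then show ?thesis using t1 t2 t3 by simp
  qed
qed

text \<open>The sets of \<open>compactin_linf_equicont\<close> carry almost all the mass. Being
  compact in a Hausdorff space they are closed, hence Borel, so the image law can be evaluated on
  them.\<close>

lemma gaussian_tight:
  assumes NG: "gaussian_limit N G"
  shows "linf_tight K (distr N (linf_borel K) G)"
  unfolding linf_tight_def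
proof (intro allI impI)
  note G = gaussian_limitD(2)[OF NG] and G_tight = gaussian_limitD(5)[OF NG]
  interpret N: prob_space N by (rule gaussian_limitD(1)[OF NG])
  fix \<epsilon> :: real assume "\<epsilon> > 0"
  obtain j R where R: "R > 0" "tail_bound j R \<le> \<epsilon>"
    using tail_bound_small[OF \<open>\<epsilon> > 0\<close>] by blast
  obtain E where E: "E \<in> sets N" "measure N (space N - E) \<le> \<epsilon>" "\<And>om. om \<in> E \<Longrightarrow> G om \<in> equicont j (R + 4)"
    using G_tight[OF R(1), of j] R(2) by (meson order_trans)
  have "closedin (mtopology_of (linf K)) (equicont j (R + 4))"
    using compactin_linf_equicont Metric_space.Hausdorff_space_mtopology[OF Metric_space_mspace_mdist]
    unfolding mtopology_of_def by (intro compactin_imp_closedin)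
  then have "openin (mtopology_of (linf K)) (mspace (linf K) - equicont j (R + 4))"
    unfolding closedin_def topspace_linf by (rule conjunct2)
  then have "space (linf_borel K) - (mspace (linf K) - equicont j (R + 4)) \<in> sets (linf_borel K)"
    by (intro sets.compl_sets openin_linf_sets)
  moreover have "space (linf_borel K) - (mspace (linf K) - equicont j (R + 4)) = equicont j (R + 4)"
    unfolding space_linf_borel using equicont_subset_linf by blast
  ultimately have C: "equicont j (R + 4) \<in> sets (linf_borel K)" by (simp only:)
  have "1 - \<epsilon> \<le> measure N E" using E(2) N.prob_compl[OF E(1)] by linarith
  also have "\<dots> \<le> measure N (G -` equicont j (R + 4) \<inter> space N)"
    using E(3) sets.sets_into_space[OF E(1)] by (intro N.finite_measure_mono measurable_sets[OF G C]) blast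
  also have "\<dots> = measure (distr N (linf_borel K) G) (equicont j (R + 4))"
    by (rule measure_distr[OF G C, symmetric])
  finally show "\<exists>C. compactin (mtopology_of (linf K)) C \<and> 1 - \<epsilon> \<le> measure (distr N (linf_borel K) G) C"
    using compactin_linf_equicont by blast
qed

end

text \<open>The Donsker theorem for a bounded Lipschitz class indexed by a set with nets of
  geometric growth. The type of the coordinates of the underlying probability space is left open; it
  has only to contain a copy of the natural numbers.\<close>

theorem (in Lipschitz_sample) uniform_central_limit_theorem:
  fixes e :: "nat \<Rightarrow> 'i"
  assumes "inj e"
  obtains N :: "('i \<Rightarrow> real) measure" and G where "prob_space N" "gaussian_process N K G"
    "\<And>Y. Y \<in> K \<Longrightarrow> (LINT om|N. G om Y) = 0"
    "\<And>Y Y'. Y \<in> K \<Longrightarrow> Y' \<in> K \<Longrightarrow> covariance N (\<lambda>om. G om Y) (\<lambda>om. G om Y') = cov Y Y'"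
    "converges_in_law_linf K M (\<lambda>p om. Emp p om) N G"
    "converges_in_law M (\<lambda>p om. linf_norm K (Emp p om)) N (\<lambda>om. linf_norm K (G om))"
proof -
  obtain N :: "('i \<Rightarrow> real) measure" and G where NG: "gaussian_limit N G"
    by (rule exists_gaussian[OF assms])
  note N = gaussian_limitD(1)[OF NG] and G = gaussian_limitD(2)[OF NG]
    and Gm = gaussian_limitD(3)[OF NG] and G_law = gaussian_limitD(4)[OF NG]
  interpret N: prob_space N by (rule N)
  note lim = emp_functional_tendsto[OF NG] and mom = gaussian_moments[OF NG]
  have norm_cont: "linf_continuous K (linf_norm K)"
    by (rule continuous_linf_norm[OF K_nonempty])
  have X_norm: "(\<lambda>om. linf_norm K (Emp p om)) \<in> borel_measurable M" for p
    by (rule measurable_compose[OF emp_measurable_linf linf_borel_functional_measurable[OF norm_cont]])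
  have G_norm: "(\<lambda>om. linf_norm K (G om)) \<in> borel_measurable N"
    by (rule measurable_compose[OF G linf_borel_functional_measurable[OF norm_cont]])
  have X_in: "Emp p om \<in> mspace (linf K)" if "om \<in> space M" for p om
    using measurable_space[OF emp_measurable_linf that] by (simp only: space_linf_borel)
  show ?thesis
  proof (rule that[OF N])
    show "gaussian_process N K G"
      unfolding gaussian_process_def
    proof (intro conjI ballI allI impI)
      show "(\<lambda>om. G om Y) \<in> borel_measurable N" if "Y \<in> K" for Y by (rule Gm[OF that])
      fix F :: "'a set" and s :: "'a \<Rightarrow> real" assume F: "finite F \<and> F \<subseteq> K"
      then have FK: "Y \<in> F \<Longrightarrow> Y \<in> K" for Y by blast
      show "gaussian_measure (distr N borel (\<lambda>om. \<Sum>Y\<in>F. s Y * G om Y))"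
        unfolding G_law[OF conjunct1[OF F] conjunct2[OF F]]
        by (intro gaussian_measure_centred_normal sum_cov_nonneg FK conjunct1[OF F])
    qed
    show mean0: "(LINT om|N. G om Y) = 0" if "Y \<in> K" for Y by (rule mom(1)[OF that that])
    show "covariance N (\<lambda>om. G om Y) (\<lambda>om. G om Y') = cov Y Y'" if "Y \<in> K" "Y' \<in> K" for Y Y'
      unfolding covariance_def mean0[OF that(1)] mean0[OF that(2)] using mom(2)[OF that] by simp
    show "converges_in_law_linf K M (\<lambda>p om. Emp p om) N G"
      unfolding converges_in_law_linf_def
    proof (intro conjI allI ballI impI)
      show "Emp p om \<in> mspace (linf K)" if "om \<in> space M" for p om by (rule X_in[OF that])
      show "G \<in> measurable N (linf_borel K)" by (rule G)
      show "linf_tight K (distr N (linf_borel K) G)" by (rule gaussian_tight[OF NG])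
      fix H assume H: "linf_continuous K H \<and> bounded (H ` mspace (linf K))"
      then obtain b where b: "\<And>x. x \<in> mspace (linf K) \<Longrightarrow> \<bar>H x\<bar> \<le> b"
        unfolding bounded_iff by auto
      have "outer_expectation M (\<lambda>om. H (Emp p om)) = (LINT om|M. H (Emp p om))" for p
      proof (rule M.outer_expectation_eq, rule M.integrable_const_bound)
        show "AE om in M. norm (H (Emp p om)) \<le> b"
          by (rule AE_I2) (simp only: real_norm_def b[OF X_in])
        show "(\<lambda>om. H (Emp p om)) \<in> borel_measurable M"
          by (rule measurable_compose[OF emp_measurable_linf linf_borel_functional_measurable[OF conjunct1[OF H]]])
      qed
      then show "(\<lambda>p. outer_expectation M (\<lambda>om. H (Emp p om))) \<longlonglongrightarrow> (LINT om|N. H (G om))"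
        using lim[OF conjunct1[OF H] conjunct2[OF H]] by (simp only:)
    qed
    show "converges_in_law M (\<lambda>p om. linf_norm K (Emp p om)) N (\<lambda>om. linf_norm K (G om))"
      unfolding converges_in_law_def
    proof (intro conjI allI X_norm G_norm)
      \<comment> \<open>Continuous mapping: a bounded continuous g of the uniform norm is itself a
        bounded continuous functional on \<open>linf K\<close>.\<close>
      show "weak_conv_m (\<lambda>p. distr M borel (\<lambda>om. linf_norm K (Emp p om))) (distr N borel (\<lambda>om. linf_norm K (G om)))"
      proof (rule integral_bdd_continuous_conv_imp_weak_conv)
        show "real_distribution (distr M borel (\<lambda>om. linf_norm K (Emp p om)))" for p
          by (rule M.real_distribution_distr[OF X_norm])
        show "real_distribution (distr N borel (\<lambda>om. linf_norm K (G om)))"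
          by (rule N.real_distribution_distr[OF G_norm])
        fix g :: "real \<Rightarrow> real" assume g: "\<And>x. isCont g x" "\<And>x. \<bar>g x\<bar> \<le> 1"
        have gc: "continuous_on UNIV g" using g(1) by (simp add: continuous_at_imp_continuous_on)
        then have gm: "g \<in> borel_measurable borel" by (rule borel_measurable_continuous_onI)
        have "linf_continuous K (\<lambda>x. g (linf_norm K x))"
          using continuous_map_compose[OF norm_cont, of euclideanreal g] gc by (simp add: comp_def)
        moreover have "bounded ((\<lambda>x. g (linf_norm K x)) ` mspace (linf K))"
          using g(2) unfolding bounded_iff by auto
        ultimately have "(\<lambda>p. LINT om|M. g (linf_norm K (Emp p om))) \<longlonglongrightarrow> (LINT om|N. g (linf_norm K (G om)))"
          by (rule lim)
        then show "(\<lambda>p. LINT x|distr M borel (\<lambda>om. linf_norm K (Emp p om)). g x)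
            \<longlonglongrightarrow> (LINT x|distr N borel (\<lambda>om. linf_norm K (G om)). g x)"
          by (simp only: integral_distr[OF X_norm gm] integral_distr[OF G_norm gm])
      qed
    qed
  qed
qed

section \<open>The sliced Wasserstein energy\<close>

theorem theorem2p4:
  fixes M :: "'a measure"
    and \<theta> :: "nat \<Rightarrow> 'a \<Rightarrow> real^'d"
    and Z :: "real^'d^'n"
    and K :: "(real^'d^'n) set"
  assumes "prob_space M"
    and "prob_space.indep_vars M (\<lambda>_. sphere_uniform) \<theta> UNIV"
    and "\<And>i. distr M sphere_uniform (\<theta> i) = sphere_uniform"
    and "compact K" and "K \<noteq> {}"
  shows "\<exists>(N :: (real^'d^'n \<Rightarrow> real) measure) G.
      prob_space N \<and>
      gaussian_process N K G \<and>
      (\<forall>Y\<in>K. (LINT \<omega>|N. G \<omega> Y) = 0) \<and>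
      (\<forall>Y\<in>K. \<forall>Y'\<in>K. covariance N (\<lambda>\<omega>. G \<omega> Y) (\<lambda>\<omega>. G \<omega> Y') =
         (LINT t|sphere_uniform. w Z t Y * w Z t Y') - \<E> Z Y * \<E> Z Y') \<and>
      converges_in_law_linf K M
        (\<lambda>p \<omega>. \<lambda>Y\<in>K. sqrt (real p) * (\<E>_emp Z (\<lambda>i. \<theta> i \<omega>) p Y - \<E> Z Y)) N G \<and>
      converges_in_law M
        (\<lambda>p \<omega>. sqrt (real p) * linf_norm K (\<lambda>Y. \<E>_emp Z (\<lambda>i. \<theta> i \<omega>) p Y - \<E> Z Y))
        N (\<lambda>\<omega>. linf_norm K (G \<omega>))"
proof -
  obtain \<pi> c A q where net: "dyadic_net K \<pi> c" "\<And>j. real (card (\<pi> j ` K)) \<le> A * q ^ j" "A > 0" "q > 0"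
    apply (rule compact_dyadic_net[OF assms(4,5)])
    subgoal premises prems for \<pi> c A q
      using prems(2-) by (rule prems(1))
    done
  obtain R where R: "\<And>Y. Y \<in> K \<Longrightarrow> norm Y \<le> R" "R > 0"
    using compact_imp_bounded[OF assms(4)] unfolding bounded_pos by blast
  \<comment> \<open>The constants of \<open>w_bound\<close> and \<open>w_Lipschitz\<close> for
    clouds of norm at most R; R > 0 keeps both positive even when Z = 0.\<close>
  define B where "B = (R + norm Z)\<^sup>2"
  define L where "L = 2 * (R + norm Z)"
  have RZ: "R + norm Z > 0" using R(2) by (simp add: add_pos_nonneg)
  interpret M: prob_space M by (rule assms(1))
  interpret S: prob_space "sphere_uniform :: (real^'d) measure" by (rule prob_space_sphere_uniform)
  interpret net: dyadic_net K \<pi> c by (rule net(1))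
  interpret Lipschitz_sample K \<pi> c sphere_uniform "\<lambda>Y t. w Z t Y" B L A q M \<theta>
  proof unfold_locales
    show "(\<lambda>t. w Z t Y) \<in> borel_measurable sphere_uniform" for Y by (rule w_measurable)
    show "\<bar>w Z t Y\<bar> \<le> B" if "Y \<in> K" "t \<in> space sphere_uniform" for Y t
      unfolding B_def using that R(1) by (intro w_bound) auto
    show "\<bar>w Z t Y - w Z t Y'\<bar> \<le> L * dist Y Y'" if "Y \<in> K" "Y' \<in> K" "t \<in> space sphere_uniform" for Y Y' t
      unfolding L_def using that R(1) by (intro w_Lipschitz) auto
    show "B > 0" "L > 0" using RZ by (simp_all add: B_def L_def)
  qed (rule net assms)+
  \<comment> \<open>Constant matrices embed the natural numbers into the index type and so label the
    coordinates that carry the normals.\<close>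
  have "inj (\<lambda>k::nat. \<chi> i j. real k :: real^'d^'n)"
    by (rule injI) (simp add: vec_eq_iff)
  then obtain N :: "(real^'d^'n \<Rightarrow> real) measure" and G where NG: "prob_space N" "gaussian_process N K G"
    "\<And>Y. Y \<in> K \<Longrightarrow> (LINT \<omega>|N. G \<omega> Y) = 0"
    "\<And>Y Y'. Y \<in> K \<Longrightarrow> Y' \<in> K \<Longrightarrow> covariance N (\<lambda>\<omega>. G \<omega> Y) (\<lambda>\<omega>. G \<omega> Y') = cov Y Y'"
    "converges_in_law_linf K M (\<lambda>p \<omega>. restrict (emp p \<omega>) K) N G"
    "converges_in_law M (\<lambda>p \<omega>. linf_norm K (restrict (emp p \<omega>) K)) N (\<lambda>\<omega>. linf_norm K (G \<omega>))"
    apply (rule uniform_central_limit_theorem)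
    subgoal premises prems for N G
      using prems(2-) by (rule prems(1))
    done
  have mean_eq: "mean Y = \<E> Z Y" for Y by (simp add: mean_def \<E>_def)
  have emp_eq: "emp p \<omega> = (\<lambda>Y. sqrt (real p) * (\<E>_emp Z (\<lambda>i. \<theta> i \<omega>) p Y - \<E> Z Y))" for p \<omega>
    by (simp add: emp_def empirical_def \<E>_emp_def mean_eq fun_eq_iff)
  \<comment> \<open>Moving the factor out of the supremum takes boundedness of the path, which is
    known for outcomes in \<open>space M\<close>; measurability and laws depend on these outcomes
    only.\<close>
  have norm_eq: "linf_norm K (restrict (emp p \<omega>) K) = sqrt (real p) * linf_norm K (\<lambda>Y. \<E>_emp Z (\<lambda>i. \<theta> i \<omega>) p Y - \<E> Z Y)"
    if \<omega>: "\<omega> \<in> space M" for p \<omega>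
  proof -
    have "restrict (emp p \<omega>) K \<in> mspace (linf K)"
      using measurable_space[OF emp_measurable_linf \<omega>] by (simp only: space_linf_borel)
    from linf_bdd_above[OF this] have "bdd_above ((\<lambda>Y. \<bar>emp p \<omega> Y\<bar>) ` K)"
      by (simp cong: image_cong_simp)
    then have "linf_norm K (emp p \<omega>) = sqrt (real p) * linf_norm K (\<lambda>Y. \<E>_emp Z (\<lambda>i. \<theta> i \<omega>) p Y - \<E> Z Y)"
      unfolding emp_eq by (intro linf_norm_scale assms(5)) auto
    moreover have "linf_norm K (restrict (emp p \<omega>) K) = linf_norm K (emp p \<omega>)"
      unfolding linf_norm_def by (simp cong: image_cong_simp)
    ultimately show ?thesis by (simp only:)
  qed
  have "converges_in_law M (\<lambda>p \<omega>. sqrt (real p) * linf_norm K (\<lambda>Y. \<E>_emp Z (\<lambda>i. \<theta> i \<omega>) p Y - \<E> Z Y))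
        N (\<lambda>\<omega>. linf_norm K (G \<omega>))"
    using NG(6) unfolding converges_in_law_def
    by (simp only: norm_eq simp_thms cong: measurable_cong distr_cong)
  with NG show ?thesis
    by (intro exI[of _ N] exI[of _ G]) (simp add: emp_eq cov_def mean_eq)
qed

end
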